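(* Let $0<\alpha<1<\beta$ and $a\in(0,1)$. Let $j>k\geq 1$ be integers and, for $p\in P_{\alpha,\beta}$, let $\nu(p)=\lambda_j(p)$ and $\lambda(p)=\lambda_k(p)$ be the $j$-th and $k$-th eigenvalues of the weighted eigenvalue problem described in the context. Then the maximum problem $$\sup_{p\in P_{\alpha,\beta}}\frac{\nu(p)}{\lambda(p)}$$ admits a solution, i.e. the supremum is attained at some $\widehat p\in P_{\alpha,\beta}$.
   Context: $I=(-\pi,\pi)$. For $0<\alpha<1<\beta$, $$P_{\alpha, \beta}:=\Big\{p\in L^\infty(I):\ \int_I p\,dx=2\pi,\ \alpha\leq p\leq\beta \text{ and } p(x)=p(-x) \text{ a.e. in } I\Big\}.$$ For $a\in(0,1)$, $V(I):=\{u\in H^2(I)\cap H^1_0(I): u(\pm a\pi)=0\}$. The weighted eigenvalue problem is $$e''''=\lambda\, p\, e \text{ in } I,\qquad e(\pm\pi)=e''(\pm\pi)=0,\qquad e(\pm a\pi)=0,$$ in the weak sense: $e\in V(I)$ and $\int_I e''v''\,dx=\lambda\int_I p\,ev\,dx$ for all $v\in V(I)$. For each $p\in P_{\alpha,\beta}$ its eigenvalues are positive and simple and form a strictly increasing divergent sequence $\lambda_1(p)<\lambda_2(p)<\cdots$. *)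

theory Defs
  imports "HOL-Analysis.Analysis"
begin

abbreviation beam :: "real set" where
  "beam \<equiv> {-pi<..<pi}"

abbreviation beam_measure :: "real measure" where
  "beam_measure \<equiv> lebesgue_on beam"

text \<open>
  Elements of Lebesgue and Sobolev spaces on the interval are represented by functions
  on the whole real line; their values outside the interval are irrelevant, and functions that
  agree almost everywhere on the interval represent the same element.
\<close>

definition L2 :: "(real \<Rightarrow> real) set" where
  "L2 = {u. u \<in> borel_measurable beam_measure \<and> integrable beam_measure (\<lambda>x. (u x)\<^sup>2)}"

definition test_function :: "(real \<Rightarrow> real) \<Rightarrow> bool" where
  "test_function \<phi> \<longleftrightarrow>
     (\<forall>n x. (deriv ^^ n) \<phi> differentiable (at x)) \<and>
     (\<exists>K. compact K \<and> K \<subseteq> beam \<and> (\<forall>x. x \<notin> K \<longrightarrow> \<phi> x = 0))"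

text \<open>
  Square integrability of both functions is part of the following relation, so that all
  the integrals involved exist (the Bochner integral of a non-integrable function is 0).
\<close>

definition has_weak_deriv :: "(real \<Rightarrow> real) \<Rightarrow> (real \<Rightarrow> real) \<Rightarrow> bool" where
  "has_weak_deriv u g \<longleftrightarrow> u \<in> L2 \<and> g \<in> L2 \<and>
     (\<forall>\<phi>. test_function \<phi> \<longrightarrow>
        (LINT x|beam_measure. u x * deriv \<phi> x) = - (LINT x|beam_measure. g x * \<phi> x))"

text \<open>A weak derivative is unique up to equality almost everywhere; a version is chosen.\<close>

definition weak_deriv :: "(real \<Rightarrow> real) \<Rightarrow> real \<Rightarrow> real" where
  "weak_deriv u = (SOME g. has_weak_deriv u g)"

definition H1 :: "(real \<Rightarrow> real) set" where
  "H1 = {u. \<exists>g. has_weak_deriv u g}"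

definition H2 :: "(real \<Rightarrow> real) set" where
  "H2 = {u. \<exists>g h. has_weak_deriv u g \<and> has_weak_deriv g h}"

definition H1_norm :: "(real \<Rightarrow> real) \<Rightarrow> real" where
  "H1_norm u = sqrt ((LINT x|beam_measure. (u x)\<^sup>2) + (LINT x|beam_measure. (weak_deriv u x)\<^sup>2))"

definition H10 :: "(real \<Rightarrow> real) set" where
  "H10 = {u \<in> H1. \<forall>\<epsilon>>0. \<exists>\<phi>. test_function \<phi> \<and> H1_norm (\<lambda>x. u x - \<phi> x) < \<epsilon>}"

text \<open>
  Every class in \<open>H\<^sup>2\<close> has exactly one representative that is continuous on the interval.
  The pointwise conditions at the piers refer to it, so the space consists of these representatives.
\<close>

definition V :: "real \<Rightarrow> (real \<Rightarrow> real) set" where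
  "V a = {u \<in> H2 \<inter> H10. continuous_on beam u \<and> u (a * pi) = 0 \<and> u (- a * pi) = 0}"

text \<open>The bounds below make every admissible weight essentially bounded.\<close>

definition weights :: "real \<Rightarrow> real \<Rightarrow> (real \<Rightarrow> real) set" where
  "weights \<alpha> \<beta> = {p. p \<in> borel_measurable beam_measure \<and>
     (LINT x|beam_measure. p x) = 2 * pi \<and>
     (AE x in beam_measure. \<alpha> \<le> p x \<and> p x \<le> \<beta>) \<and>
     (AE x in beam_measure. p x = p (- x))}"

definition is_eigenvalue :: "real \<Rightarrow> (real \<Rightarrow> real) \<Rightarrow> real \<Rightarrow> bool" where
  "is_eigenvalue a p l \<longleftrightarrow>
     (\<exists>e \<in> V a. (\<exists>x \<in> beam. e x \<noteq> 0) \<and>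
        (\<forall>v \<in> V a.
           (LINT x|beam_measure. weak_deriv (weak_deriv e) x * weak_deriv (weak_deriv v) x)
             = l * (LINT x|beam_measure. p x * e x * v x)))"

text \<open>
  The eigenvalues being simple, the \<open>j\<close>-th one, for \<open>j \<ge> 1\<close>, is the \<open>j\<close>-th smallest element
  of the set of eigenvalues. As \<open>card\<close> is 0 on infinite sets, the condition for \<open>j \<ge> 1\<close> also says
  that only finitely many eigenvalues lie below.
\<close>

definition nth_eigenvalue :: "real \<Rightarrow> (real \<Rightarrow> real) \<Rightarrow> nat \<Rightarrow> real" where
  "nth_eigenvalue a p j =
     (THE l. is_eigenvalue a p l \<and> card {m. is_eigenvalue a p m \<and> m \<le> l} = j)"

end

theory Submission
  imports Defs "HOL-Complex_Analysis.Great_Picard"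
begin

text \<open>
  A continuous real function on a sequentially compact space attains its supremum. The proof finds a
  topology on the weights for which both halves of this hold: a sequence of weights \<open>p\<close>
  converges when the primitives \<open>x \<mapsto> \<integral>\<^sub>-\<^sub>\<pi>\<^sup>x p\<close> converge uniformly, which for bounded weights is
  weak-* convergence.

  Compactness (\<open>weights_compact\<close>). The primitives of the weights are equi-Lipschitz, so the
  Arzela-Ascoli theorem gives a uniformly convergent subsequence. The limit is again the primitive of
  a weight: the weights whose primitives are within \<open>1/n\<close> of the limit form decreasing nonempty
  convex sets, and elements of nearly minimal norm of these sets form a Cauchy sequence in
  \<open>L\<^sup>2\<close> by the parallelogram identity (\<open>weights_closed\<close>).

  Continuity (\<open>eigenvalue_lipschitz\<close>). The reciprocal of an eigenvalue is a minimax value of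
  the Rayleigh quotient \<open>\<integral>pu\<^sup>2 / \<integral>(u'')\<^sup>2\<close>. Since \<open>u\<^sup>2\<close> has the derivative \<open>2uu'\<close>,
  which is bounded by a multiple of \<open>\<integral>(u'')\<^sup>2\<close>, integration by parts shows that replacing the
  weight changes the quotient by at most a constant times the uniform distance \<open>d\<close> of the
  primitives. Hence \<open>1/\<lambda>\<^sub>n\<close> changes by at most a constant times \<open>d\<close>
  (\<open>spectral_comparison\<close>).

  For this the \<open>n\<close>-th smallest element of the set of eigenvalues has to be the reciprocal of the
  \<open>n\<close>-th minimax value, so the set must be shown to be an increasing sequence without
  multiplicities. An element of the space \<open>V\<close> is \<open>u = -Kh\<close>, where \<open>h = u''\<close>, \<open>K\<close> is the
  Green operator of \<open>-d\<^sup>2/dx\<^sup>2\<close> with Dirichlet conditions, and \<open>h\<close> is orthogonal to the two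
  piecewise linear functions that represent the evaluations at the piers (\<open>V_imp_K\<close>,
  \<open>K_imp_V\<close>). With \<open>\<Pi>\<close> the projection onto the orthogonal complement of these two, the weak
  problem with eigenvalue \<open>l\<close> says that \<open>f = l K \<Pi> K(p f)\<close>. The operator
  \<open>f \<mapsto> K \<Pi> K(p f)\<close> on continuous functions is compact, symmetric and positive for the inner
  product \<open>\<integral>pfg\<close>, and for such operators maximizing the quadratic form successively on
  orthogonal complements yields all positive eigenvalues (\<open>spectral_sequence\<close>,
  \<open>spectral_complete\<close>).

  Two eigenfunctions with the same eigenvalue have a nontrivial combination with zero slope at
  \<open>-\<pi>\<close>. Such a function vanishes (\<open>clamped_eigenfunction_zero\<close>): on the first span it starts
  with \<open>u = u' = u'' = 0\<close>, and the fourth derivative is a positive multiple of \<open>p u\<close>. So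
  \<open>u\<close> takes the strict sign of its third derivative at \<open>-\<pi>\<close> and could not return to zero at the
  pier unless this number is 0. The same argument then applies from pier to pier, where only the third
  derivative may jump.
\<close>

section \<open>The eigenvalues of a compact positive operator\<close>

lemma discriminant_bound:
  fixes a b c :: real
  assumes q: "\<And>t. 0 \<le> a + 2 * t * b + t\<^sup>2 * c" and "0 \<le> c"
  shows "b\<^sup>2 \<le> a * c"
proof (cases "c = 0")
  case True
  have "b = 0"
  proof (rule ccontr)
    assume "b \<noteq> 0"
    then show False
      using q[of "- (a + 1) / (2 * b)"] True by (simp add: field_simps)
  qed
  with True show ?thesis by simp
next
  case False
  then have "c > 0" using \<open>0 \<le> c\<close> by simp
  then show ?thesis
    using q[of "- b / c"] by (simp add: field_simps power2_eq_square)
qed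

text \<open>
  Fewer equations than unknowns. Eliminating one unknown with a nonzero coefficient removes one
  equation and one unknown at a time.
\<close>

lemma homogeneous_system:
  fixes A :: "'j \<Rightarrow> 'i \<Rightarrow> real"
  assumes "finite J" "finite I" "card J < card I"
  shows "\<exists>c. (\<exists>i\<in>I. c i \<noteq> 0) \<and> (\<forall>j\<in>J. (\<Sum>i\<in>I. c i * A j i) = 0)"
  using assms
proof (induction J arbitrary: I A rule: finite_induct)
  case empty
  then have "I \<noteq> {}" by auto
  then show ?case by (intro exI[of _ "\<lambda>_. 1"]) auto
next
  case (insert j J)
  show ?case
  proof (cases "\<forall>i\<in>I. A j i = 0")
    case True
    have "card J < card I" using insert by simp
    then obtain c where "\<exists>i\<in>I. c i \<noteq> 0" "\<forall>j\<in>J. (\<Sum>i\<in>I. c i * A j i) = 0"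
      using insert.IH[of I A] insert.prems by blast
    then show ?thesis using True by (intro exI[of _ c]) auto
  next
    case False
    then obtain k where k: "k \<in> I" "A j k \<noteq> 0" by blast
    define B where "B l i = A l i - A l k * A j i / A j k" for l i
    have "card J < card (I - {k})" using insert k by simp
    then obtain c where c: "\<exists>i\<in>I - {k}. c i \<noteq> 0" "\<And>l. l \<in> J \<Longrightarrow> (\<Sum>i\<in>I - {k}. c i * B l i) = 0"
      using insert.IH[of "I - {k}" B] insert.prems by blast
    define d where "d = c(k := - (\<Sum>i\<in>I - {k}. c i * A j i) / A j k)"
    have split: "(\<Sum>i\<in>I. d i * A l i) = d k * A l k + (\<Sum>i\<in>I - {k}. c i * A l i)" for l
    proof -
      have "(\<Sum>i\<in>I. d i * A l i) = d k * A l k + (\<Sum>i\<in>I - {k}. d i * A l i)"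
        using k insert.prems by (simp add: sum.remove)
      also have "(\<Sum>i\<in>I - {k}. d i * A l i) = (\<Sum>i\<in>I - {k}. c i * A l i)"
        by (rule sum.cong) (auto simp: d_def)
      finally show ?thesis .
    qed
    have "(\<Sum>i\<in>I. d i * A j i) = 0"
      unfolding split using k by (simp add: d_def)
    moreover have "(\<Sum>i\<in>I. d i * A l i) = 0" if "l \<in> J" for l
    proof -
      have "(\<Sum>i\<in>I - {k}. c i * B l i)
          = (\<Sum>i\<in>I - {k}. c i * A l i) - (\<Sum>i\<in>I - {k}. c i * A j i) * (A l k / A j k)"
        unfolding B_def sum_distrib_right sum_subtractf[symmetric]
        by (rule sum.cong) (auto simp: algebra_simps)
      then show ?thesis
        unfolding split using c(2)[OF that] by (simp add: d_def)
    qed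
    moreover have "\<exists>i\<in>I. d i \<noteq> 0" using c(1) by (auto simp: d_def)
    ultimately show ?thesis by (intro exI[of _ d]) auto
  qed
qed

text \<open>
  The form \<open>ip\<close> is semidefinite because the intended vectors are functions on the real line with
  an inner product that sees only their values on an interval. Convergence of images of bounded
  sequences is compactness of the operator, and the last assumption says that it has infinite rank,
  by way of a sequence of vectors on whose span the quadratic form is definite.
\<close>

locale compact_positive =
  fixes ip :: "'v::real_vector \<Rightarrow> 'v \<Rightarrow> real" and T :: "'v \<Rightarrow> 'v"
  assumes ip_sym: "ip x y = ip y x"
    and ip_add: "ip (x + y) z = ip x z + ip y z"
    and ip_scale: "ip (c *\<^sub>R x) y = c * ip x y"
    and ip_nonneg: "0 \<le> ip x x"
    and T_sym: "ip (T x) y = ip x (T y)"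
    and T_pos: "0 \<le> ip (T x) x"
    and T_bounded: "\<exists>C. \<forall>x. ip (T x) x \<le> C * ip x x"
    and T_compact: "(\<And>n. ip (f n) (f n) \<le> 1) \<Longrightarrow>
          \<exists>r w. strict_mono (r :: nat \<Rightarrow> nat) \<and>
            (\<lambda>n. ip (T (f (r n)) - w) (T (f (r n)) - w)) \<longlonglongrightarrow> 0"
    and T_rank: "\<exists>v. \<forall>(n::nat) c. (\<exists>i\<le>n. c i \<noteq> 0) \<longrightarrow>
          0 < ip (T (\<Sum>i\<le>n. c i *\<^sub>R v i)) (\<Sum>i\<le>n. c i *\<^sub>R v i)"
begin

lemma ip_add': "ip z (x + y) = ip z x + ip z y"
  by (metis ip_sym ip_add)

lemma ip_scale': "ip y (c *\<^sub>R x) = c * ip y x"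
  by (metis ip_sym ip_scale)

lemma ip_diff: "ip (x - y) z = ip x z - ip y z"
  using ip_add[of "x - y" y z] by simp

lemma ip_diff': "ip z (x - y) = ip z x - ip z y"
  by (metis ip_sym ip_diff)

lemma ip_sum: "ip (\<Sum>i\<in>A. h i) z = (\<Sum>i\<in>A. ip (h i) z)"
proof -
  have "ip 0 z = 0"
    using ip_add[of 0 0 z] by simp
  then show ?thesis
    by (induction A rule: infinite_finite_induct) (auto simp: ip_add)
qed

lemma ip_cauchy_schwarz: "(ip x y)\<^sup>2 \<le> ip x x * ip y y"
proof (rule discriminant_bound)
  fix t
  show "0 \<le> ip x x + 2 * t * ip x y + t\<^sup>2 * ip y y"
    using ip_nonneg[of "x + t *\<^sub>R y"] ip_sym[of y x]
    by (simp add: ip_add ip_add' ip_scale ip_scale' power2_eq_square algebra_simps)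
qed (rule ip_nonneg)

lemma ip_null: "ip x x = 0 \<Longrightarrow> ip x y = 0"
  using ip_cauchy_schwarz[of x y] by simp

lemma T_add_ip: "ip (T (x + y)) z = ip (T x) z + ip (T y) z"
  by (simp add: T_sym ip_add)

lemma T_scale_ip: "ip (T (c *\<^sub>R x)) z = c * ip (T x) z"
  by (simp add: T_sym ip_scale)

lemma T_cauchy_schwarz: "(ip (T x) y)\<^sup>2 \<le> ip (T x) x * ip (T y) y"
proof (rule discriminant_bound)
  fix t
  show "0 \<le> ip (T x) x + 2 * t * ip (T x) y + t\<^sup>2 * ip (T y) y"
    using T_pos[of "x + t *\<^sub>R y"] ip_sym[of y "T x"] T_sym[of y x]
    by (simp add: T_add_ip T_scale_ip ip_add' ip_scale' power2_eq_square algebra_simps)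
qed (rule T_pos)

lemma ip_triangle: "ip (x - z) (x - z) \<le> 2 * ip (x - y) (x - y) + 2 * ip (y - z) (y - z)"
proof -
  have *: "ip (u + v) (u + v) \<le> 2 * ip u u + 2 * ip v v" for u v
    using ip_nonneg[of "u - v"] by (simp add: ip_add ip_add' ip_diff ip_diff')
  show ?thesis
    using *[of "x - y" "y - z"] by simp
qed

lemma ip_tendsto:
  assumes "(\<lambda>n. ip (x n - w) (x n - w)) \<longlonglongrightarrow> 0"
  shows "(\<lambda>n. ip (x n) y) \<longlonglongrightarrow> ip w y"
proof -
  have "(\<lambda>n. ip (x n - w) y) \<longlonglongrightarrow> 0"
  proof (rule Lim_null_comparison)
    show "\<forall>\<^sub>F n in sequentially. norm (ip (x n - w) y) \<le> sqrt (ip (x n - w) (x n - w) * ip y y)"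
      using ip_cauchy_schwarz[of _ y] by (auto intro!: always_eventually real_le_rsqrt)
    show "(\<lambda>n. sqrt (ip (x n - w) (x n - w) * ip y y)) \<longlonglongrightarrow> 0"
      using tendsto_real_sqrt[OF tendsto_mult[OF assms tendsto_const[of "ip y y"]]] by simp
  qed
  from tendsto_add[OF this tendsto_const[of "ip w y"]] show ?thesis
    by (simp add: ip_diff)
qed

lemma ip_self_tendsto:
  assumes "(\<lambda>n. ip (x n - w) (x n - w)) \<longlonglongrightarrow> 0"
  shows "(\<lambda>n. ip (x n) (x n)) \<longlonglongrightarrow> ip w w"
proof -
  have "(\<lambda>n. ip (x n - w) (x n - w) + 2 * ip (x n) w - ip w w) \<longlonglongrightarrow> 0 + 2 * ip w w - ip w w"
    by (intro tendsto_intros assms ip_tendsto)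
  moreover have "ip (x n - w) (x n - w) + 2 * ip (x n) w - ip w w = ip (x n) (x n)" for n
    using ip_sym[of w "x n"] by (simp add: ip_diff ip_diff')
  ultimately show ?thesis by simp
qed

lemma positive_orthogonal_to:
  "\<exists>f. (\<forall>i<(n::nat). ip f (y i) = 0) \<and> 0 < ip (T f) f"
proof -
  obtain v where v: "(\<exists>i\<le>n. c i \<noteq> 0) \<Longrightarrow>
      0 < ip (T (\<Sum>i\<le>n. c i *\<^sub>R v i)) (\<Sum>i\<le>n. c i *\<^sub>R v i)" for n :: nat and c
    using T_rank by blast
  obtain c where c: "\<exists>i\<in>{..n}. c i \<noteq> 0" "\<forall>j\<in>{..<n}. (\<Sum>i\<in>{..n}. c i * ip (v i) (y j)) = 0"
    using homogeneous_system[of "{..<n}" "{..n}" "\<lambda>j i. ip (v i) (y j)"] by auto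
  show ?thesis
    using c v[where n=n and c=c]
    by (intro exI[of _ "\<Sum>i\<le>n. c i *\<^sub>R v i"]) (auto simp: ip_sum ip_scale)
qed

text \<open>
  The eigenvector equation holds only up to null vectors of the form, hence is tested against all
  vectors.
\<close>

definition eigenpair :: "'v \<Rightarrow> real \<Rightarrow> bool" where
  "eigenpair e m \<longleftrightarrow> (\<forall>x. ip (T e) x = m * ip e x)"

text \<open>
  One step of the successive maximization. A maximizing sequence \<open>f\<close> in the unit ball satisfies
  \<open>T f - m f \<rightarrow> 0\<close>, because \<open>\<parallel>T f\<parallel>\<^sup>2 \<le> m \<langle>T f, f\<rangle>\<close>. So a limit of \<open>T f\<close> along a
  subsequence, which compactness provides, is also a limit of \<open>m f\<close> and hence an eigenvector.
\<close>

lemma maximizer_exists: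
  assumes e: "\<And>i. i < (n::nat) \<Longrightarrow> \<exists>m. eigenpair (e i) m"
  shows "\<exists>w. ip w w = 1 \<and> (\<forall>i<n. ip w (e i) = 0) \<and> 0 < ip (T w) w \<and> eigenpair w (ip (T w) w) \<and>
           (\<forall>x. (\<forall>i<n. ip x (e i) = 0) \<longrightarrow> ip (T x) x \<le> ip (T w) w * ip x x)"
proof -
  define S where "S = {x. \<forall>i<n. ip x (e i) = 0}"
  have TS: "T x \<in> S" if "x \<in> S" for x
    unfolding S_def
  proof safe
    fix i assume "i < n"
    then obtain m where "eigenpair (e i) m" using e by blast
    then have "ip (T x) (e i) = m * ip x (e i)"
      by (metis T_sym eigenpair_def ip_sym)
    then show "ip (T x) (e i) = 0" using that \<open>i < n\<close> by (simp add: S_def)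
  qed
  obtain C where C: "ip (T x) x \<le> C * ip x x" for x
    using T_bounded by blast
  define Q where "Q = {ip (T x) x |x. x \<in> S \<and> ip x x \<le> 1}"
  define m where "m = Sup Q"
  have Q0: "0 \<in> Q"
  proof -
    have z: "ip 0 z = 0" for z using ip_add[of 0 0 z] by simp
    have "ip (T 0) 0 = 0" by (simp add: T_sym z)
    then show ?thesis unfolding Q_def S_def using z by (auto intro!: exI[of _ 0])
  qed
  have bdd: "bdd_above Q"
  proof (rule bdd_aboveI)
    fix q assume "q \<in> Q"
    then obtain x where "q = ip (T x) x" "ip x x \<le> 1" by (auto simp: Q_def)
    then show "q \<le> \<bar>C\<bar>"
      using C[of x] mult_mono[of C "\<bar>C\<bar>" "ip x x" 1] ip_nonneg[of x] by linarith
  qed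
  have le: "ip (T x) x \<le> m * ip x x" if "x \<in> S" for x
  proof (cases "ip x x = 0")
    case True
    then show ?thesis using C[of x] by simp
  next
    case False
    define c where "c = 1 / sqrt (ip x x)"
    have pos: "ip x x > 0" using False ip_nonneg[of x] by simp
    have c2: "c * c = 1 / ip x x" using pos by (simp add: c_def)
    have cc: "c * (c * y) = y / ip x x" for y
      using c2 by (metis mult.assoc times_divide_eq_left mult_1)
    have "ip (T (c *\<^sub>R x)) (c *\<^sub>R x) \<in> Q"
      unfolding Q_def using that pos
      by (intro CollectI exI[of _ "c *\<^sub>R x"])
         (auto simp: S_def ip_scale ip_scale' cc)
    then have "ip (T (c *\<^sub>R x)) (c *\<^sub>R x) \<le> m"
      unfolding m_def by (rule cSup_upper[OF _ bdd])
    then have "ip (T x) x / ip x x \<le> m"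
      by (simp add: T_scale_ip ip_scale' cc)
    then show ?thesis
      using pos by (simp add: pos_divide_le_eq)
  qed
  have mpos: "m > 0"
  proof -
    obtain f where f: "f \<in> S" "0 < ip (T f) f"
      using positive_orthogonal_to[of n e] by (auto simp: S_def)
    have "0 < m * ip f f" using le[OF f(1)] f(2) by linarith
    then show ?thesis using ip_nonneg[of f] by (simp add: zero_less_mult_iff)
  qed
  \<comment> \<open>Cauchy-Schwarz for the semi-inner product \<open>ip (T x) y\<close>.\<close>
  have le2: "ip (T x) (T x) \<le> m * ip (T x) x" if "x \<in> S" for x
  proof (cases "ip (T x) (T x) = 0")
    case True
    then show ?thesis using mpos T_pos by simp
  next
    case False
    then have p: "ip (T x) (T x) > 0" using ip_nonneg[of "T x"] by simp
    have "(ip (T x) (T x))\<^sup>2 \<le> ip (T x) x * ip (T (T x)) (T x)"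
      by (rule T_cauchy_schwarz)
    also have "\<dots> \<le> ip (T x) x * (m * ip (T x) (T x))"
      by (intro mult_left_mono le TS that T_pos)
    finally have "ip (T x) (T x) * ip (T x) (T x) \<le> (m * ip (T x) x) * ip (T x) (T x)"
      by (simp add: power2_eq_square mult_ac)
    then show ?thesis using p by simp
  qed
  have "\<exists>f. f \<in> S \<and> ip f f \<le> 1 \<and> m - 1 / real (Suc k) < ip (T f) f" for k
  proof -
    have "m - 1 / real (Suc k) < Sup Q" by (simp add: m_def)
    then obtain q where "q \<in> Q" "m - 1 / real (Suc k) < q"
      using less_cSup_iff[OF _ bdd] Q0 by blast
    then show ?thesis unfolding Q_def by blast
  qed
  then obtain f where f: "\<And>k. f k \<in> S" "\<And>k. ip (f k) (f k) \<le> 1"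
      and fm: "\<And>k. m - 1 / real (Suc k) < ip (T (f k)) (f k)"
    by metis
  have flim: "(\<lambda>k. ip (T (f k)) (f k)) \<longlonglongrightarrow> m"
  proof (rule tendsto_sandwich)
    show "(\<lambda>k. m - 1 / real (Suc k)) \<longlonglongrightarrow> m"
      using tendsto_diff[OF tendsto_const[of m] LIMSEQ_Suc[OF lim_1_over_n]] by simp
    show "\<forall>\<^sub>F k in sequentially. m - 1 / real (Suc k) \<le> ip (T (f k)) (f k)"
      by (intro always_eventually allI less_imp_le fm)
    show "\<forall>\<^sub>F k in sequentially. ip (T (f k)) (f k) \<le> m"
    proof (intro always_eventually allI)
      fix k
      show "ip (T (f k)) (f k) \<le> m"
        using le[OF f(1)[of k]] mult_left_mono[OF f(2)[of k], of m] mpos by linarith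
    qed
  qed simp
  obtain r w where r: "strict_mono r"
      and w: "(\<lambda>k. ip (T (f (r k)) - w) (T (f (r k)) - w)) \<longlonglongrightarrow> 0"
    using T_compact[of f] f(2) by blast
  have flim': "(\<lambda>k. ip (T (f (r k))) (f (r k))) \<longlonglongrightarrow> m"
    using LIMSEQ_subseq_LIMSEQ[OF flim r] by (simp add: o_def)
  have almost: "ip (T (f k) - m *\<^sub>R f k) (T (f k) - m *\<^sub>R f k) \<le> m * (m - ip (T (f k)) (f k))" for k
  proof -
    have "ip (T (f k) - m *\<^sub>R f k) (T (f k) - m *\<^sub>R f k)
        = ip (T (f k)) (T (f k)) - 2 * m * ip (T (f k)) (f k) + m * m * ip (f k) (f k)"
      using ip_sym[of "f k" "T (f k)"]
      by (simp add: ip_diff ip_diff' ip_scale ip_scale' algebra_simps)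
    also have "\<dots> \<le> m * ip (T (f k)) (f k) - 2 * m * ip (T (f k)) (f k) + m * m * 1"
      using mpos by (intro add_mono diff_mono mult_left_mono le2 f) auto
    finally show ?thesis by (simp add: algebra_simps)
  qed
  have mf: "(\<lambda>k. ip (m *\<^sub>R f (r k) - w) (m *\<^sub>R f (r k) - w)) \<longlonglongrightarrow> 0"
  proof (rule tendsto_sandwich[OF _ _ tendsto_const])
    show "\<forall>\<^sub>F k in sequentially. 0 \<le> ip (m *\<^sub>R f (r k) - w) (m *\<^sub>R f (r k) - w)"
      by (simp add: ip_nonneg)
    show "\<forall>\<^sub>F k in sequentially. ip (m *\<^sub>R f (r k) - w) (m *\<^sub>R f (r k) - w)
       \<le> 2 * (m * (m - ip (T (f (r k))) (f (r k)))) + 2 * ip (T (f (r k)) - w) (T (f (r k)) - w)"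
    proof (rule always_eventually, rule allI)
      fix k
      have "ip (m *\<^sub>R f (r k) - T (f (r k))) (m *\<^sub>R f (r k) - T (f (r k)))
          = ip (T (f (r k)) - m *\<^sub>R f (r k)) (T (f (r k)) - m *\<^sub>R f (r k))"
        by (simp add: ip_diff ip_diff')
      then show "ip (m *\<^sub>R f (r k) - w) (m *\<^sub>R f (r k) - w)
       \<le> 2 * (m * (m - ip (T (f (r k))) (f (r k)))) + 2 * ip (T (f (r k)) - w) (T (f (r k)) - w)"
        using ip_triangle[of "m *\<^sub>R f (r k)" w "T (f (r k))"] almost[of "r k"] by linarith
    qed
    have "(\<lambda>k. 2 * (m * (m - ip (T (f (r k))) (f (r k)))) + 2 * ip (T (f (r k)) - w) (T (f (r k)) - w))
        \<longlonglongrightarrow> 2 * (m * (m - m)) + 2 * 0"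
      by (intro tendsto_intros flim' w)
    then show "(\<lambda>k. 2 * (m * (m - ip (T (f (r k))) (f (r k)))) + 2 * ip (T (f (r k)) - w) (T (f (r k)) - w))
        \<longlonglongrightarrow> 0" by simp
  qed
  have eig: "ip (T w) x = m * ip w x" for x
  proof -
    have "(\<lambda>k. ip (m *\<^sub>R f (r k)) (T x)) \<longlonglongrightarrow> ip w (T x)"
      by (rule ip_tendsto[OF mf])
    moreover have "ip (m *\<^sub>R f (r k)) (T x) = m * ip (T (f (r k))) x" for k
      by (simp add: ip_scale T_sym)
    moreover have "(\<lambda>k. m * ip (T (f (r k))) x) \<longlonglongrightarrow> m * ip w x"
      by (intro tendsto_intros ip_tendsto[OF w])
    ultimately have "ip w (T x) = m * ip w x"
      by (simp add: LIMSEQ_unique)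
    then show ?thesis by (simp add: T_sym)
  qed
  have wS: "ip w (e i) = 0" if "i < n" for i
    using ip_tendsto[OF w, of "e i"] TS[OF f(1)] that by (simp add: S_def LIMSEQ_const_iff)
  have wpos: "ip w w > 0"
  proof -
    have "(ip (T (f k)) (f k))\<^sup>2 \<le> ip (T (f k)) (T (f k))" for k
      using ip_cauchy_schwarz[of "T (f k)" "f k"] mult_left_mono[OF f(2) ip_nonneg[of "T (f k)"], of k]
      by simp
    moreover have "(\<lambda>k. (ip (T (f (r k))) (f (r k)))\<^sup>2) \<longlonglongrightarrow> m\<^sup>2"
      by (intro tendsto_intros flim')
    ultimately have "m\<^sup>2 \<le> ip w w"
      using LIMSEQ_le[OF _ ip_self_tendsto[OF w]] by blast
    then show ?thesis using mpos by (smt (verit) zero_less_power)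
  qed
  define v where "v = (1 / sqrt (ip w w)) *\<^sub>R w"
  have v1: "ip v v = 1"
    using wpos by (simp add: v_def ip_scale ip_scale')
  have veig: "ip (T v) x = m * ip v x" for x
    by (simp add: v_def T_scale_ip ip_scale eig)
  show ?thesis
    using v1 veig wS mpos le
    by (intro exI[of _ v]) (auto simp: eigenpair_def S_def v_def ip_scale)
qed

text \<open>
  The eigenvalues tend to 0 because the images of an orthonormal sequence of eigenvectors with
  eigenvalues at least \<open>L > 0\<close> have mutual distance at least \<open>\<surd>2 L\<close> and thus no Cauchy
  subsequence.
\<close>

theorem spectral_sequence:
  "\<exists>e m. (\<forall>i j. ip (e i) (e j) = (if i = j then 1 else 0)) \<and>
     (\<forall>i. eigenpair (e i) (m i)) \<and> (\<forall>i. 0 < m i) \<and> decseq m \<and> m \<longlonglongrightarrow> 0 \<and>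
     (\<forall>n x. (\<forall>i<n. ip x (e i) = 0) \<longrightarrow> ip (T x) x \<le> m n * ip x x)"
proof -
  define P where "P e (n::nat) w \<longleftrightarrow> ip w w = 1 \<and> (\<forall>i<n. ip w (e i) = 0) \<and> 0 < ip (T w) w \<and>
      eigenpair w (ip (T w) w) \<and>
      (\<forall>x. (\<forall>i<n. ip x (e i) = 0) \<longrightarrow> ip (T x) x \<le> ip (T w) w * ip x x)" for e n w
  have "\<exists>e. \<forall>n. P e n (e n)"
  proof (rule dependent_wellorder_choice)
    fix r and f g :: "nat \<Rightarrow> 'v" and n :: nat
    assume "\<And>i. i < n \<Longrightarrow> f i = g i"
    then show "P f n r = P g n r" by (auto simp: P_def)
  next
    fix n and f :: "nat \<Rightarrow> 'v"
    assume "\<And>i. i < n \<Longrightarrow> P f i (f i)"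
    then have "\<exists>m. eigenpair (f i) m" if "i < n" for i
      using that by (auto simp: P_def)
    from maximizer_exists[of n f, OF this] show "\<exists>r. P f n r"
      by (auto simp: P_def)
  qed
  then obtain e where e: "\<And>n. P e n (e n)" by blast
  define m where "m n = ip (T (e n)) (e n)" for n
  have orth: "ip (e i) (e j) = (if i = j then 1 else 0)" for i j
    using e[of i] e[of j] ip_sym[of "e i" "e j"] by (cases i j rule: linorder_cases) (auto simp: P_def)
  have eig: "eigenpair (e i) (m i)" and pos: "0 < m i" for i
    using e[of i] by (auto simp: P_def m_def)
  have max: "ip (T x) x \<le> m n * ip x x" if "\<And>i. i < n \<Longrightarrow> ip x (e i) = 0" for n x
    using e[of n] that by (auto simp: P_def m_def)
  have dec: "decseq m"
  proof (rule decseq_SucI)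
    fix n
    show "m (Suc n) \<le> m n"
      using max[of n "e (Suc n)"] by (simp add: orth m_def)
  qed
  have lim: "m \<longlonglongrightarrow> 0"
  proof -
    obtain L where L: "m \<longlonglongrightarrow> L" "\<And>i. L \<le> m i"
      using decseq_convergent[OF dec, of 0] pos by (auto intro: less_imp_le)
    have "L \<ge> 0" using LIMSEQ_le_const[OF L(1), of 0] pos by (auto intro: less_imp_le)
    obtain r w where r: "strict_mono r"
        and w: "(\<lambda>k. ip (T (e (r k)) - w) (T (e (r k)) - w)) \<longlonglongrightarrow> 0"
      using T_compact[of e] by (auto simp: orth)
    have far: "2 * L\<^sup>2 \<le> ip (T (e i) - T (e j)) (T (e i) - T (e j))" if "i \<noteq> j" for i j
    proof -
      have Tij: "ip (T (e i)) (T (e j)) = m i * m j * ip (e i) (e j)" for i j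
        using eig[of i] eig[of j] unfolding eigenpair_def
        by (metis ip_sym mult.assoc)
      have "ip (T (e i) - T (e j)) (T (e i) - T (e j)) = (m i)\<^sup>2 + (m j)\<^sup>2"
        using that by (simp add: ip_diff ip_diff' Tij orth power2_eq_square)
      moreover have "L\<^sup>2 \<le> (m i)\<^sup>2" "L\<^sup>2 \<le> (m j)\<^sup>2"
        using L(2) \<open>L \<ge> 0\<close> by (auto intro: power_mono)
      ultimately show ?thesis by simp
    qed
    have bound: "2 * L\<^sup>2 \<le> 2 * ip (T (e (r k)) - w) (T (e (r k)) - w)
        + 2 * ip (T (e (r (Suc k))) - w) (T (e (r (Suc k))) - w)" for k
    proof -
      have "r k \<noteq> r (Suc k)" using r by (metis lessI less_irrefl strict_mono_less)
      moreover have "ip (w - T (e (r (Suc k)))) (w - T (e (r (Suc k))))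
          = ip (T (e (r (Suc k))) - w) (T (e (r (Suc k))) - w)"
        by (simp add: ip_diff ip_diff')
      ultimately show ?thesis
        using far[of "r k" "r (Suc k)"] ip_triangle[of "T (e (r k))" "T (e (r (Suc k)))" w] by linarith
    qed
    have "(\<lambda>k. 2 * ip (T (e (r k)) - w) (T (e (r k)) - w)
        + 2 * ip (T (e (r (Suc k))) - w) (T (e (r (Suc k))) - w)) \<longlonglongrightarrow> 2 * 0 + 2 * 0"
      by (intro tendsto_intros w LIMSEQ_Suc[OF w])
    then have "2 * L\<^sup>2 \<le> 2 * 0 + 2 * 0"
      using LIMSEQ_le_const bound by blast
    then have "L = 0" by simp
    with L(1) show ?thesis by simp
  qed
  show ?thesis
    using orth eig pos dec lim max by blast
qed

end

section \<open>Square-integrable functions and their primitives\<close>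

lemma finite_measure_beam: "finite_measure beam_measure"
  by (intro finite_measure_lebesgue_on) (simp add: lmeasurable_interval)

interpretation beam: finite_measure beam_measure
  by (rule finite_measure_beam)

lemma measure_beam [simp]: "measure beam_measure beam = 2 * pi"
  by (simp add: measure_restrict_space)

lemma integral_const_beam: "(LINT x|beam_measure. (c::real)) = 2 * pi * c"
  using measure_beam by simp

lemma borel_measurable_beam:
  "f \<in> borel_measurable borel \<Longrightarrow> f \<in> borel_measurable beam_measure"
  by (intro measurable_restrict_space1 measurable_completion) simp

lemma ident_measurable_beam [measurable]: "(\<lambda>x. x) \<in> borel_measurable beam_measure"
  by (rule borel_measurable_beam) simp

lemma AE_beam_neq: "AE x in beam_measure. x \<noteq> y"
  using AE_completion[OF AE_lborel_singleton[of y]] by (auto simp: AE_restrict_space_iff)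

lemma L2D:
  assumes "f \<in> L2"
  shows "f \<in> borel_measurable beam_measure" "integrable beam_measure (\<lambda>x. (f x)\<^sup>2)"
  using assms by (auto simp: L2_def)

lemma L2_mult_integrable:
  assumes f: "f \<in> L2" and g: "g \<in> L2"
  shows "integrable beam_measure (\<lambda>x. f x * g x)"
proof (rule Bochner_Integration.integrable_bound)
  note [measurable] = L2D(1)[OF f] L2D(1)[OF g]
  show "integrable beam_measure (\<lambda>x. (f x)\<^sup>2 + (g x)\<^sup>2)"
    using L2D[OF f] L2D[OF g] by auto
  show "(\<lambda>x. f x * g x) \<in> borel_measurable beam_measure" by measurable
  have "\<bar>u * v\<bar> \<le> u\<^sup>2 + v\<^sup>2" for u v :: real
  proof -
    have "2 * (\<bar>u\<bar> * \<bar>v\<bar>) \<le> u\<^sup>2 + v\<^sup>2"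
      using sum_squares_bound[of "\<bar>u\<bar>" "\<bar>v\<bar>"] by simp
    moreover have "0 \<le> \<bar>u\<bar> * \<bar>v\<bar>" by simp
    ultimately show ?thesis unfolding abs_mult by linarith
  qed
  then show "AE x in beam_measure. norm (f x * g x) \<le> norm ((f x)\<^sup>2 + (g x)\<^sup>2)"
    by (auto simp: abs_of_nonneg)
qed

lemma L2_bounded:
  assumes [measurable]: "f \<in> borel_measurable beam_measure"
    and "AE x in beam_measure. \<bar>f x\<bar> \<le> C"
  shows "f \<in> L2"
proof -
  have "integrable beam_measure (\<lambda>x. (f x)\<^sup>2)"
  proof (rule beam.integrable_const_bound)
    show "AE x in beam_measure. norm ((f x)\<^sup>2) \<le> C\<^sup>2"
      using assms(2) by eventually_elim (simp add: abs_le_square_iff[symmetric])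
  qed measurable
  then show ?thesis by (simp add: L2_def)
qed

lemma L2_const [simp]: "(\<lambda>x. c) \<in> L2"
  by (rule L2_bounded[where C="\<bar>c\<bar>"]) auto

lemma L2_integrable: "f \<in> L2 \<Longrightarrow> integrable beam_measure f"
  using L2_mult_integrable[OF _ L2_const[of 1]] by simp

lemma L2_add: assumes f: "f \<in> L2" and g: "g \<in> L2" shows "(\<lambda>x. f x + g x) \<in> L2"
proof -
  note [measurable] = L2D(1)[OF f] L2D(1)[OF g]
  have "integrable beam_measure (\<lambda>x. (f x)\<^sup>2 + (g x)\<^sup>2 + 2 * (f x * g x))"
    using L2D[OF f] L2D[OF g] L2_mult_integrable[OF f g] by auto
  then have "integrable beam_measure (\<lambda>x. (f x + g x)\<^sup>2)"
    by (simp add: power2_sum mult.assoc)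
  then show ?thesis by (simp add: L2_def)
qed

lemma L2_bounded_mult:
  assumes f: "f \<in> L2" and [measurable]: "h \<in> borel_measurable beam_measure"
    and "AE x in beam_measure. \<bar>h x\<bar> \<le> C"
  shows "(\<lambda>x. h x * f x) \<in> L2"
proof -
  note [measurable] = L2D(1)[OF f]
  have "integrable beam_measure (\<lambda>x. (h x * f x)\<^sup>2)"
  proof (rule Bochner_Integration.integrable_bound)
    show "integrable beam_measure (\<lambda>x. C\<^sup>2 * (f x)\<^sup>2)" using L2D[OF f] by auto
    show "AE x in beam_measure. norm ((h x * f x)\<^sup>2) \<le> norm (C\<^sup>2 * (f x)\<^sup>2)"
      using assms(3)
    proof eventually_elim
      fix x assume "\<bar>h x\<bar> \<le> C"
      then have "(h x)\<^sup>2 \<le> C\<^sup>2" by (simp add: abs_le_square_iff[symmetric])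
      then show "norm ((h x * f x)\<^sup>2) \<le> norm (C\<^sup>2 * (f x)\<^sup>2)"
        by (simp add: power_mult_distrib mult_right_mono)
    qed
  qed measurable
  then show ?thesis by (simp add: L2_def)
qed

lemma L2_cmult: "f \<in> L2 \<Longrightarrow> (\<lambda>x. c * f x) \<in> L2"
  by (rule L2_bounded_mult[where C="\<bar>c\<bar>"]) auto

lemma L2_diff: "f \<in> L2 \<Longrightarrow> g \<in> L2 \<Longrightarrow> (\<lambda>x. f x - g x) \<in> L2"
  using L2_add[of f "\<lambda>x. (-1) * g x"] L2_cmult[of g "-1"] by simp

lemma L2_uminus: "f \<in> L2 \<Longrightarrow> (\<lambda>x. - f x) \<in> L2"
  using L2_cmult[of f "-1"] by simp

lemma L2_sum: "(\<And>i. i \<in> A \<Longrightarrow> f i \<in> L2) \<Longrightarrow> (\<lambda>x. \<Sum>i\<in>A. f i x) \<in> L2"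
  by (induction A rule: infinite_finite_induct) (auto intro: L2_add)

lemma L2_continuous:
  assumes "continuous_on {-pi..pi} f"
  shows "f \<in> L2"
proof -
  have "compact (f ` {-pi..pi})"
    using assms by (intro compact_continuous_image) auto
  then obtain C where C: "\<And>x. x \<in> {-pi..pi} \<Longrightarrow> \<bar>f x\<bar> \<le> C"
    by (meson bounded_real compact_imp_bounded imageI)
  have "f \<in> borel_measurable beam_measure"
    by (rule continuous_imp_measurable_on_sets_lebesgue)
       (auto intro: continuous_on_subset[OF assms])
  then show ?thesis
    by (rule L2_bounded[where C=C]) (use C in auto)
qed

lemma L2_cong_AE:
  assumes "f \<in> L2" "g \<in> borel_measurable beam_measure" "AE x in beam_measure. f x = g x"
  shows "g \<in> L2"
proof -
  note [measurable] = L2D(1)[OF assms(1)] assms(2)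
  have "integrable beam_measure (\<lambda>x. (g x)\<^sup>2) \<longleftrightarrow> integrable beam_measure (\<lambda>x. (f x)\<^sup>2)"
    by (rule integrable_cong_AE) (use assms(3) in auto)
  then show ?thesis using assms by (simp add: L2_def)
qed

lemma L2_cauchy_schwarz:
  assumes f: "f \<in> L2" and g: "g \<in> L2"
  shows "(LINT x|beam_measure. f x * g x)\<^sup>2
       \<le> (LINT x|beam_measure. (f x)\<^sup>2) * (LINT x|beam_measure. (g x)\<^sup>2)"
proof -
  have *: "0 \<le> (LINT x|beam_measure. (f x)\<^sup>2) + 2 * t * (LINT x|beam_measure. f x * g x)
      + t\<^sup>2 * (LINT x|beam_measure. (g x)\<^sup>2)" for t
  proof -
    have "0 \<le> (LINT x|beam_measure. (f x + t * g x)\<^sup>2)"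
      by (rule integral_nonneg_AE) simp
    also have "\<dots> = (LINT x|beam_measure. (f x)\<^sup>2 + 2 * t * (f x * g x) + t\<^sup>2 * (g x)\<^sup>2)"
      by (rule Bochner_Integration.integral_cong) (auto simp: power2_eq_square algebra_simps)
    also have "\<dots> = (LINT x|beam_measure. (f x)\<^sup>2) + 2 * t * (LINT x|beam_measure. f x * g x)
      + t\<^sup>2 * (LINT x|beam_measure. (g x)\<^sup>2)"
      using L2D[OF f] L2D[OF g] L2_mult_integrable[OF f g] by simp
    finally show ?thesis .
  qed
  show ?thesis
    by (rule discriminant_bound[OF *]) (rule integral_nonneg_AE, simp)
qed

lemma L2_null:
  assumes f: "f \<in> L2" and "(LINT x|beam_measure. (f x)\<^sup>2) = 0"
  shows "AE x in beam_measure. f x = 0"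
  using integral_nonneg_eq_0_iff_AE[OF L2D(2)[OF f]] assms(2) by simp

text \<open>
  The integral from \<open>-\<pi>\<close> to \<open>x\<close>, written over the whole interval so that it makes
  sense for every real \<open>x\<close> and is constant outside the interval.
\<close>

definition primitive :: "(real \<Rightarrow> real) \<Rightarrow> real \<Rightarrow> real" where
  "primitive g x = (LINT t|beam_measure. (if t < x then g t else 0))"

lemma L2_restrict:
  assumes f: "f \<in> L2" and [measurable]: "Measurable.pred beam_measure P"
  shows "(\<lambda>t. if P t then f t else 0) \<in> L2"
proof -
  have "(\<lambda>t. (if P t then 1 else 0) * f t) \<in> L2"
    by (rule L2_bounded_mult[where C=1, OF f]) auto
  then show ?thesis by (simp add: if_distrib[of "\<lambda>c. c * _"] cong: if_cong)
qed

lemma L2_cut: "f \<in> L2 \<Longrightarrow> (\<lambda>t. if t < x then f t else 0) \<in> L2"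
  by (rule L2_restrict) measurable

lemma primitive_left [simp]: "x \<le> -pi \<Longrightarrow> primitive g x = 0"
  unfolding primitive_def by (rule integral_eq_zero_AE) auto

lemma primitive_right: "pi \<le> x \<Longrightarrow> primitive g x = (LINT t|beam_measure. g t)"
  unfolding primitive_def by (rule Bochner_Integration.integral_cong) auto

lemma primitive_add:
  "f \<in> L2 \<Longrightarrow> g \<in> L2 \<Longrightarrow> primitive (\<lambda>t. f t + g t) x = primitive f x + primitive g x"
  unfolding primitive_def
  by (subst Bochner_Integration.integral_add[symmetric])
     (auto intro!: L2_integrable L2_cut Bochner_Integration.integral_cong)

lemma primitive_cmult: "primitive (\<lambda>t. c * f t) x = c * primitive f x"
proof -
  have "primitive (\<lambda>t. c * f t) x = (LINT t|beam_measure. c * (if t < x then f t else 0))"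
    unfolding primitive_def by (rule Bochner_Integration.integral_cong) auto
  then show ?thesis by (simp add: primitive_def)
qed

lemma primitive_diff:
  "f \<in> L2 \<Longrightarrow> g \<in> L2 \<Longrightarrow> primitive (\<lambda>t. f t - g t) x = primitive f x - primitive g x"
  using primitive_add[of f "\<lambda>t. (-1) * g t" x] primitive_cmult[of "-1" g x] L2_cmult[of g "-1"] by simp

lemma primitive_cong_AE:
  assumes "f \<in> borel_measurable beam_measure" "g \<in> borel_measurable beam_measure"
    "AE t in beam_measure. f t = g t"
  shows "primitive f x = primitive g x"
  unfolding primitive_def using assms by (intro integral_cong_AE) auto

lemma primitive_cong: "(\<And>t. t \<in> beam \<Longrightarrow> f t = g t) \<Longrightarrow> primitive f x = primitive g x"
  unfolding primitive_def by (intro Bochner_Integration.integral_cong) auto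

lemma integral_slab:
  assumes "-pi \<le> x" "x \<le> y" "y \<le> pi"
  shows "(LINT t|beam_measure. (if x \<le> t \<and> t < y then c else 0)) = c * (y - x)"
proof -
  have eq: "(\<lambda>t. if x \<le> t \<and> t < y then c else 0) = (\<lambda>t. indicator {x..<y} t *\<^sub>R c)"
    by (auto simp: indicator_def)
  have m: "{x..<y} \<in> sets lebesgue" by simp
  have "(LINT t|beam_measure. indicator {x..<y} t *\<^sub>R c) = (LINT t|lebesgue. indicator beam t *\<^sub>R indicator {x..<y} t *\<^sub>R c)"
    by (subst integral_restrict_space) auto
  also have "\<dots> = (LINT t|lebesgue. indicator {x<..<y} t *\<^sub>R c)"
  proof (rule integral_cong_AE)
    have "AE t in lebesgue. t \<noteq> x"
      by (rule AE_I'[of "{x}"]) auto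
    then show "AE t in lebesgue. indicator beam t *\<^sub>R indicator {x..<y} t *\<^sub>R c = indicator {x<..<y} t *\<^sub>R c"
      by eventually_elim (use assms in \<open>auto simp: indicator_def\<close>)
  qed (auto intro!: borel_measurable_times borel_measurable_indicator)
  also have "\<dots> = c * (y - x)" using assms by (simp add: mult.commute)
  finally show ?thesis by (simp only: eq)
qed

lemma primitive_increment:
  assumes f: "f \<in> L2" and "x \<le> y"
  shows "primitive f y - primitive f x = (LINT t|beam_measure. (if x \<le> t \<and> t < y then f t else 0))"
  unfolding primitive_def
  by (subst Bochner_Integration.integral_diff[symmetric])
     (use assms in \<open>auto intro!: L2_integrable L2_cut Bochner_Integration.integral_cong\<close>)

text \<open>
  Cauchy-Schwarz against the indicator function of \<open>{x..<y}\<close>; it makes primitives continuous.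
\<close>

lemma primitive_holder:
  assumes f: "f \<in> L2" and "-pi \<le> x" "x \<le> y" "y \<le> pi"
  shows "(primitive f y - primitive f x)\<^sup>2 \<le> (y - x) * (LINT t|beam_measure. (f t)\<^sup>2)"
proof -
  let ?c = "\<lambda>t. if x \<le> t \<and> t < y then 1 else (0::real)"
  have c: "?c \<in> L2" by (rule L2_restrict) (simp, measurable)
  have "primitive f y - primitive f x = (LINT t|beam_measure. ?c t * f t)"
    by (subst primitive_increment[OF f \<open>x \<le> y\<close>]) (rule Bochner_Integration.integral_cong, auto)
  also have "\<dots>\<^sup>2 \<le> (LINT t|beam_measure. (?c t)\<^sup>2) * (LINT t|beam_measure. (f t)\<^sup>2)"
    by (rule L2_cauchy_schwarz[OF c f])
  also have "(LINT t|beam_measure. (?c t)\<^sup>2) = (LINT t|beam_measure. ?c t)"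
    by (rule Bochner_Integration.integral_cong) auto
  also have "\<dots> = y - x"
    using integral_slab[OF assms(2-4), of 1] by simp
  finally show ?thesis .
qed

lemma primitive_lipschitz:
  assumes f: "f \<in> L2" and B: "AE t in beam_measure. l \<le> f t \<and> f t \<le> u"
    and "-pi \<le> x" "x \<le> y" "y \<le> pi"
  shows "l * (y - x) \<le> primitive f y - primitive f x" "primitive f y - primitive f x \<le> u * (y - x)"
proof -
  have int: "integrable beam_measure (\<lambda>t. if x \<le> t \<and> t < y then g t else 0)" if "g \<in> L2" for g
    by (rule L2_integrable, rule L2_restrict[OF that]) measurable
  show "l * (y - x) \<le> primitive f y - primitive f x"
    unfolding primitive_increment[OF f \<open>x \<le> y\<close>] integral_slab[OF assms(3-5), symmetric]
    by (rule integral_mono_AE) (use B int[OF f] int[of "\<lambda>_. l"] in auto)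
  show "primitive f y - primitive f x \<le> u * (y - x)"
    unfolding primitive_increment[OF f \<open>x \<le> y\<close>] integral_slab[OF assms(3-5), symmetric]
    by (rule integral_mono_AE) (use B int[OF f] int[of "\<lambda>_. u"] in auto)
qed

lemma primitive_bound:
  assumes f: "f \<in> L2"
  shows "(primitive f x)\<^sup>2 \<le> 2 * pi * (LINT t|beam_measure. (f t)\<^sup>2)"
proof -
  have nn: "0 \<le> (LINT t|beam_measure. (f t)\<^sup>2)" by (rule integral_nonneg_AE) simp
  consider "x \<le> -pi" | "-pi \<le> x" "x \<le> pi" | "pi \<le> x" by linarith
  then show ?thesis
  proof cases
    case 1 then show ?thesis using nn by simp
  next
    case 2
    then show ?thesis
      using primitive_holder[OF f order_refl 2] mult_right_mono[OF _ nn, of "x + pi" "2 * pi"] by simp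
  next
    case 3
    then show ?thesis
      using primitive_holder[OF f order_refl, of pi] by (simp add: primitive_right)
  qed
qed

lemma integral_bound_L2:
  assumes f: "f \<in> L2"
  shows "(LINT t|beam_measure. f t)\<^sup>2 \<le> 2 * pi * (LINT t|beam_measure. (f t)\<^sup>2)"
  using primitive_bound[OF f, of pi] by (simp add: primitive_right)

lemma primitive_continuous:
  assumes f: "f \<in> L2"
  shows "continuous_on {-pi..pi} (primitive f)"
proof -
  define N where "N = (LINT t|beam_measure. (f t)\<^sup>2)"
  have N: "N \<ge> 0" unfolding N_def by (rule integral_nonneg_AE) simp
  have H: "\<bar>primitive f y - primitive f x\<bar> \<le> sqrt (\<bar>y - x\<bar> * N)" if "x \<in> {-pi..pi}" "y \<in> {-pi..pi}" for x y
  proof (cases "x \<le> y")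
    case True
    then show ?thesis
      using primitive_holder[OF f, of x y] that by (auto intro!: real_le_rsqrt simp: N_def)
  next
    case False
    then show ?thesis
      using primitive_holder[OF f, of y x] that by (auto intro!: real_le_rsqrt simp: N_def power2_commute)
  qed
  show ?thesis
    unfolding continuous_on_def
  proof
    fix x assume x: "x \<in> {-pi..pi}"
    have "((\<lambda>y. primitive f y - primitive f x) \<longlongrightarrow> 0) (at x within {-pi..pi})"
    proof (rule Lim_null_comparison)
      show "\<forall>\<^sub>F y in at x within {-pi..pi}. norm (primitive f y - primitive f x) \<le> sqrt (\<bar>y - x\<bar> * N)"
        using H[OF x] by (auto simp: eventually_at_filter)
      show "((\<lambda>y. sqrt (\<bar>y - x\<bar> * N)) \<longlongrightarrow> 0) (at x within {-pi..pi})"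
        by (rule tendsto_eq_intros refl | simp)+
    qed
    then show "(primitive f \<longlongrightarrow> primitive f x) (at x within {-pi..pi})"
      by (simp add: LIM_zero_iff)
  qed
qed

lemma primitive_L2: "f \<in> L2 \<Longrightarrow> primitive f \<in> L2"
  by (rule L2_continuous) (rule primitive_continuous)

text \<open>
  Integration by parts for two functions whose derivatives are only square-integrable. It is Fubini's
  theorem on the triangle \<open>y < x\<close>.
\<close>

lemma primitive_by_parts:
  assumes f: "f \<in> L2" and g: "g \<in> L2"
  shows "(LINT x|beam_measure. primitive f x * g x) + (LINT x|beam_measure. f x * primitive g x)
       = (LINT x|beam_measure. f x) * (LINT x|beam_measure. g x)"
proof -
  interpret P: pair_sigma_finite beam_measure beam_measure ..
  note [measurable] = L2D(1)[OF f] L2D(1)[OF g]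
  define k where "k = (\<lambda>(x::real, y::real). (if y < x then f y else 0) * g x)"
  have kmeas: "k \<in> borel_measurable (beam_measure \<Otimes>\<^sub>M beam_measure)"
    unfolding k_def by measurable
  have kint: "integrable (beam_measure \<Otimes>\<^sub>M beam_measure) k"
  proof (rule P.Fubini_integrable[OF kmeas])
    have "(\<lambda>x. \<integral>y. norm (k (x, y)) \<partial>beam_measure) = (\<lambda>x. primitive (\<lambda>t. \<bar>f t\<bar>) x * \<bar>g x\<bar>)"
    proof
      fix x
      have "(\<integral>y. norm (k (x, y)) \<partial>beam_measure) = (\<integral>y. (if y < x then \<bar>f y\<bar> else 0) * \<bar>g x\<bar> \<partial>beam_measure)"
        by (rule Bochner_Integration.integral_cong) (auto simp: k_def abs_mult)
      then show "(\<integral>y. norm (k (x, y)) \<partial>beam_measure) = primitive (\<lambda>t. \<bar>f t\<bar>) x * \<bar>g x\<bar>"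
        by (simp add: primitive_def)
    qed
    moreover have "(\<lambda>t. \<bar>f t\<bar>) \<in> L2" "(\<lambda>t. \<bar>g t\<bar>) \<in> L2"
      using L2D[OF f] L2D[OF g] by (auto simp: L2_def)
    ultimately show "integrable beam_measure (\<lambda>x. \<integral>y. norm (k (x, y)) \<partial>beam_measure)"
      by (simp add: L2_mult_integrable primitive_L2)
    show "AE x in beam_measure. integrable beam_measure (\<lambda>y. k (x, y))"
      unfolding k_def using L2_integrable[OF L2_cut[OF f]] by simp
  qed
  have "(LINT x|beam_measure. primitive f x * g x) = (\<integral>x. (\<integral>y. k (x, y) \<partial>beam_measure) \<partial>beam_measure)"
    by (simp add: k_def primitive_def)
  also have "\<dots> = (\<integral>y. (\<integral>x. k (x, y) \<partial>beam_measure) \<partial>beam_measure)"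
    using P.Fubini_integral[of "\<lambda>x y. k (x, y)"] kint by simp
  also have "\<dots> = (\<integral>y. f y * ((LINT x|beam_measure. g x) - primitive g y) \<partial>beam_measure)"
  proof (rule Bochner_Integration.integral_cong[OF refl])
    fix y
    have "(\<integral>x. k (x, y) \<partial>beam_measure) = (\<integral>x. f y * (if y < x then g x else 0) \<partial>beam_measure)"
      by (rule Bochner_Integration.integral_cong) (auto simp: k_def)
    also have "\<dots> = f y * (\<integral>x. (if y < x then g x else 0) \<partial>beam_measure)"
      by simp
    also have "(\<integral>x. (if y < x then g x else 0) \<partial>beam_measure)
        = (\<integral>x. g x - (if x < y then g x else 0) \<partial>beam_measure)"
    proof (rule integral_cong_AE)
      show "AE x in beam_measure. (if y < x then g x else 0) = g x - (if x < y then g x else 0)"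
        using AE_beam_neq[of y] by eventually_elim auto
    qed auto
    also have "\<dots> = (LINT x|beam_measure. g x) - primitive g y"
      unfolding primitive_def
      by (rule Bochner_Integration.integral_diff) (auto intro!: L2_integrable g L2_cut)
    finally show "(\<integral>x. k (x, y) \<partial>beam_measure) = f y * ((LINT x|beam_measure. g x) - primitive g y)" .
  qed
  also have "\<dots> = (\<integral>y. f y * (LINT x|beam_measure. g x) - f y * primitive g y \<partial>beam_measure)"
    by (simp add: right_diff_distrib)
  also have "\<dots> = (LINT x|beam_measure. f x) * (LINT x|beam_measure. g x) - (LINT x|beam_measure. f x * primitive g x)"
    using L2_integrable[OF f] L2_mult_integrable[OF f primitive_L2[OF g]] by simp
  finally show ?thesis by simp
qed

lemma primitive_FTC:
  assumes F: "\<And>x. x \<in> {-pi..pi} \<Longrightarrow> (F has_real_derivative f x) (at x within {-pi..pi})"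
    and f: "continuous_on {-pi..pi} f" and x: "x \<in> {-pi..pi}"
  shows "primitive f x = F x - F (-pi)"
proof -
  have "(f has_integral (F x - F (-pi))) {-pi..x}"
  proof (rule fundamental_theorem_of_calculus)
    fix t assume "t \<in> {-pi..x}"
    then have "(F has_real_derivative f t) (at t within {-pi..x})"
      using DERIV_subset[OF F, of t "{-pi..x}"] x by auto
    then show "(F has_vector_derivative f t) (at t within {-pi..x})"
      by (simp add: has_real_derivative_iff_has_vector_derivative)
  qed (use x in auto)
  then have "((\<lambda>t. if t \<in> {-pi..x} then f t else 0) has_integral (F x - F (-pi))) UNIV"
    by (simp only: has_integral_restrict_UNIV)
  then have "((\<lambda>t. if t \<in> beam then (if t < x then f t else 0) else 0) has_integral (F x - F (-pi))) UNIV"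
    by (rule has_integral_spike[of "{-pi, x}", rotated 2]) (use x in auto)
  then have "((\<lambda>t. if t < x then f t else 0) has_integral (F x - F (-pi))) beam"
    by (simp only: has_integral_restrict_UNIV)
  moreover have "integrable beam_measure (\<lambda>t. if t < x then f t else 0)"
    by (intro L2_integrable L2_cut L2_continuous f)
  ultimately show ?thesis
    unfolding primitive_def
    by (subst lebesgue_integral_eq_integral) (auto dest: integral_unique)
qed

section \<open>Test functions, weak derivatives and boundary values\<close>

text \<open>
  A set of functions that is closed under differentiation consists of smooth functions. This avoids
  formulas for derivatives of order \<open>n\<close>.
\<close>

lemma higher_derivs_differentiable:
  assumes S: "\<And>f. f \<in> S \<Longrightarrow> \<exists>f'\<in>S. \<forall>x. (f has_real_derivative f' x) (at x)" and f: "f \<in> S"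
  shows "(deriv ^^ n) f differentiable (at x)"
proof -
  have "(deriv ^^ n) f \<in> S"
  proof (induction n)
    case (Suc n)
    then obtain f' where f': "f' \<in> S" "\<And>x. ((deriv ^^ n) f has_real_derivative f' x) (at x)"
      using S by blast
    then have "deriv ((deriv ^^ n) f) = f'"
      by (auto intro: DERIV_imp_deriv)
    then show ?case using f' by simp
  qed (use f in simp)
  then show ?thesis
    using S real_differentiable_def by blast
qed

text \<open>
  The family \<open>P(1/x) exp(-1/x)\<close>, continued by 0, contains the standard smooth function that
  vanishes on a half-line, and it is closed under differentiation.
\<close>

definition flat :: "real poly \<Rightarrow> real \<Rightarrow> real" where
  "flat P x = (if x \<le> 0 then 0 else poly P (1 / x) * exp (- 1 / x))"

lemma poly_exp_decay: "((\<lambda>y::real. poly P y * exp (- y)) \<longlongrightarrow> 0) at_top"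
proof -
  have "((\<lambda>y. \<Sum>i\<le>degree P. coeff P i * (y ^ i / exp y)) \<longlongrightarrow> (\<Sum>i\<le>degree P. coeff P i * 0)) at_top"
    by (intro tendsto_intros tendsto_power_div_exp_0)
  then show ?thesis
    by (simp add: poly_altdef sum_distrib_right exp_minus divide_inverse mult.assoc)
qed

lemma flat_derivative:
  "(flat P has_real_derivative flat ([:0, 0, 1:] * (P - pderiv P)) x) (at x)"
proof -
  consider "x < 0" | "x > 0" | "x = 0" by linarith
  then show ?thesis
  proof cases
    case 1
    have "((\<lambda>x. 0) has_real_derivative 0) (at x)" by simp
    then have "(flat P has_real_derivative 0) (at x)"
      by (rule DERIV_cong_ev[THEN iffD1, rotated 3])
         (use 1 in \<open>auto simp: flat_def intro!: eventually_mono[OF eventually_nhds_in_open[of "{..<0}"]]\<close>)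
    then show ?thesis using 1 by (simp add: flat_def)
  next
    case 2
    have i: "((\<lambda>x. 1 / x) has_real_derivative - (1 / x\<^sup>2)) (at x)"
      using 2 by (auto intro!: derivative_eq_intros simp: power2_eq_square)
    have d: "((\<lambda>x. poly P (1 / x) * exp (- (1 / x))) has_real_derivative
        poly (pderiv P) (1 / x) * - (1 / x\<^sup>2) * exp (- (1 / x))
        + exp (- (1 / x)) * - (- (1 / x\<^sup>2)) * poly P (1 / x)) (at x)"
      by (intro DERIV_mult DERIV_chain2[OF poly_DERIV i] DERIV_fun_exp DERIV_minus i)
    have "poly (pderiv P) (1 / x) * - (1 / x\<^sup>2) * exp (- (1 / x))
        + exp (- (1 / x)) * - (- (1 / x\<^sup>2)) * poly P (1 / x)
        = flat ([:0, 0, 1:] * (P - pderiv P)) x"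
      using 2 by (simp add: flat_def power2_eq_square algebra_simps)
    with d have "((\<lambda>x. poly P (1 / x) * exp (- 1 / x)) has_real_derivative
        flat ([:0, 0, 1:] * (P - pderiv P)) x) (at x)" by simp
    then show ?thesis
      by (rule DERIV_cong_ev[THEN iffD1, rotated 3])
         (use 2 in \<open>auto simp: flat_def intro!: eventually_mono[OF eventually_nhds_in_open[of "{0<..}"]]\<close>)
  next
    case 3
    have "((\<lambda>h. (flat P h - flat P 0) / h) \<longlongrightarrow> 0) (at 0)"
    proof (rule filterlim_split_at)
      show "((\<lambda>h. (flat P h - flat P 0) / h) \<longlongrightarrow> 0) (at_left 0)"
        by (rule tendsto_eventually) (auto simp: flat_def eventually_at_filter)
      have "((\<lambda>y. poly ([:0, 1:] * P) y * exp (- y)) \<longlongrightarrow> 0) at_top"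
        by (rule poly_exp_decay)
      then have "((\<lambda>y. (flat P (inverse y) - flat P 0) / inverse y) \<longlongrightarrow> 0) at_top"
        by (rule Lim_transform_eventually)
           (auto simp: flat_def field_simps intro!: eventually_mono[OF eventually_gt_at_top[of 0]])
      then show "((\<lambda>h. (flat P h - flat P 0) / h) \<longlongrightarrow> 0) (at_right 0)"
        by (simp add: filterlim_at_right_to_top)
    qed
    then show ?thesis using 3 by (simp add: has_field_derivative_iff flat_def)
  qed
qed

text \<open>
  Just enough smooth functions: a class that contains polynomials and cutoffs, and in which every
  member has its derivative by construction.
\<close>

inductive_set smooth :: "(real \<Rightarrow> real) set" where
  smooth_const: "(\<lambda>x. c) \<in> smooth"
| smooth_ident: "(\<lambda>x. x) \<in> smooth"
| smooth_flat: "(\<lambda>x. flat P (c + d * x)) \<in> smooth"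
| smooth_add: "f \<in> smooth \<Longrightarrow> g \<in> smooth \<Longrightarrow> (\<lambda>x. f x + g x) \<in> smooth"
| smooth_mult: "f \<in> smooth \<Longrightarrow> g \<in> smooth \<Longrightarrow> (\<lambda>x. f x * g x) \<in> smooth"

lemma smooth_derivative:
  "f \<in> smooth \<Longrightarrow> \<exists>f'\<in>smooth. \<forall>x. (f has_real_derivative f' x) (at x)"
proof (induction rule: smooth.induct)
  case (smooth_const c)
  show ?case by (rule bexI[OF _ smooth.smooth_const[of 0]]) auto
next
  case smooth_ident
  show ?case by (rule bexI[OF _ smooth.smooth_const[of 1]]) auto
next
  case (smooth_flat P c d)
  let ?Q = "[:0, 0, 1:] * (P - pderiv P)"
  show ?case
  proof (intro bexI allI)
    fix x
    have "((\<lambda>x. c + d * x) has_real_derivative d) (at x)"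
      by (rule derivative_eq_intros refl | simp)+
    from DERIV_chain2[OF flat_derivative this]
    show "((\<lambda>x. flat P (c + d * x)) has_real_derivative flat ?Q (c + d * x) * d) (at x)" .
  qed (intro smooth.smooth_mult smooth.smooth_flat smooth.smooth_const)
next
  case (smooth_add f g)
  then obtain f' g' where "f' \<in> smooth" "g' \<in> smooth"
      "\<forall>x. (f has_real_derivative f' x) (at x)" "\<forall>x. (g has_real_derivative g' x) (at x)"
    by blast
  then show ?case
    by (intro bexI[of _ "\<lambda>x. f' x + g' x"] allI DERIV_add smooth.smooth_add) auto
next
  case (smooth_mult f g)
  then obtain f' g' where d: "f' \<in> smooth" "g' \<in> smooth"
      "\<forall>x. (f has_real_derivative f' x) (at x)" "\<forall>x. (g has_real_derivative g' x) (at x)"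
    by blast
  then show ?case
    by (intro bexI[of _ "\<lambda>x. f' x * g x + g' x * f x"] allI DERIV_mult smooth.smooth_add smooth.smooth_mult)
       (auto intro: smooth_mult)
qed

lemma smooth_continuous: "f \<in> smooth \<Longrightarrow> continuous_on A f"
  by (metis DERIV_isCont continuous_at_imp_continuous_on smooth_derivative)

definition bump :: "(real \<Rightarrow> real) \<Rightarrow> bool" where
  "bump \<psi> \<longleftrightarrow> \<psi> \<in> smooth \<and> (\<exists>c d. -pi < c \<and> c \<le> d \<and> d < pi \<and> (\<forall>x. x \<notin> {c..d} \<longrightarrow> \<psi> x = 0))"

lemma bump_L2: "bump \<psi> \<Longrightarrow> \<psi> \<in> L2"
  by (auto simp: bump_def intro: L2_continuous smooth_continuous)

lemma bump_test_function: "bump \<psi> \<Longrightarrow> test_function \<psi>"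
  unfolding test_function_def bump_def
proof (intro conjI allI; elim conjE exE)
  fix n x assume "\<psi> \<in> smooth"
  then show "(deriv ^^ n) \<psi> differentiable (at x)"
    using higher_derivs_differentiable[OF smooth_derivative] by blast
next
  fix c d assume "- pi < c" "d < pi" "\<forall>x. x \<notin> {c..d} \<longrightarrow> \<psi> x = 0"
  then show "\<exists>K. compact K \<and> K \<subseteq> beam \<and> (\<forall>x. x \<notin> K \<longrightarrow> \<psi> x = 0)"
    by (intro exI[of _ "{c..d}"]) auto
qed

text \<open>
  A function of mean zero with compact support is the derivative of a test function.
\<close>

lemma bump_primitive:
  assumes b: "bump \<psi>" and mean: "(LINT x|beam_measure. \<psi> x) = 0"
  shows "\<exists>\<phi>. test_function \<phi> \<and> deriv \<phi> = \<psi> \<and> (\<forall>x\<in>{-pi..pi}. \<phi> x = primitive \<psi> x)"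
proof -
  obtain c d where sm: "\<psi> \<in> smooth" and cd: "-pi < c" "c \<le> d" "d < pi"
      and out: "\<And>x. x \<notin> {c..d} \<Longrightarrow> \<psi> x = 0"
    using b unfolding bump_def by blast
  have "isCont \<psi> x" for x
    using smooth_continuous[OF sm, of UNIV] by (simp add: continuous_on_eq_continuous_at)
  then obtain F where F: "\<And>x. (F has_vector_derivative \<psi> x) (at x)"
    using einterval_antiderivative[of "-\<infinity>" "\<infinity>" \<psi>] by auto
  define \<phi> where "\<phi> x = F x - F (-pi)" for x
  have d\<phi>: "(\<phi> has_real_derivative \<psi> x) (at x)" for x
    unfolding \<phi>_def using F[of x]
    by (auto intro!: derivative_eq_intros simp: has_real_derivative_iff_has_vector_derivative[symmetric])
  have prim: "\<phi> x = primitive \<psi> x" if "x \<in> {-pi..pi}" for x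
    using primitive_FTC[of \<phi> \<psi> x, OF has_field_derivative_at_within[OF d\<phi>] smooth_continuous[OF sm] that]
    by (simp add: \<phi>_def)
  have left: "\<phi> x = 0" if "x < c" for x
  proof -
    have "\<phi> x = \<phi> (-pi)"
    proof (rule DERIV_zero_connected_constant[of "{..<c}" "{}"])
      show "continuous_on {..<c} \<phi>"
        using d\<phi> DERIV_isCont continuous_at_imp_continuous_on by blast
      show "\<forall>t\<in>{..<c} - {}. (\<phi> has_real_derivative 0) (at t)"
      proof
        fix t assume "t \<in> {..<c} - {}"
        then show "(\<phi> has_real_derivative 0) (at t)" using d\<phi>[of t] out[of t] by simp
      qed
    qed (use that cd in auto)
    then show ?thesis by (simp add: \<phi>_def)
  qed
  have right: "\<phi> x = 0" if "d < x" for x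
  proof -
    have "\<phi> x = \<phi> pi"
    proof (rule DERIV_zero_connected_constant[of "{d<..}" "{}"])
      show "continuous_on {d<..} \<phi>"
        using d\<phi> DERIV_isCont continuous_at_imp_continuous_on by blast
      show "\<forall>t\<in>{d<..} - {}. (\<phi> has_real_derivative 0) (at t)"
      proof
        fix t assume "t \<in> {d<..} - {}"
        then show "(\<phi> has_real_derivative 0) (at t)" using d\<phi>[of t] out[of t] by simp
      qed
    qed (use that cd in auto)
    also have "\<dots> = 0" using prim[of pi] mean by (simp add: primitive_right)
    finally show ?thesis .
  qed
  have "test_function \<phi>"
    unfolding test_function_def
  proof (intro conjI allI)
    fix n x
    show "(deriv ^^ n) \<phi> differentiable (at x)"
    proof (rule higher_derivs_differentiable[of "insert \<phi> smooth"])
      fix f assume "f \<in> insert \<phi> smooth"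
      then show "\<exists>f'\<in>insert \<phi> smooth. \<forall>x. (f has_real_derivative f' x) (at x)"
        using smooth_derivative d\<phi> sm by blast
    qed simp
    show "\<exists>K. compact K \<and> K \<subseteq> beam \<and> (\<forall>x. x \<notin> K \<longrightarrow> \<phi> x = 0)"
      using left right cd by (intro exI[of _ "{c..d}"]) auto
  qed
  moreover have "deriv \<phi> = \<psi>" using d\<phi> by (auto intro: DERIV_imp_deriv)
  ultimately show ?thesis using prim by blast
qed

text \<open>
  Smooth, with values in \<open>[0,1]\<close> and support inside the interval, and convergent to 1 pointwise:
  the arguments of the two factors are \<open>(n+1)(\<pi> + x) - 1\<close> and \<open>(n+1)(\<pi> - x) - 1\<close>.
\<close>

definition cutoff :: "nat \<Rightarrow> real \<Rightarrow> real" where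
  "cutoff n x = flat 1 (real (Suc n) * pi - 1 + real (Suc n) * x) * flat 1 (real (Suc n) * pi - 1 + (- real (Suc n)) * x)"

lemma cutoff_smooth: "cutoff n \<in> smooth"
  unfolding cutoff_def[abs_def] by (intro smooth.intros)

lemma flat_one_range: "0 \<le> flat 1 x" "flat 1 x \<le> 1"
  by (auto simp: flat_def)

lemma cutoff_range: "0 \<le> cutoff n x" "cutoff n x \<le> 1"
  using flat_one_range by (auto simp: cutoff_def intro!: mult_le_one)

lemma cutoff_support: "x \<notin> {-pi + 1 / real (Suc n)..pi - 1 / real (Suc n)} \<Longrightarrow> cutoff n x = 0"
  by (auto simp: cutoff_def flat_def field_simps)

lemma cutoff_mult_bump: "f \<in> smooth \<Longrightarrow> bump (\<lambda>x. f x * cutoff n x)"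
  unfolding bump_def
proof (intro conjI exI allI impI)
  have "1 / real (Suc n) \<le> 1" by simp
  then show "-pi + 1 / real (Suc n) \<le> pi - 1 / real (Suc n)" using pi_gt3 by linarith
qed (use cutoff_support in \<open>auto intro: smooth.intros cutoff_smooth\<close>)

lemma cutoff_tendsto:
  assumes "x \<in> beam"
  shows "(\<lambda>n. cutoff n x) \<longlonglongrightarrow> 1"
proof -
  have *: "(\<lambda>n. flat 1 (real (Suc n) * s - 1)) \<longlonglongrightarrow> 1" if "s > 0" for s
  proof -
    have "filterlim (\<lambda>n. real (Suc n) * s) at_top sequentially"
      by (rule filterlim_at_top_mult_tendsto_pos[OF tendsto_const that])
         (rule filterlim_compose[OF filterlim_real_sequentially filterlim_Suc])
    then have top: "filterlim (\<lambda>n. - 1 + real (Suc n) * s) at_top sequentially"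
      by (rule filterlim_tendsto_add_at_top[OF tendsto_const])
    have "(\<lambda>n. exp (- 1 / (- 1 + real (Suc n) * s))) \<longlonglongrightarrow> exp 0"
      by (intro tendsto_exp tendsto_divide_0[OF tendsto_const] filterlim_at_top_imp_at_infinity top)
    moreover have "\<forall>\<^sub>F n in sequentially. exp (- 1 / (- 1 + real (Suc n) * s)) = flat 1 (real (Suc n) * s - 1)"
      using filterlim_at_top_dense[THEN iffD1, OF top, rule_format, of 0]
      by eventually_elim (auto simp: flat_def algebra_simps)
    ultimately show ?thesis
      using Lim_transform_eventually by fastforce
  qed
  have "(\<lambda>n. flat 1 (real (Suc n) * (pi + x) - 1) * flat 1 (real (Suc n) * (pi - x) - 1)) \<longlonglongrightarrow> 1 * 1"
    by (intro tendsto_mult *) (use assms in auto)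
  moreover have "cutoff n x = flat 1 (real (Suc n) * (pi + x) - 1) * flat 1 (real (Suc n) * (pi - x) - 1)" for n
    unfolding cutoff_def by (simp add: algebra_simps)
  ultimately show ?thesis by simp
qed

text \<open>
  The class \<open>smooth\<close> is an algebra that separates points, so it is uniformly dense by the
  Stone-Weierstrass theorem. Multiplication by a cutoff costs little in \<open>L\<^sup>2\<close>.
\<close>

lemma bump_dense:
  assumes g: "continuous_on {-pi..pi} g" and "\<epsilon> > 0"
  shows "\<exists>\<psi>. bump \<psi> \<and> (LINT x|beam_measure. (g x - \<psi> x)\<^sup>2) < \<epsilon>"
proof -
  define \<delta> where "\<delta> = sqrt (\<epsilon> / (8 * pi))"
  have \<delta>: "\<delta> > 0" "\<delta>\<^sup>2 = \<epsilon> / (8 * pi)" using \<open>\<epsilon> > 0\<close> by (auto simp: \<delta>_def)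
  have "\<exists>q. q \<in> smooth \<and> (\<forall>x\<in>{-pi..pi}. \<bar>g x - q x\<bar> < \<delta>)"
  proof (rule Stone_Weierstrass_HOL)
    fix x y :: real assume "x \<in> {-pi..pi} \<and> y \<in> {-pi..pi} \<and> x \<noteq> y"
    then show "\<exists>f. f \<in> smooth \<and> f x \<noteq> f y"
      by (intro exI[of _ "\<lambda>x. x"]) (auto intro: smooth.intros)
  qed (use g \<delta> in \<open>auto intro: smooth.intros smooth_continuous\<close>)
  then obtain q where q: "q \<in> smooth" "\<And>x. x \<in> {-pi..pi} \<Longrightarrow> \<bar>g x - q x\<bar> < \<delta>" by blast
  note gL = L2_continuous[OF g] and qL = L2_continuous[OF smooth_continuous[OF q(1)]]
  have cL: "(\<lambda>x. q x * cutoff n x) \<in> L2" for n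
    by (rule bump_L2, rule cutoff_mult_bump, rule q)
  note [measurable] = L2D(1)[OF gL] L2D(1)[OF qL] L2D(1)[OF L2_continuous[OF smooth_continuous[OF cutoff_smooth]]]
  have "(\<lambda>n. LINT x|beam_measure. (q x - q x * cutoff n x)\<^sup>2) \<longlonglongrightarrow> (LINT x|beam_measure. 0)"
  proof (rule integral_dominated_convergence[where w="\<lambda>x. (q x)\<^sup>2"])
    show "AE x in beam_measure. (\<lambda>n. (q x - q x * cutoff n x)\<^sup>2) \<longlonglongrightarrow> 0"
    proof (rule AE_I2)
      fix x assume "x \<in> space beam_measure"
      then have "(\<lambda>n. (q x - q x * cutoff n x)\<^sup>2) \<longlonglongrightarrow> (q x - q x * 1)\<^sup>2"
        by (intro tendsto_intros cutoff_tendsto) simp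
      then show "(\<lambda>n. (q x - q x * cutoff n x)\<^sup>2) \<longlonglongrightarrow> 0" by simp
    qed
    show "AE x in beam_measure. norm ((q x - q x * cutoff n x)\<^sup>2) \<le> (q x)\<^sup>2" for n
    proof (rule AE_I2)
      fix x
      have "(q x - q x * cutoff n x)\<^sup>2 = (q x)\<^sup>2 * (1 - cutoff n x)\<^sup>2"
        by (simp add: power2_eq_square algebra_simps)
      also have "\<dots> \<le> (q x)\<^sup>2 * 1"
        using cutoff_range[of n x] by (intro mult_left_mono) (auto simp: abs_square_le_1)
      finally show "norm ((q x - q x * cutoff n x)\<^sup>2) \<le> (q x)\<^sup>2" by simp
    qed
  qed (use L2D[OF qL] in auto)
  then have "\<forall>\<^sub>F n in sequentially. (LINT x|beam_measure. (q x - q x * cutoff n x)\<^sup>2) < \<epsilon> / 4"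
    using \<open>\<epsilon> > 0\<close> by (intro order_tendstoD(2)) auto
  then obtain n where n: "(LINT x|beam_measure. (q x - q x * cutoff n x)\<^sup>2) < \<epsilon> / 4"
    by (auto simp: eventually_sequentially)
  have "(LINT x|beam_measure. (g x - q x * cutoff n x)\<^sup>2)
      \<le> (LINT x|beam_measure. 2 * (g x - q x)\<^sup>2 + 2 * (q x - q x * cutoff n x)\<^sup>2)"
  proof (rule integral_mono)
    fix x
    have *: "(u + v)\<^sup>2 \<le> 2 * u\<^sup>2 + 2 * v\<^sup>2" for u v :: real
      using zero_le_power2[of "u - v"] by (simp add: power2_eq_square algebra_simps)
    show "(g x - q x * cutoff n x)\<^sup>2 \<le> 2 * (g x - q x)\<^sup>2 + 2 * (q x - q x * cutoff n x)\<^sup>2"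
      using *[of "g x - q x" "q x - q x * cutoff n x"] by simp
  qed (use L2D(2)[OF L2_diff] gL qL cL in auto)
  also have "\<dots> = 2 * (LINT x|beam_measure. (g x - q x)\<^sup>2) + 2 * (LINT x|beam_measure. (q x - q x * cutoff n x)\<^sup>2)"
    using L2D(2)[OF L2_diff] gL qL cL by (subst Bochner_Integration.integral_add) auto
  also have "(LINT x|beam_measure. (g x - q x)\<^sup>2) \<le> (LINT x|beam_measure. \<delta>\<^sup>2)"
  proof (rule integral_mono)
    fix x assume "x \<in> space beam_measure"
    then show "(g x - q x)\<^sup>2 \<le> \<delta>\<^sup>2" using q(2)[of x] \<delta>(1) by (auto simp: abs_le_square_iff[symmetric])
  qed (use L2D(2)[OF L2_diff] gL qL in auto)
  also have "(LINT x|beam_measure. \<delta>\<^sup>2) = \<epsilon> / 4" by (simp add: integral_const_beam \<delta>(2))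
  finally show ?thesis
    using n cutoff_mult_bump[OF q(1), of n] by (intro exI[of _ "\<lambda>x. q x * cutoff n x"]) auto
qed

text \<open>
  Almost everywhere, the sign of \<open>f\<close> is a limit of continuous functions with values in
  \<open>[-1,1]\<close>. Testing with them gives \<open>\<integral>\<bar>f\<bar> = 0\<close> in the limit.
\<close>

lemma orthogonal_to_continuous_null:
  assumes f: "f \<in> L2"
    and z: "\<And>g. continuous_on UNIV g \<Longrightarrow> (LINT x|beam_measure. f x * g x) = 0"
  shows "AE x in beam_measure. f x = 0"
proof -
  define s where "s x = (if x \<in> beam then sgn (f x) else 0)" for x
  have "(\<lambda>x. sgn (f x)) \<in> borel_measurable beam_measure"
    using L2D(1)[OF f] by measurable
  then have "s \<in> borel_measurable lebesgue"
    unfolding s_def by (rule borel_measurable_if_I) simp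
  then have "s measurable_on UNIV"
    by (rule lebesgue_measurable_imp_measurable_on_real) simp
  then obtain N h where N: "negligible N" and h: "\<And>n. continuous_on UNIV (h n)"
      and lim: "\<And>x. x \<notin> N \<Longrightarrow> (\<lambda>n. h n x) \<longlonglongrightarrow> s x"
    unfolding measurable_on_def by auto
  define g where "g n x = max (-1) (min 1 (h n x))" for n x
  have g: "continuous_on UNIV (g n)" for n
    unfolding g_def by (intro continuous_intros h)
  have gL: "g n \<in> L2" for n
    by (rule L2_continuous) (rule continuous_on_subset[OF g], simp)
  note [measurable] = L2D(1)[OF f] L2D(1)[OF gL]
  have AEN: "AE x in beam_measure. x \<notin> N"
    using AE_not_in[of N lebesgue] N by (auto simp: AE_restrict_space_iff negligible_iff_null_sets)
  have "(\<lambda>n. LINT x|beam_measure. f x * g n x) \<longlonglongrightarrow> (LINT x|beam_measure. \<bar>f x\<bar>)"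
  proof (rule integral_dominated_convergence[where w="\<lambda>x. \<bar>f x\<bar>"])
    show "AE x in beam_measure. (\<lambda>n. f x * g n x) \<longlonglongrightarrow> \<bar>f x\<bar>"
      using AEN AE_space
    proof eventually_elim
      fix x assume "x \<notin> N" "x \<in> space beam_measure"
      then have "(\<lambda>n. f x * g n x) \<longlonglongrightarrow> f x * max (-1) (min 1 (s x))"
        unfolding g_def by (intro tendsto_intros lim)
      moreover have "f x * max (-1) (min 1 (s x)) = \<bar>f x\<bar>"
        using \<open>x \<in> space beam_measure\<close> by (auto simp: s_def sgn_if)
      ultimately show "(\<lambda>n. f x * g n x) \<longlonglongrightarrow> \<bar>f x\<bar>" by simp
    qed
    show "AE x in beam_measure. norm (f x * g n x) \<le> \<bar>f x\<bar>" for n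
    proof (rule AE_I2)
      fix x
      have "\<bar>g n x\<bar> \<le> 1" by (auto simp: g_def)
      then show "norm (f x * g n x) \<le> \<bar>f x\<bar>"
        using mult_left_mono[of "\<bar>g n x\<bar>" 1 "\<bar>f x\<bar>"] by (simp add: abs_mult)
    qed
  qed (use L2_integrable[OF f] in auto)
  then have "(LINT x|beam_measure. \<bar>f x\<bar>) = 0"
    using z[OF g] by (simp add: LIMSEQ_const_iff)
  then show ?thesis
    using integral_nonneg_eq_0_iff_AE[of beam_measure "\<lambda>x. \<bar>f x\<bar>"] L2_integrable[OF f] by auto
qed

lemma orthogonal_to_bumps_null:
  assumes f: "f \<in> L2" and z: "\<And>\<psi>. bump \<psi> \<Longrightarrow> (LINT x|beam_measure. f x * \<psi> x) = 0"
  shows "AE x in beam_measure. f x = 0"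
proof (rule orthogonal_to_continuous_null[OF f])
  fix g :: "real \<Rightarrow> real" assume "continuous_on UNIV g"
  then have g: "continuous_on {-pi..pi} g" by (rule continuous_on_subset) simp
  note gL = L2_continuous[OF g]
  define A where "A = (LINT x|beam_measure. (f x)\<^sup>2)"
  define B where "B = (LINT x|beam_measure. f x * g x)"
  have A: "A \<ge> 0" unfolding A_def by (rule integral_nonneg_AE) simp
  have "B\<^sup>2 \<le> 0 + e" if "e > 0" for e
  proof -
    obtain \<psi> where \<psi>: "bump \<psi>" "(LINT x|beam_measure. (g x - \<psi> x)\<^sup>2) < e / (A + 1)"
      using bump_dense[OF g, of "e / (A + 1)"] \<open>e > 0\<close> A by auto
    have "B = (LINT x|beam_measure. f x * g x) - (LINT x|beam_measure. f x * \<psi> x)"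
      using z[OF \<psi>(1)] by (simp add: B_def)
    also have "\<dots> = (LINT x|beam_measure. f x * (g x - \<psi> x))"
      using L2_mult_integrable[OF f gL] L2_mult_integrable[OF f bump_L2[OF \<psi>(1)]]
      by (simp add: right_diff_distrib)
    finally have "B\<^sup>2 \<le> A * (LINT x|beam_measure. (g x - \<psi> x)\<^sup>2)"
      unfolding A_def using L2_cauchy_schwarz[OF f L2_diff[OF gL bump_L2[OF \<psi>(1)]]] by simp
    also have "\<dots> \<le> A * (e / (A + 1))"
      using \<psi>(2) A by (intro mult_left_mono) auto
    also have "\<dots> \<le> e" using A \<open>e > 0\<close> by (simp add: field_simps)
    finally show ?thesis by simp
  qed
  then have "B\<^sup>2 \<le> 0" by (rule field_le_epsilon)
  then show "(LINT x|beam_measure. f x * g x) = 0" by (simp add: B_def)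
qed

lemma mean_one_bump: "\<exists>\<rho>. bump \<rho> \<and> (LINT x|beam_measure. \<rho> x) = 1"
proof -
  have "\<exists>\<psi>. bump \<psi> \<and> (LINT x|beam_measure. \<psi> x) \<noteq> 0"
  proof (rule ccontr)
    assume "\<not> ?thesis"
    then have "AE x in beam_measure. (1::real) = 0"
      by (intro orthogonal_to_bumps_null) auto
    then have "(LINT x|beam_measure. (1::real)) = (LINT x|beam_measure. 0)"
      by (intro integral_cong_AE) auto
    then show False by simp
  qed
  then obtain \<psi> where \<psi>: "bump \<psi>" "(LINT x|beam_measure. \<psi> x) \<noteq> 0" by blast
  define c where "c = 1 / (LINT x|beam_measure. \<psi> x)"
  have "bump (\<lambda>x. c * \<psi> x)"
    using \<psi>(1) smooth.smooth_mult[OF smooth.smooth_const[of c], of \<psi>]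
    unfolding bump_def by (metis mult_zero_right)
  moreover have "(LINT x|beam_measure. c * \<psi> x) = 1"
    using \<psi>(2) by (simp add: c_def)
  ultimately show ?thesis by blast
qed

lemma bump_sub_cmult:
  assumes "bump \<psi>" "bump \<rho>"
  shows "bump (\<lambda>x. \<psi> x - c * \<rho> x)"
proof -
  obtain a b where \<psi>: "\<psi> \<in> smooth" "-pi < a" "a \<le> b" "b < pi" "\<And>x. x \<notin> {a..b} \<Longrightarrow> \<psi> x = 0"
    using assms(1) unfolding bump_def by blast
  obtain a' b' where \<rho>: "\<rho> \<in> smooth" "-pi < a'" "a' \<le> b'" "b' < pi" "\<And>x. x \<notin> {a'..b'} \<Longrightarrow> \<rho> x = 0"
    using assms(2) unfolding bump_def by blast
  have "(\<lambda>x. \<psi> x + (- c) * \<rho> x) \<in> smooth"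
    by (intro smooth.intros \<psi> \<rho>)
  moreover have "\<psi> x - c * \<rho> x = 0" if "x \<notin> {min a a'..max b b'}" for x
  proof -
    have "\<psi> x = 0" by (rule \<psi>(5)) (use that in auto)
    moreover have "\<rho> x = 0" by (rule \<rho>(5)) (use that in auto)
    ultimately show ?thesis by simp
  qed
  moreover have "-pi < min a a'" "min a a' \<le> max b b'" "max b b' < pi"
    using \<psi> \<rho> by auto
  moreover have "(\<lambda>x. \<psi> x - c * \<rho> x) \<in> smooth"
    using calculation(1) by simp
  ultimately show ?thesis unfolding bump_def by blast
qed

text \<open>
  Every bump becomes the derivative of a test function when its mean is removed by a multiple of one
  fixed bump \<open>\<rho>\<close> of mean 1. So \<open>f\<close> minus the constant \<open>\<integral>f\<rho>\<close> is orthogonal to all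
  bumps.
\<close>

lemma du_bois_reymond:
  assumes f: "f \<in> L2"
    and z: "\<And>\<phi>. test_function \<phi> \<Longrightarrow> (LINT x|beam_measure. f x * deriv \<phi> x) = 0"
  shows "\<exists>c. AE x in beam_measure. f x = c"
proof -
  obtain \<rho> where \<rho>: "bump \<rho>" "(LINT x|beam_measure. \<rho> x) = 1"
    using mean_one_bump by blast
  define c where "c = (LINT x|beam_measure. f x * \<rho> x)"
  have "AE x in beam_measure. f x - c = 0"
  proof (rule orthogonal_to_bumps_null)
    show "(\<lambda>x. f x - c) \<in> L2" by (intro L2_diff f L2_const)
    fix \<psi> assume \<psi>: "bump \<psi>"
    define k where "k = (LINT x|beam_measure. \<psi> x)"
    have b: "bump (\<lambda>x. \<psi> x - k * \<rho> x)" by (rule bump_sub_cmult[OF \<psi> \<rho>(1)])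
    have "(LINT x|beam_measure. \<psi> x - k * \<rho> x) = 0"
      using L2_integrable[OF bump_L2[OF \<psi>]] L2_integrable[OF bump_L2[OF \<rho>(1)]] \<rho>(2)
      by (simp add: k_def)
    then obtain \<phi> where \<phi>: "test_function \<phi>" "deriv \<phi> = (\<lambda>x. \<psi> x - k * \<rho> x)"
      using bump_primitive[OF b] by blast
    have "0 = (LINT x|beam_measure. f x * (\<psi> x - k * \<rho> x))"
      using z[OF \<phi>(1)] by (simp add: \<phi>(2))
    also have "\<dots> = (LINT x|beam_measure. f x * \<psi> x - k * (f x * \<rho> x))"
      by (rule Bochner_Integration.integral_cong) (auto simp: algebra_simps)
    also have "\<dots> = (LINT x|beam_measure. f x * \<psi> x) - k * c"
      using L2_mult_integrable[OF f bump_L2[OF \<psi>]] L2_mult_integrable[OF f bump_L2[OF \<rho>(1)]]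
      by (simp add: c_def)
    also have "\<dots> = (LINT x|beam_measure. (f x - c) * \<psi> x)"
      using L2_mult_integrable[OF f bump_L2[OF \<psi>]] L2_integrable[OF bump_L2[OF \<psi>]]
      by (simp add: k_def left_diff_distrib)
    finally show "(LINT x|beam_measure. (f x - c) * \<psi> x) = 0" by simp
  qed
  then show ?thesis by auto
qed

lemma test_function_primitive:
  assumes "test_function \<phi>"
  shows "continuous_on {-pi..pi} (deriv \<phi>)"
    and "(LINT x|beam_measure. deriv \<phi> x) = 0"
    and "x \<in> {-pi..pi} \<Longrightarrow> \<phi> x = primitive (deriv \<phi>) x"
proof -
  have n: "(deriv ^^ n) \<phi> differentiable (at x)" for n x
    using assms unfolding test_function_def by blast
  have d0: "\<phi> differentiable (at x)" and d1: "deriv \<phi> differentiable (at x)" for x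
    using n[of 0 x] n[of 1 x] by simp_all
  have D: "(\<phi> has_real_derivative deriv \<phi> x) (at x)" for x
    using d0[of x] by (simp add: DERIV_deriv_iff_real_differentiable)
  show c: "continuous_on {-pi..pi} (deriv \<phi>)"
    using d1 by (simp add: differentiable_imp_continuous_within continuous_at_imp_continuous_on)
  have z: "\<phi> x = 0" if "x \<notin> beam" for x
    using assms that unfolding test_function_def by blast
  have P: "primitive (deriv \<phi>) x = \<phi> x" if "x \<in> {-pi..pi}" for x
    using primitive_FTC[of \<phi> "deriv \<phi>" x] that D c z[of "-pi"]
    by (auto intro: has_field_derivative_at_within)
  show "x \<in> {-pi..pi} \<Longrightarrow> \<phi> x = primitive (deriv \<phi>) x"
    using P by simp
  show "(LINT x|beam_measure. deriv \<phi> x) = 0"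
    using P[of pi] z[of pi] by (simp add: primitive_right)
qed

text \<open>
  Together with \<open>weak_deriv_imp_primitive\<close> this identifies weak differentiability with being
  almost everywhere a constant plus a primitive.
\<close>

lemma has_weak_deriv_primitive:
  assumes g: "g \<in> L2" and u: "u \<in> borel_measurable beam_measure"
    and eq: "AE x in beam_measure. u x = c + primitive g x"
  shows "has_weak_deriv u g"
  unfolding has_weak_deriv_def
proof (intro conjI allI impI)
  have P: "(\<lambda>x. c + primitive g x) \<in> L2" by (intro L2_add L2_const primitive_L2 g)
  show "u \<in> L2" by (rule L2_cong_AE[OF P u]) (use eq in auto)
  fix \<phi> assume \<phi>: "test_function \<phi>"
  note D = test_function_primitive[OF \<phi>]
  note DL = L2_continuous[OF D(1)]
  note [measurable] = u L2D(1)[OF DL] L2D(1)[OF g] L2D(1)[OF primitive_L2[OF g]] L2D(1)[OF P]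
  have "(LINT x|beam_measure. u x * deriv \<phi> x) = (LINT x|beam_measure. c * deriv \<phi> x + primitive g x * deriv \<phi> x)"
    by (rule integral_cong_AE) (use eq in \<open>auto simp: algebra_simps\<close>)
  also have "\<dots> = (LINT x|beam_measure. primitive g x * deriv \<phi> x)"
    using L2_integrable[OF DL] L2_mult_integrable[OF primitive_L2[OF g] DL] D(2) by simp
  also have "\<dots> = - (LINT x|beam_measure. g x * primitive (deriv \<phi>) x)"
    using primitive_by_parts[OF g DL] D(2) by simp
  also have "(LINT x|beam_measure. g x * primitive (deriv \<phi>) x) = (LINT x|beam_measure. g x * \<phi> x)"
    by (rule Bochner_Integration.integral_cong) (use D(3) in auto)
  finally show "(LINT x|beam_measure. u x * deriv \<phi> x) = - (LINT x|beam_measure. g x * \<phi> x)" .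
qed (rule g)

lemma weak_deriv_imp_primitive:
  assumes "has_weak_deriv u g"
  shows "\<exists>c. AE x in beam_measure. u x = c + primitive g x"
proof -
  have u: "u \<in> L2" and g: "g \<in> L2"
    and ug: "\<And>\<phi>. test_function \<phi> \<Longrightarrow>
        (LINT x|beam_measure. u x * deriv \<phi> x) = - (LINT x|beam_measure. g x * \<phi> x)"
    using assms by (auto simp: has_weak_deriv_def)
  have w: "has_weak_deriv (\<lambda>x. 0 + primitive g x) g"
    by (rule has_weak_deriv_primitive[OF g, of _ 0]) (use L2D(1)[OF primitive_L2[OF g]] in auto)
  have "\<exists>c. AE x in beam_measure. u x - primitive g x = c"
  proof (rule du_bois_reymond)
    show "(\<lambda>x. u x - primitive g x) \<in> L2" by (intro L2_diff u primitive_L2 g)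
    fix \<phi> assume \<phi>: "test_function \<phi>"
    have DL: "deriv \<phi> \<in> L2" by (rule L2_continuous, rule test_function_primitive(1)[OF \<phi>])
    show "(LINT x|beam_measure. (u x - primitive g x) * deriv \<phi> x) = 0"
      using ug[OF \<phi>] w \<phi> L2_mult_integrable[OF u DL] L2_mult_integrable[OF primitive_L2[OF g] DL]
      by (simp add: has_weak_deriv_def left_diff_distrib)
  qed
  then obtain c where "AE x in beam_measure. u x - primitive g x = c" by blast
  then have "AE x in beam_measure. u x = c + primitive g x" by eventually_elim simp
  then show ?thesis ..
qed

lemma weak_deriv_unique:
  assumes "has_weak_deriv u g" "has_weak_deriv u h"
  shows "AE x in beam_measure. g x = h x"
proof -
  have g: "g \<in> L2" and h: "h \<in> L2"
    using assms by (auto simp: has_weak_deriv_def)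
  have "AE x in beam_measure. g x - h x = 0"
  proof (rule orthogonal_to_bumps_null)
    show "(\<lambda>x. g x - h x) \<in> L2" by (intro L2_diff g h)
    fix \<psi> assume \<psi>: "bump \<psi>"
    show "(LINT x|beam_measure. (g x - h x) * \<psi> x) = 0"
      using assms bump_test_function[OF \<psi>] L2_mult_integrable[OF g bump_L2[OF \<psi>]]
        L2_mult_integrable[OF h bump_L2[OF \<psi>]]
      by (simp add: has_weak_deriv_def left_diff_distrib)
  qed
  then show ?thesis by auto
qed

lemma weak_deriv_AE:
  assumes "has_weak_deriv u g"
  shows "has_weak_deriv u (weak_deriv u)" "AE x in beam_measure. weak_deriv u x = g x"
proof -
  show *: "has_weak_deriv u (weak_deriv u)"
    unfolding weak_deriv_def by (rule someI[of "has_weak_deriv u"]) (rule assms)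
  show "AE x in beam_measure. weak_deriv u x = g x"
    by (rule weak_deriv_unique[OF * assms])
qed

lemma has_weak_deriv_cong_AE:
  assumes "has_weak_deriv u g" "v \<in> borel_measurable beam_measure" "AE x in beam_measure. v x = u x"
  shows "has_weak_deriv v g"
proof -
  obtain c where "AE x in beam_measure. u x = c + primitive g x"
    using weak_deriv_imp_primitive[OF assms(1)] by blast
  then have v: "AE x in beam_measure. v x = c + primitive g x"
    using assms(3) by eventually_elim simp
  have "g \<in> L2" using assms(1) by (simp add: has_weak_deriv_def)
  then show ?thesis
    by (rule has_weak_deriv_primitive[OF _ assms(2) v])
qed

lemma H1_norm_bounds:
  assumes "has_weak_deriv w r" "H1_norm w < \<epsilon>"
  shows "(LINT x|beam_measure. (w x)\<^sup>2) \<le> \<epsilon>\<^sup>2" "(LINT x|beam_measure. (r x)\<^sup>2) \<le> \<epsilon>\<^sup>2"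
proof -
  have r: "r \<in> L2" and wd: "weak_deriv w \<in> L2"
    using assms(1) weak_deriv_AE(1)[OF assms(1)] by (auto simp: has_weak_deriv_def)
  note [measurable] = L2D(1)[OF r] L2D(1)[OF wd]
  have eq: "(LINT x|beam_measure. (weak_deriv w x)\<^sup>2) = (LINT x|beam_measure. (r x)\<^sup>2)"
    by (rule integral_cong_AE) (use weak_deriv_AE(2)[OF assms(1)] in auto)
  have nn: "0 \<le> (LINT x|beam_measure. (w x)\<^sup>2)" "0 \<le> (LINT x|beam_measure. (r x)\<^sup>2)"
    by (auto intro: integral_nonneg_AE)
  have "(LINT x|beam_measure. (w x)\<^sup>2) + (LINT x|beam_measure. (r x)\<^sup>2) \<le> \<epsilon>\<^sup>2"
    using assms(2) nn unfolding H1_norm_def eq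
    by (smt (verit) real_less_lsqrt real_sqrt_ge_zero sqrt_le_D power_mono real_sqrt_pow2)
  then show "(LINT x|beam_measure. (w x)\<^sup>2) \<le> \<epsilon>\<^sup>2" "(LINT x|beam_measure. (r x)\<^sup>2) \<le> \<epsilon>\<^sup>2"
    using nn by linarith+
qed

text \<open>
  Approximate \<open>g\<close> by a bump, correct the bump to mean zero, and integrate: the primitive of the
  result is a test function close to \<open>u\<close> in the \<open>H\<^sup>1\<close> norm.
\<close>

lemma primitive_H10:
  assumes g: "continuous_on {-pi..pi} g" and mean: "(LINT x|beam_measure. g x) = 0"
    and u: "u \<in> borel_measurable beam_measure" and eq: "AE x in beam_measure. u x = primitive g x"
  shows "u \<in> H10"
  unfolding H10_def
proof (intro CollectI conjI allI impI)
  note gL = L2_continuous[OF g]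
  have "has_weak_deriv u g"
    by (rule has_weak_deriv_primitive[OF gL u, of 0]) (use eq in auto)
  then show "u \<in> H1" by (auto simp: H1_def)
  fix \<epsilon> :: real assume "\<epsilon> > 0"
  obtain \<rho> where \<rho>: "bump \<rho>" "(LINT x|beam_measure. \<rho> x) = 1"
    using mean_one_bump by blast
  note \<rho>L = bump_L2[OF \<rho>(1)]
  define R where "R = (LINT x|beam_measure. (\<rho> x)\<^sup>2)"
  have R: "R \<ge> 0" unfolding R_def by (rule integral_nonneg_AE) simp
  \<comment> \<open>The first factor bounds the squared \<open>H\<^sup>1\<close> norm of a primitive by the squared \<open>L\<^sup>2\<close>
    norm of its derivative, the second accounts for the correction of the mean.\<close>
  define C where "C = (4 * pi\<^sup>2 + 1) * (2 + 4 * pi * R)"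
  have C: "C > 0" using R by (auto simp: C_def intro!: mult_pos_pos add_pos_nonneg)
  obtain \<psi> where \<psi>: "bump \<psi>" and small: "(LINT x|beam_measure. (g x - \<psi> x)\<^sup>2) < \<epsilon>\<^sup>2 / C"
    using bump_dense[OF g, of "\<epsilon>\<^sup>2 / C"] C \<open>\<epsilon> > 0\<close> by auto
  note \<psi>L = bump_L2[OF \<psi>]
  define k where "k = (LINT x|beam_measure. \<psi> x)"
  define \<eta> where "\<eta> x = \<psi> x - k * \<rho> x" for x
  have \<eta>: "bump \<eta>" unfolding \<eta>_def by (rule bump_sub_cmult[OF \<psi> \<rho>(1)])
  note \<eta>L = bump_L2[OF \<eta>]
  have \<eta>0: "(LINT x|beam_measure. \<eta> x) = 0"
    unfolding \<eta>_def using L2_integrable[OF \<psi>L] L2_integrable[OF \<rho>L] \<rho>(2) by (simp add: k_def)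
  obtain \<phi> where \<phi>: "test_function \<phi>" "\<And>x. x \<in> {-pi..pi} \<Longrightarrow> \<phi> x = primitive \<eta> x"
    using bump_primitive[OF \<eta> \<eta>0] by blast
  define r where "r x = g x - \<eta> x" for x
  have rL: "r \<in> L2" unfolding r_def by (intro L2_diff gL \<eta>L)
  have w: "AE x in beam_measure. u x - \<phi> x = 0 + primitive r x"
    using eq AE_space
  proof eventually_elim
    fix x assume "u x = primitive g x" "x \<in> space beam_measure"
    then show "u x - \<phi> x = 0 + primitive r x"
      using \<phi>(2)[of x] unfolding r_def by (simp add: primitive_diff[OF gL \<eta>L])
  qed
  have \<phi>m: "\<phi> \<in> borel_measurable beam_measure"
  proof (rule measurable_cong[THEN iffD2])
    show "primitive \<eta> \<in> borel_measurable beam_measure" using L2D(1)[OF primitive_L2[OF \<eta>L]] .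
  qed (use \<phi>(2) in auto)
  note [measurable] = u \<phi>m L2D(1)[OF primitive_L2[OF rL]] L2D(1)[OF rL]
  have hw: "has_weak_deriv (\<lambda>x. u x - \<phi> x) r"
    by (rule has_weak_deriv_primitive[OF rL _ w]) measurable
  have wdL: "weak_deriv (\<lambda>x. u x - \<phi> x) \<in> L2"
    using weak_deriv_AE(1)[OF hw] by (simp add: has_weak_deriv_def)
  note [measurable] = L2D(1)[OF wdL]
  define S where "S = (LINT x|beam_measure. (r x)\<^sup>2)"
  have S0: "S \<ge> 0" unfolding S_def by (rule integral_nonneg_AE) simp
  have e1: "(LINT x|beam_measure. (weak_deriv (\<lambda>x. u x - \<phi> x) x)\<^sup>2) = S"
    unfolding S_def by (rule integral_cong_AE) (use weak_deriv_AE(2)[OF hw] in auto)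
  have e2: "(LINT x|beam_measure. (u x - \<phi> x)\<^sup>2) \<le> 4 * pi\<^sup>2 * S"
  proof -
    have "(LINT x|beam_measure. (u x - \<phi> x)\<^sup>2) = (LINT x|beam_measure. (primitive r x)\<^sup>2)"
      by (rule integral_cong_AE) (use w in auto)
    also have "\<dots> \<le> (LINT x|beam_measure. 2 * pi * S)"
      by (rule integral_mono) (use L2D(2)[OF primitive_L2[OF rL]] primitive_bound[OF rL] in \<open>auto simp: S_def\<close>)
    finally show ?thesis by (simp add: integral_const_beam power2_eq_square)
  qed
  define D where "D = (LINT x|beam_measure. (g x - \<psi> x)\<^sup>2)"
  have kk: "k\<^sup>2 \<le> 2 * pi * D"
  proof -
    have "(LINT x|beam_measure. g x - \<psi> x) = - k"
      using L2_integrable[OF gL] L2_integrable[OF \<psi>L] mean by (simp add: k_def)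
    then show ?thesis using integral_bound_L2[OF L2_diff[OF gL \<psi>L]] by (simp add: D_def)
  qed
  have "S \<le> (LINT x|beam_measure. 2 * (g x - \<psi> x)\<^sup>2 + 2 * k\<^sup>2 * (\<rho> x)\<^sup>2)"
    unfolding S_def
  proof (rule integral_mono)
    fix x
    have *: "(u + v)\<^sup>2 \<le> 2 * u\<^sup>2 + 2 * v\<^sup>2" for u v :: real
      using zero_le_power2[of "u - v"] by (simp add: power2_eq_square algebra_simps)
    show "(r x)\<^sup>2 \<le> 2 * (g x - \<psi> x)\<^sup>2 + 2 * k\<^sup>2 * (\<rho> x)\<^sup>2"
      using *[of "g x - \<psi> x" "k * \<rho> x"] by (simp add: r_def \<eta>_def algebra_simps power_mult_distrib)
  qed (use L2D(2)[OF L2_diff[OF gL \<psi>L]] L2D(2)[OF \<rho>L] L2D(2)[OF rL] in auto)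
  also have "\<dots> = 2 * D + 2 * k\<^sup>2 * R"
    using L2D(2)[OF L2_diff[OF gL \<psi>L]] L2D(2)[OF \<rho>L] by (simp add: D_def R_def)
  also have "\<dots> \<le> 2 * D + 2 * (2 * pi * D) * R"
    using kk R by (intro add_left_mono mult_right_mono mult_left_mono) auto
  finally have SD: "S \<le> (2 + 4 * pi * R) * D" by (simp add: algebra_simps)
  have "(4 * pi\<^sup>2 + 1) * S \<le> (4 * pi\<^sup>2 + 1) * ((2 + 4 * pi * R) * D)"
    by (rule mult_left_mono[OF SD]) simp
  also have "\<dots> = C * D" by (simp add: C_def)
  also have "\<dots> < C * (\<epsilon>\<^sup>2 / C)" using small C by (simp only: D_def mult_less_cancel_left_pos)
  also have "\<dots> = \<epsilon>\<^sup>2" using C by simp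
  finally have "(4 * pi\<^sup>2 + 1) * S < \<epsilon>\<^sup>2" .
  then have "(LINT x|beam_measure. (u x - \<phi> x)\<^sup>2) + S < \<epsilon>\<^sup>2"
    using e2 by (simp add: algebra_simps)
  then have "H1_norm (\<lambda>x. u x - \<phi> x) < \<epsilon>"
    unfolding H1_norm_def e1 using \<open>\<epsilon> > 0\<close> by (simp add: real_less_lsqrt)
  then show "\<exists>\<phi>. test_function \<phi> \<and> H1_norm (\<lambda>x. u x - \<phi> x) < \<epsilon>"
    using \<phi>(1) by blast
qed

lemma primitive_one: "x \<in> {-pi..pi} \<Longrightarrow> primitive (\<lambda>_. 1) x = x + pi"
  using primitive_FTC[of "\<lambda>x. x" "\<lambda>_. 1" x] by auto

text \<open>
  Limits of test functions vanish at both ends. The functionals \<open>u(\<pi>) - u(-\<pi>) = \<integral>u'\<close> and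
  \<open>2\<pi> u(\<pi>) = \<integral>u + \<integral>u'(x + \<pi>)\<close> are continuous in the \<open>H\<^sup>1\<close> norm and vanish on test
  functions.
\<close>

lemma H10_boundary:
  assumes u: "u \<in> H10" and g: "g \<in> L2" and eq: "AE x in beam_measure. u x = c + primitive g x"
  shows "c = 0" "(LINT x|beam_measure. g x) = 0"
proof -
  define G where "G = (LINT x|beam_measure. g x)"
  define X where "X = (LINT x|beam_measure. (x + pi)\<^sup>2)"
  have X0: "X \<ge> 0" unfolding X_def by (rule integral_nonneg_AE) simp
  have um: "u \<in> borel_measurable beam_measure"
    using u by (auto simp: H10_def H1_def has_weak_deriv_def L2_def)
  have xL: "(\<lambda>x. x + pi) \<in> L2" by (rule L2_continuous) (intro continuous_intros)
  have main: "(LINT x|beam_measure. c + primitive f x) + (LINT x|beam_measure. f x * (x + pi))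
      = 2 * pi * (c + (LINT x|beam_measure. f x))" if f: "f \<in> L2" for f c
  proof -
    have "(LINT x|beam_measure. f x * primitive (\<lambda>_. 1) x) = (LINT x|beam_measure. f x * (x + pi))"
      by (rule Bochner_Integration.integral_cong) (auto simp: primitive_one)
    then show ?thesis
      using primitive_by_parts[OF f L2_const[of 1]] L2_integrable[OF primitive_L2[OF f]]
      by (simp add: integral_const_beam algebra_simps measure_beam)
  qed
  have est: "G\<^sup>2 \<le> 2 * pi * e \<and> (2 * pi * (c + G))\<^sup>2 \<le> (4 * pi + 2 * X) * e" if "e > 0" for e
  proof -
    have "sqrt e > 0" using that by simp
    then obtain \<phi> where \<phi>: "test_function \<phi>" "H1_norm (\<lambda>x. u x - \<phi> x) < sqrt e"
      using u unfolding H10_def by blast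
    note D = test_function_primitive[OF \<phi>(1)]
    note DL = L2_continuous[OF D(1)]
    define r where "r x = g x - deriv \<phi> x" for x
    have rL: "r \<in> L2" unfolding r_def by (intro L2_diff g DL)
    have w: "AE x in beam_measure. u x - \<phi> x = c + primitive r x"
      using eq AE_space
    proof eventually_elim
      fix x assume "u x = c + primitive g x" "x \<in> space beam_measure"
      then show "u x - \<phi> x = c + primitive r x"
        using D(3)[of x] unfolding r_def by (simp add: primitive_diff[OF g DL])
    qed
    have \<phi>m: "\<phi> \<in> borel_measurable beam_measure"
    proof (rule measurable_cong[THEN iffD2])
      show "primitive (deriv \<phi>) \<in> borel_measurable beam_measure" using L2D(1)[OF primitive_L2[OF DL]] .
    qed (use D(3) in auto)
    note [measurable] = um \<phi>m L2D(1)[OF primitive_L2[OF rL]] L2D(1)[OF rL]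
    have hw: "has_weak_deriv (\<lambda>x. u x - \<phi> x) r"
      by (rule has_weak_deriv_primitive[OF rL _ w]) measurable
    note small = H1_norm_bounds[OF hw \<phi>(2)]
    have G: "(LINT x|beam_measure. r x) = G"
      unfolding r_def G_def using L2_integrable[OF g] L2_integrable[OF DL] D(2) by simp
    have "G\<^sup>2 \<le> 2 * pi * (LINT x|beam_measure. (r x)\<^sup>2)"
      using integral_bound_L2[OF rL] by (simp add: G)
    also have "\<dots> \<le> 2 * pi * e" using small(2) that by simp
    finally have 1: "G\<^sup>2 \<le> 2 * pi * e" .
    have wL: "(\<lambda>x. u x - \<phi> x) \<in> L2" using hw by (simp add: has_weak_deriv_def)
    have "2 * pi * (c + G) = (LINT x|beam_measure. u x - \<phi> x) + (LINT x|beam_measure. r x * (x + pi))"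
    proof -
      have "(LINT x|beam_measure. u x - \<phi> x) = (LINT x|beam_measure. c + primitive r x)"
        by (rule integral_cong_AE) (use w in auto)
      then show ?thesis using main[OF rL, of c] by (simp add: G)
    qed
    then have "(2 * pi * (c + G))\<^sup>2 \<le> 2 * (LINT x|beam_measure. u x - \<phi> x)\<^sup>2 + 2 * (LINT x|beam_measure. r x * (x + pi))\<^sup>2"
      using zero_le_power2[of "(LINT x|beam_measure. u x - \<phi> x) - (LINT x|beam_measure. r x * (x + pi))"]
      by (simp add: power2_eq_square algebra_simps)
    also have "\<dots> \<le> 2 * (2 * pi * (LINT x|beam_measure. (u x - \<phi> x)\<^sup>2)) + 2 * ((LINT x|beam_measure. (r x)\<^sup>2) * X)"
      unfolding X_def using integral_bound_L2[OF wL] L2_cauchy_schwarz[OF rL xL]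
      by (intro add_mono mult_left_mono) auto
    also have "\<dots> \<le> 2 * (2 * pi * e) + 2 * (e * X)"
      using small that X0 by (intro add_mono mult_left_mono mult_right_mono) auto
    finally show ?thesis using 1 by (simp add: algebra_simps)
  qed
  have lim0: "t = 0" if "\<And>e. e > 0 \<Longrightarrow> t\<^sup>2 \<le> K * e" "K > 0" for t K :: real
  proof -
    have "t\<^sup>2 \<le> 0 + e" if "e > 0" for e
      using \<open>\<And>e. e > 0 \<Longrightarrow> t\<^sup>2 \<le> K * e\<close>[of "e / K"] that \<open>K > 0\<close> by simp
    then have "t\<^sup>2 \<le> 0" by (rule field_le_epsilon)
    then show ?thesis by simp
  qed
  have "G = 0" using lim0[of G "2 * pi"] est by simp
  moreover have "2 * pi * (c + G) = 0"
    using lim0[of "2 * pi * (c + G)" "4 * pi + 2 * X"] est X0 by (simp add: add_pos_nonneg)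
  ultimately show "c = 0" "(LINT x|beam_measure. g x) = 0" by (auto simp: G_def)
qed

section \<open>The Green operator of the second derivative\<close>

definition ip2 :: "(real \<Rightarrow> real) \<Rightarrow> (real \<Rightarrow> real) \<Rightarrow> real" where
  "ip2 f g = (LINT x|beam_measure. f x * g x)"

lemma ip2_sym: "ip2 f g = ip2 g f"
  by (simp add: ip2_def mult.commute)

lemma ip2_self: "ip2 f f = (LINT x|beam_measure. (f x)\<^sup>2)"
  by (simp add: ip2_def power2_eq_square)

lemma ip2_nonneg: "0 \<le> ip2 f f"
  unfolding ip2_self by (rule integral_nonneg_AE) simp

lemma ip2_add:
  "f \<in> L2 \<Longrightarrow> g \<in> L2 \<Longrightarrow> h \<in> L2 \<Longrightarrow> ip2 (\<lambda>x. f x + g x) h = ip2 f h + ip2 g h"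
  by (simp add: ip2_def distrib_right L2_mult_integrable)

lemma ip2_diff:
  "f \<in> L2 \<Longrightarrow> g \<in> L2 \<Longrightarrow> h \<in> L2 \<Longrightarrow> ip2 (\<lambda>x. f x - g x) h = ip2 f h - ip2 g h"
  by (simp add: ip2_def left_diff_distrib L2_mult_integrable)

lemma ip2_cmult: "ip2 (\<lambda>x. c * f x) h = c * ip2 f h"
  by (simp add: ip2_def mult.assoc)

lemma ip2_uminus: "ip2 (\<lambda>x. - f x) h = - ip2 f h"
  by (simp add: ip2_def)

lemma ip2_cong_AE:
  assumes "f \<in> L2" "g \<in> borel_measurable beam_measure" "h \<in> L2" "AE x in beam_measure. f x = g x"
  shows "ip2 f h = ip2 g h"
  unfolding ip2_def
  by (rule integral_cong_AE) (use assms L2D(1) in auto)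

lemma ip2_cong:
  "(\<And>x. x \<in> beam \<Longrightarrow> f x = g x) \<Longrightarrow> (\<And>x. x \<in> beam \<Longrightarrow> h x = k x) \<Longrightarrow> ip2 f h = ip2 g k"
  unfolding ip2_def by (rule Bochner_Integration.integral_cong) auto

lemma ip2_cauchy_schwarz: "f \<in> L2 \<Longrightarrow> g \<in> L2 \<Longrightarrow> (ip2 f g)\<^sup>2 \<le> ip2 f f * ip2 g g"
  using L2_cauchy_schwarz unfolding ip2_def[of f g] ip2_self by blast

text \<open>
  The Green function of \<open>-d\<^sup>2/dx\<^sup>2\<close> on \<open>(-\<pi>,\<pi>)\<close> with Dirichlet conditions: as a function
  of \<open>t\<close> it is piecewise linear, vanishes at both ends and has a kink at \<open>x\<close>.
\<close>

definition hat :: "real \<Rightarrow> real \<Rightarrow> real" where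
  "hat x t = min t x + pi - (t + pi) * (x + pi) / (2 * pi)"

definition K :: "(real \<Rightarrow> real) \<Rightarrow> real \<Rightarrow> real" where
  "K h x = ip2 (hat x) h"

text \<open>
  The derivative of \<open>K h\<close> at the left end.
\<close>

definition slope :: "(real \<Rightarrow> real) \<Rightarrow> real" where
  "slope h = (LINT x|beam_measure. primitive h x) / (2 * pi)"

text \<open>
  The derivative of \<open>K h\<close>, by \<open>K_primitive\<close>.
\<close>

definition K' :: "(real \<Rightarrow> real) \<Rightarrow> real \<Rightarrow> real" where
  "K' h x = slope h - primitive h x"

lemma hat_continuous: "continuous_on A (hat x)"
  unfolding hat_def[abs_def] by (intro continuous_intros) auto

lemma hat_L2: "hat x \<in> L2"
  by (rule L2_continuous) (rule hat_continuous)

lemma hat_bound: "x \<in> {-pi..pi} \<Longrightarrow> t \<in> {-pi..pi} \<Longrightarrow> (hat x t)\<^sup>2 \<le> (2 * pi)\<^sup>2"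
proof -
  assume a: "x \<in> {-pi..pi}" "t \<in> {-pi..pi}"
  have "0 \<le> (t + pi) * (x + pi)" using a by simp
  moreover have "(t + pi) * (x + pi) \<le> (2 * pi) * (2 * pi)"
    using a by (intro mult_mono) auto
  ultimately have "0 \<le> (t + pi) * (x + pi) / (2 * pi)" "(t + pi) * (x + pi) / (2 * pi) \<le> 2 * pi"
    by (auto simp: pos_divide_le_eq)
  moreover have "- pi \<le> min t x" "min t x \<le> pi" using a by auto
  ultimately have "\<bar>hat x t\<bar> \<le> 2 * pi" unfolding hat_def by linarith
  then show ?thesis using abs_le_square_iff[of "hat x t" "2 * pi"] by simp
qed

lemma K'_continuous: "h \<in> L2 \<Longrightarrow> continuous_on {-pi..pi} (K' h)"
  unfolding K'_def[abs_def] by (intro continuous_intros primitive_continuous)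

lemma K'_L2: "h \<in> L2 \<Longrightarrow> K' h \<in> L2"
  by (rule L2_continuous) (rule K'_continuous)

lemma K'_mean: "h \<in> L2 \<Longrightarrow> (LINT x|beam_measure. K' h x) = 0"
  unfolding K'_def using L2_integrable[OF primitive_L2] by (simp add: slope_def)

text \<open>
  The kernel form of the operator makes the value at a point an inner product with a hat function;
  this form shows that \<open>K h\<close> is twice weakly differentiable with second derivative
  \<open>-h\<close>.
\<close>

lemma K_primitive:
  assumes h: "h \<in> L2" and x: "x \<in> {-pi..pi}"
  shows "K h x = primitive (K' h) x"
proof -
  define M where "M = (LINT t|beam_measure. h t)"
  define c where "c y = (\<lambda>t::real. if t < y then 1 else (0::real))" for y
  have cL: "c y \<in> L2" for y unfolding c_def by (rule L2_cut) simp
  have pc: "primitive (c y) t = min t y + pi" if "y \<in> {-pi..pi}" "t \<in> {-pi..pi}" for y t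
  proof -
    have "primitive (c y) t = primitive (\<lambda>_. 1) (min t y)"
      unfolding primitive_def c_def by (rule Bochner_Integration.integral_cong) auto
    moreover have "min t y \<in> {-pi..pi}" using that by (auto simp: min_def)
    ultimately show ?thesis using primitive_one by simp
  qed
  have pp: "primitive (primitive h) y = (y + pi) * M - ip2 (\<lambda>t. min t y + pi) h" if y: "y \<in> {-pi..pi}" for y
  proof -
    have "primitive (primitive h) y = (LINT t|beam_measure. primitive h t * c y t)"
      unfolding primitive_def[of "primitive h"] by (rule Bochner_Integration.integral_cong) (auto simp: c_def)
    also have "\<dots> = M * (LINT t|beam_measure. c y t) - (LINT t|beam_measure. h t * primitive (c y) t)"
      using primitive_by_parts[OF h cL[of y]] by (simp add: M_def)
    also have "(LINT t|beam_measure. c y t) = y + pi"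
      using primitive_right[of pi "c y"] pc[OF y, of pi] y by simp
    also have "(LINT t|beam_measure. h t * primitive (c y) t) = ip2 (\<lambda>t. min t y + pi) h"
      unfolding ip2_def by (rule Bochner_Integration.integral_cong) (use pc y in auto)
    finally show ?thesis by (simp add: mult.commute)
  qed
  have L1: "(\<lambda>t. min t y + pi) \<in> L2" for y
    by (rule L2_continuous) (intro continuous_intros)
  have L2': "(\<lambda>t. t + pi) \<in> L2"
    by (rule L2_continuous) (intro continuous_intros)
  have "2 * pi * slope h = 2 * pi * M - ip2 (\<lambda>t. min t pi + pi) h"
    using pp[of pi] by (simp add: slope_def primitive_right)
  also have "ip2 (\<lambda>t. min t pi + pi) h = ip2 (\<lambda>t. t + pi) h"
    by (rule ip2_cong) auto
  finally have sl: "slope h = M - ip2 (\<lambda>t. t + pi) h / (2 * pi)"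
    by (simp add: field_simps)
  have "primitive (K' h) x = slope h * (x + pi) - primitive (primitive h) x"
    unfolding K'_def[abs_def]
    using primitive_diff[OF L2_const primitive_L2[OF h], of "slope h" x] primitive_cmult[of "slope h" "\<lambda>_. 1" x]
      primitive_one[OF x] by simp
  also have "\<dots> = ip2 (\<lambda>t. min t x + pi) h - (x + pi) / (2 * pi) * ip2 (\<lambda>t. t + pi) h"
    by (simp add: sl pp[OF x] algebra_simps)
  also have "\<dots> = ip2 (\<lambda>t. (min t x + pi) - (x + pi) / (2 * pi) * (t + pi)) h"
    using ip2_diff[OF L1[of x] L2_cmult[OF L2', of "(x + pi) / (2 * pi)"] h]
      ip2_cmult[of "(x + pi) / (2 * pi)" "\<lambda>t. t + pi" h] by simp
  also have "\<dots> = K h x"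
    unfolding K_def by (rule ip2_cong) (auto simp: hat_def mult.commute)
  finally show ?thesis by simp
qed

lemma K_continuous: "h \<in> L2 \<Longrightarrow> continuous_on {-pi..pi} (K h)"
  using continuous_on_cong[THEN iffD2, OF refl K_primitive primitive_continuous[OF K'_L2]] by blast

lemma K_L2: "h \<in> L2 \<Longrightarrow> K h \<in> L2"
  by (rule L2_continuous) (rule K_continuous)

lemma K_ends:
  assumes "h \<in> L2" shows "K h (-pi) = 0" "K h pi = 0"
  using K_primitive[OF assms, of "-pi"] K_primitive[OF assms, of pi] K'_mean[OF assms]
  by (auto simp: primitive_right)

lemma K_energy:
  assumes f: "f \<in> L2" and g: "g \<in> L2"
  shows "ip2 (K f) g = ip2 (K' f) (K' g)"
proof -
  have "ip2 (K f) g = (LINT x|beam_measure. primitive (K' f) x * g x)"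
    unfolding ip2_def by (rule Bochner_Integration.integral_cong) (auto simp: K_primitive[OF f])
  also have "\<dots> = - (LINT x|beam_measure. K' f x * primitive g x)"
    using primitive_by_parts[OF K'_L2[OF f] g] K'_mean[OF f] by simp
  also have "\<dots> = - (LINT x|beam_measure. slope g * K' f x - K' f x * K' g x)"
    unfolding K'_def[of g] by (simp add: algebra_simps)
  also have "\<dots> = ip2 (K' f) (K' g)"
    using L2_integrable[OF K'_L2[OF f]] L2_mult_integrable[OF K'_L2[OF f] K'_L2[OF g]] K'_mean[OF f]
    by (simp add: ip2_def)
  finally show ?thesis .
qed

lemma K_sym: "f \<in> L2 \<Longrightarrow> g \<in> L2 \<Longrightarrow> ip2 (K f) g = ip2 f (K g)"
  using K_energy[of f g] K_energy[of g f] ip2_sym by metis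

lemma K_bound:
  assumes h: "h \<in> L2" and x: "x \<in> {-pi..pi}"
  shows "(K h x)\<^sup>2 \<le> 8 * pi ^ 3 * ip2 h h"
proof -
  have "ip2 (hat x) (hat x) \<le> (LINT t|beam_measure. (2 * pi)\<^sup>2)"
    unfolding ip2_self
    by (rule integral_mono) (use L2D(2)[OF hat_L2] hat_bound[OF x] in auto)
  then have "ip2 (hat x) (hat x) \<le> 8 * pi ^ 3"
    by (simp add: power2_eq_square power3_eq_cube)
  then have "ip2 (hat x) (hat x) * ip2 h h \<le> 8 * pi ^ 3 * ip2 h h"
    by (rule mult_right_mono) (rule ip2_nonneg)
  then show ?thesis
    using ip2_cauchy_schwarz[OF hat_L2 h, of x] by (simp add: K_def)
qed

lemma K_norm:
  assumes h: "h \<in> L2"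
  shows "ip2 (K h) (K h) \<le> 16 * pi ^ 4 * ip2 h h"
proof -
  have "ip2 (K h) (K h) \<le> (LINT t|beam_measure. 8 * pi ^ 3 * ip2 h h)"
    unfolding ip2_self[of "K h"]
    by (rule integral_mono) (use L2D(2)[OF K_L2[OF h]] K_bound[OF h] in auto)
  then show ?thesis by (simp add: power3_eq_cube power4_eq_xxxx)
qed

lemma K'_bound:
  assumes h: "h \<in> L2"
  shows "(K' h x)\<^sup>2 \<le> 8 * pi * ip2 h h"
proof -
  have nn: "0 \<le> ip2 h h" by (rule ip2_nonneg)
  have "(LINT x|beam_measure. primitive h x)\<^sup>2 \<le> 2 * pi * (LINT x|beam_measure. (primitive h x)\<^sup>2)"
    by (rule integral_bound_L2[OF primitive_L2[OF h]])
  also have "(LINT x|beam_measure. (primitive h x)\<^sup>2) \<le> (LINT x|beam_measure. 2 * pi * ip2 h h)"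
    unfolding ip2_self
    by (rule integral_mono) (use L2D(2)[OF primitive_L2[OF h]] primitive_bound[OF h] in auto)
  finally have "(2 * pi * slope h)\<^sup>2 \<le> 2 * pi * (2 * pi * (2 * pi * ip2 h h))"
    by (simp add: slope_def mult_left_mono)
  then have "(2 * pi)\<^sup>2 * (slope h)\<^sup>2 \<le> (2 * pi)\<^sup>2 * (2 * pi * ip2 h h)"
    by (simp add: power2_eq_square algebra_simps)
  then have s: "(slope h)\<^sup>2 \<le> 2 * pi * ip2 h h"
    by (rule mult_left_le_imp_le) simp
  have p: "(primitive h x)\<^sup>2 \<le> 2 * pi * ip2 h h"
    using primitive_bound[OF h] by (simp add: ip2_self)
  have "(K' h x)\<^sup>2 \<le> 2 * (slope h)\<^sup>2 + 2 * (primitive h x)\<^sup>2"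
    using zero_le_power2[of "slope h + primitive h x"]
    by (simp add: K'_def power2_eq_square algebra_simps)
  then show ?thesis using s p by linarith
qed

lemma K_second_derivative:
  assumes u: "\<And>x. (u has_real_derivative u1 x) (at x)" and u1: "\<And>x. (u1 has_real_derivative u2 x) (at x)"
    and u2: "continuous_on {-pi..pi} u2" and ends: "u (-pi) = 0" "u pi = 0" and x: "x \<in> {-pi..pi}"
  shows "K u2 x = - u x"
proof -
  have c1: "continuous_on {-pi..pi} u1"
    using u1 by (meson DERIV_isCont continuous_at_imp_continuous_on)
  note L = L2_continuous[OF u2] L2_continuous[OF c1]
  have p1: "primitive u2 t = u1 t - u1 (-pi)" if "t \<in> {-pi..pi}" for t
    by (rule primitive_FTC[OF has_field_derivative_at_within[OF u1] u2 that])
  have p0: "primitive u1 t = u t" if "t \<in> {-pi..pi}" for t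
    using primitive_FTC[OF has_field_derivative_at_within[OF u] c1 that] ends by simp
  have "(LINT t|beam_measure. primitive u2 t) = (LINT t|beam_measure. u1 t - u1 (-pi))"
    by (rule Bochner_Integration.integral_cong) (use p1 in auto)
  also have "\<dots> = - (2 * pi * u1 (-pi))"
    using L2_integrable[OF L(2)] p0[of pi] ends by (simp add: primitive_right)
  finally have "slope u2 = - u1 (-pi)" by (simp add: slope_def)
  then have "primitive (K' u2) x = primitive (\<lambda>t. (-1) * u1 t) x"
    by (intro primitive_cong) (simp add: K'_def p1)
  also have "\<dots> = - u x"
    using primitive_cmult[of "-1" u1 x] p0[OF x] by simp
  finally show ?thesis by (simp add: K_primitive[OF L(1) x])
qed

lemma continuous_null_open:
  fixes f :: "real \<Rightarrow> real"
  assumes f: "continuous_on beam f" and null: "AE x in beam_measure. f x = 0" and x: "x \<in> beam"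
  shows "f x = 0"
proof -
  define U where "U = {x \<in> beam. f x \<noteq> 0}"
  have "open U"
    unfolding U_def using continuous_open_preimage[OF f, of "- {0}"]
    by (simp add: vimage_def Int_def open_Compl)
  moreover have "negligible U"
  proof -
    have "AE x in lebesgue. x \<in> beam \<longrightarrow> f x = 0"
      using null by (auto simp: AE_restrict_space_iff)
    then have "AE x in lebesgue. x \<notin> U" by eventually_elim (auto simp: U_def)
    then show ?thesis
      by (simp add: negligible_iff_null_sets AE_iff_null_sets[OF lborelD_Collect] AE_iff_null \<open>open U\<close>)
  qed
  ultimately have "U = {}" using open_not_negligible by blast
  then show ?thesis using x by (auto simp: U_def)
qed

lemma continuous_null:
  fixes f :: "real \<Rightarrow> real"
  assumes f: "continuous_on {-pi..pi} f" and null: "AE x in beam_measure. f x = 0" and x: "x \<in> {-pi..pi}"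
  shows "f x = 0"
proof -
  have fb: "continuous_on beam f" by (rule continuous_on_subset[OF f]) auto
  have z: "f t = 0" if "t \<in> beam" for t by (rule continuous_null_open[OF fb null that])
  have "x \<in> closure beam" using x by simp
  then show ?thesis
    using continuous_constant_on_closure[of beam f 0 x] f z by simp
qed

section \<open>The solution operator of the weighted beam\<close>

text \<open>
  The Fourier coefficient of \<open>f\<close> along \<open>b\<close>. If \<open>b\<close> is a null function the quotient is
  \<open>0/0 = 0\<close>, which is the right value since then \<open>ip2 f b = 0\<close>.
\<close>

definition coef :: "(real \<Rightarrow> real) \<Rightarrow> (real \<Rightarrow> real) \<Rightarrow> real" where
  "coef f b = ip2 f b / ip2 b b"

lemma coef_cancel: "f \<in> L2 \<Longrightarrow> b \<in> L2 \<Longrightarrow> coef f b * ip2 b b = ip2 f b"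
  using ip2_cauchy_schwarz[of f b] by (cases "ip2 b b = 0") (auto simp: coef_def)

text \<open>
  The second derivatives of functions with zero boundary values that vanish at the piers, because
  \<open>ip2 g (hat x) = K g x\<close>.
\<close>

definition W :: "real \<Rightarrow> (real \<Rightarrow> real) set" where
  "W a = {g \<in> L2. ip2 g (hat (a * pi)) = 0 \<and> ip2 g (hat (- a * pi)) = 0}"

text \<open>
  The second step of the Gram-Schmidt process for the two hat functions.
\<close>

definition hat2 :: "real \<Rightarrow> real \<Rightarrow> real" where
  "hat2 a x = hat (- a * pi) x - coef (hat (- a * pi)) (hat (a * pi)) * hat (a * pi) x"

text \<open>
  The orthogonal projection onto \<open>W a\<close>.
\<close>

definition Proj :: "real \<Rightarrow> (real \<Rightarrow> real) \<Rightarrow> real \<Rightarrow> real" where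
  "Proj a f x = f x - coef f (hat (a * pi)) * hat (a * pi) x - coef f (hat2 a) * hat2 a x"

lemma hat2_L2: "hat2 a \<in> L2"
  unfolding hat2_def[abs_def] by (intro L2_diff L2_cmult hat_L2)

lemma hat2_orthogonal: "ip2 (hat2 a) (hat (a * pi)) = 0"
proof -
  have "ip2 (hat2 a) (hat (a * pi)) = ip2 (hat (- a * pi)) (hat (a * pi))
      - coef (hat (- a * pi)) (hat (a * pi)) * ip2 (hat (a * pi)) (hat (a * pi))"
    unfolding hat2_def[abs_def] by (simp only: ip2_diff[OF hat_L2 L2_cmult[OF hat_L2] hat_L2] ip2_cmult)
  then show ?thesis by (simp add: coef_cancel hat_L2)
qed

lemma Proj_L2: "f \<in> L2 \<Longrightarrow> Proj a f \<in> L2"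
  unfolding Proj_def[abs_def] by (intro L2_diff L2_cmult hat_L2 hat2_L2)

lemma Proj_ip:
  assumes "f \<in> L2" "g \<in> L2"
  shows "ip2 (Proj a f) g
    = ip2 f g - coef f (hat (a * pi)) * ip2 (hat (a * pi)) g - coef f (hat2 a) * ip2 (hat2 a) g"
proof -
  have "ip2 (Proj a f) g = ip2 (\<lambda>x. f x - coef f (hat (a * pi)) * hat (a * pi) x) g
      - ip2 (\<lambda>x. coef f (hat2 a) * hat2 a x) g"
    unfolding Proj_def[abs_def] by (intro ip2_diff L2_diff L2_cmult hat_L2 hat2_L2 assms)
  also have "ip2 (\<lambda>x. f x - coef f (hat (a * pi)) * hat (a * pi) x) g
      = ip2 f g - ip2 (\<lambda>x. coef f (hat (a * pi)) * hat (a * pi) x) g"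
    by (intro ip2_diff L2_cmult hat_L2 assms)
  finally show ?thesis by (simp add: ip2_cmult)
qed

lemma ip2_hat_minus:
  "g \<in> L2 \<Longrightarrow> ip2 (hat (- a * pi)) g
     = ip2 (hat2 a) g + coef (hat (- a * pi)) (hat (a * pi)) * ip2 (hat (a * pi)) g"
  unfolding hat2_def[abs_def] by (simp add: ip2_diff[OF hat_L2 L2_cmult[OF hat_L2]] ip2_cmult)

lemma Proj_W:
  assumes "f \<in> L2" shows "Proj a f \<in> W a"
proof -
  note P = Proj_L2[OF assms, of a]
  have 1: "ip2 (hat (a * pi)) (Proj a f) = 0"
    using Proj_ip[OF assms hat_L2, of a "a * pi"] coef_cancel[OF assms hat_L2, of "a * pi"]
    by (simp add: hat2_orthogonal ip2_sym)
  have 2: "ip2 (hat2 a) (Proj a f) = 0"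
    using Proj_ip[OF assms hat2_L2, of a a] coef_cancel[OF assms hat2_L2, of a]
    using hat2_orthogonal[of a] ip2_sym[of "hat2 a"] by (metis diff_self diff_zero mult_zero_right)
  show ?thesis
    using P 1 2 ip2_hat_minus[OF P] by (simp add: W_def ip2_sym[of "Proj a f"])
qed

lemma Proj_ip_W:
  assumes "f \<in> L2" "g \<in> W a" shows "ip2 (Proj a f) g = ip2 f g"
  using assms Proj_ip[of f g a] ip2_hat_minus[of g a] by (simp add: W_def ip2_sym[of _ g])

lemma Proj_contraction:
  assumes "f \<in> L2" shows "ip2 (Proj a f) (Proj a f) \<le> ip2 f f"
proof (cases "ip2 (Proj a f) (Proj a f) = 0")
  case True
  then show ?thesis using ip2_nonneg[of f] by simp
next
  case False
  then have p: "ip2 (Proj a f) (Proj a f) > 0" using ip2_nonneg[of "Proj a f"] by linarith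
  have "ip2 (Proj a f) (Proj a f) * ip2 (Proj a f) (Proj a f) \<le> ip2 f f * ip2 (Proj a f) (Proj a f)"
    using ip2_cauchy_schwarz[OF assms Proj_L2[OF assms], of a] Proj_ip_W[OF assms Proj_W[OF assms]]
    by (simp add: power2_eq_square)
  then show ?thesis using p by simp
qed

lemma Proj_expansion: "\<exists>b c. \<forall>x. Proj a f x = f x + b * hat (a * pi) x + c * hat (- a * pi) x"
proof (intro exI allI)
  fix x
  show "Proj a f x = f x + (coef f (hat2 a) * coef (hat (- a * pi)) (hat (a * pi)) - coef f (hat (a * pi))) * hat (a * pi) x
      + (- coef f (hat2 a)) * hat (- a * pi) x"
    unfolding Proj_def hat2_def by (simp add: algebra_simps)
qed

text \<open>
  Functions that are continuous on the closed interval are represented by bounded continuous functions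
  on the real line, which form a vector space. The forms
  below see only the values on the interval.
\<close>

definition ext :: "(real \<Rightarrow> real) \<Rightarrow> real \<Rightarrow>\<^sub>C real" where
  "ext h = (SOME g. \<forall>x\<in>{-pi..pi}. apply_bcontfun g x = h x)"

lemma ext_apply:
  assumes "continuous_on {-pi..pi} h" "x \<in> {-pi..pi}"
  shows "apply_bcontfun (ext h) x = h x"
proof -
  have "continuous_on (cbox (-pi) pi) h" using assms(1) by simp
  from continuous_on_cbox_bcontfunE[OF this] have "\<exists>g. \<forall>x\<in>{-pi..pi}. apply_bcontfun g x = h x"
    by (metis cbox_interval)
  from someI_ex[OF this] show ?thesis using assms(2) unfolding ext_def by blast
qed

lemma bcontfun_L2: "apply_bcontfun f \<in> L2"
  by (rule L2_continuous) simp

lemma apply_bcontfun_sum: "apply_bcontfun (\<Sum>i\<in>A. f i) x = (\<Sum>i\<in>A. apply_bcontfun (f i) x)"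
  by (induction A rule: infinite_finite_induct) (auto simp: plus_bcontfun.rep_eq)

lemma K_lipschitz:
  assumes h: "h \<in> L2" and x: "x \<in> {-pi..pi}" and y: "y \<in> {-pi..pi}"
  shows "\<bar>K h y - K h x\<bar> \<le> sqrt (8 * pi * ip2 h h) * \<bar>y - x\<bar>"
proof -
  define L where "L = sqrt (8 * pi * ip2 h h)"
  have B: "\<bar>K' h t\<bar> \<le> L" for t
    unfolding L_def using K'_bound[OF h] by (auto intro!: real_le_rsqrt)
  have AE: "AE t in beam_measure. - L \<le> K' h t \<and> K' h t \<le> L"
    using B by (auto simp: abs_le_iff minus_le_iff)
  have *: "\<bar>K h y - K h x\<bar> \<le> L * (y - x)" if "x \<in> {-pi..pi}" "y \<in> {-pi..pi}" "x \<le> y" for x y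
    using primitive_lipschitz[OF K'_L2[OF h] AE, of x y] that
    by (auto simp: K_primitive[OF h] abs_le_iff)
  show ?thesis
    using *[of x y] *[of y x] x y unfolding L_def[symmetric] by (cases "x \<le> y") auto
qed

lemma pier_bounds:
  assumes "0 < a" "a < 1"
  shows "0 < a * pi" "a * pi < pi" "-pi < a * pi" "-pi < - a * pi" "- a * pi < pi"
proof -
  show *: "0 < a * pi" "a * pi < pi"
    using assms mult_strict_right_mono[of a 1 pi] by auto
  have "- a * pi = - (a * pi)" by simp
  then show "-pi < a * pi" "-pi < - a * pi" "- a * pi < pi"
    using * pi_gt_zero by linarith+
qed

text \<open>
  The common form of the two applications of the Arzela-Ascoli theorem, to the images of the unit
  ball under the solution operator and to the primitives of weights.
\<close>

lemma lipschitz_sequence_compact: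
  fixes F :: "nat \<Rightarrow> real \<Rightarrow> real"
  assumes lip: "\<And>n x y. x \<in> {-pi..pi} \<Longrightarrow> y \<in> {-pi..pi} \<Longrightarrow> \<bar>F n y - F n x\<bar> \<le> L * \<bar>y - x\<bar>"
    and zero: "\<And>n. F n (-pi) = 0"
  obtains g r where "continuous_on {-pi..pi} g" "strict_mono (r :: nat \<Rightarrow> nat)"
    "\<And>e. 0 < e \<Longrightarrow> \<exists>N. \<forall>n\<ge>N. \<forall>x\<in>{-pi..pi}. \<bar>F (r n) x - g x\<bar> < e"
proof -
  define B where "B = \<bar>L\<bar> + 1"
  have B: "0 < B" "L \<le> B" by (auto simp: B_def)
  have lipB: "\<bar>F n y - F n x\<bar> \<le> B * \<bar>y - x\<bar>" if "x \<in> {-pi..pi}" "y \<in> {-pi..pi}" for n x y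
    using lip[OF that, of n] mult_right_mono[OF B(2), of "\<bar>y - x\<bar>"] by linarith
  obtain g r where g: "continuous_on {-pi..pi} g" and r: "strict_mono (r :: nat \<Rightarrow> nat)"
      and lim: "\<And>e. 0 < e \<Longrightarrow> \<exists>N. \<forall>n x. n \<ge> N \<and> x \<in> {-pi..pi} \<longrightarrow> norm (F (r n) x - g x) < e"
  proof (rule Arzela_Ascoli[of "{-pi..pi}" F "B * (2 * pi)"])
    show "norm (F n x) \<le> B * (2 * pi)" if "x \<in> {-pi..pi}" for n x
    proof -
      have "\<bar>F n x - F n (-pi)\<bar> \<le> B * \<bar>x - (-pi)\<bar>"
        by (rule lipB) (use that in auto)
      also have "\<dots> \<le> B * (2 * pi)" using that B by (intro mult_left_mono) auto
      finally show ?thesis by (simp add: zero)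
    qed
    fix x e :: real assume "x \<in> {-pi..pi}" "0 < e"
    have "norm (F n x - F n y) < e" if "y \<in> {-pi..pi}" "norm (x - y) < e / B" for n y
    proof -
      have "\<bar>F n x - F n y\<bar> \<le> B * \<bar>x - y\<bar>" by (rule lipB[OF that(1) \<open>x \<in> {-pi..pi}\<close>])
      also have "\<dots> < e" using that B by (simp add: field_simps)
      finally show ?thesis by simp
    qed
    then show "\<exists>d. 0 < d \<and> (\<forall>n y. y \<in> {-pi..pi} \<and> norm (x - y) < d \<longrightarrow> norm (F n x - F n y) < e)"
      using B \<open>0 < e\<close> by (intro exI[of _ "e / B"]) auto
  qed (simp, blast)
  show ?thesis
  proof (rule that[OF g r])
    fix e :: real assume "0 < e"
    from lim[OF this] show "\<exists>N. \<forall>n\<ge>N. \<forall>x\<in>{-pi..pi}. \<bar>F (r n) x - g x\<bar> < e"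
      unfolding real_norm_def by blast
  qed
qed

locale weighted_beam =
  fixes a \<alpha> \<beta> :: real and p :: "real \<Rightarrow> real"
  assumes a_range: "0 < a" "a < 1" and \<alpha>_pos: "0 < \<alpha>" and p_measurable: "p \<in> borel_measurable beam_measure"
    and p_bounds: "AE x in beam_measure. \<alpha> \<le> p x \<and> p x \<le> \<beta>"
begin

text \<open>
  The bending moment of the beam under the load \<open>p f\<close>: if \<open>u\<close> is the deflection, then
  \<open>u'' = - mom f\<close> and \<open>u = K (mom f)\<close>.
\<close>

definition mom :: "(real \<Rightarrow> real) \<Rightarrow> real \<Rightarrow> real" where
  "mom f = Proj a (K (\<lambda>t. p t * f t))"

definition ipp :: "(real \<Rightarrow>\<^sub>C real) \<Rightarrow> (real \<Rightarrow>\<^sub>C real) \<Rightarrow> real" where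
  "ipp f g = ip2 (\<lambda>t. p t * apply_bcontfun f t) (apply_bcontfun g)"

definition T :: "(real \<Rightarrow>\<^sub>C real) \<Rightarrow> (real \<Rightarrow>\<^sub>C real)" where
  "T f = ext (K (mom (apply_bcontfun f)))"

lemmas pier_range = pier_bounds[OF a_range]

lemma p_abs: "AE x in beam_measure. \<bar>p x\<bar> \<le> \<beta>"
  using p_bounds by eventually_elim (use \<alpha>_pos in auto)

lemma \<beta>_pos: "0 < \<beta>"
proof (rule ccontr)
  assume "\<not> 0 < \<beta>"
  then have "AE x in beam_measure. False"
    using p_bounds \<alpha>_pos by (auto elim: eventually_mono)
  then have "(LINT x|beam_measure. (1::real)) = (LINT x|beam_measure. 0)"
    by (intro integral_cong_AE) auto
  then show False by simp
qed

lemma p_L2: "p \<in> L2"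
  by (rule L2_bounded[OF p_measurable p_abs])

lemma pf_L2: "f \<in> L2 \<Longrightarrow> (\<lambda>t. p t * f t) \<in> L2"
  by (rule L2_bounded_mult[OF _ p_measurable p_abs])

lemma ip2_weight_swap: "ip2 (\<lambda>t. p t * f t) g = ip2 f (\<lambda>t. p t * g t)"
  unfolding ip2_def by (simp add: mult_ac)

lemma mom_W: "f \<in> L2 \<Longrightarrow> mom f \<in> W a"
  unfolding mom_def by (intro Proj_W K_L2 pf_L2)

lemma mom_L2: "f \<in> L2 \<Longrightarrow> mom f \<in> L2"
  using mom_W by (auto simp: W_def)

text \<open>
  The weak formulation: the left side is the work of the load \<open>p f\<close> on the displacement
  \<open>K g\<close>. Symmetry and positivity of the solution operator follow from it.
\<close>

lemma mom_dual:
  assumes f: "f \<in> L2" and g: "g \<in> W a"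
  shows "ip2 (\<lambda>t. p t * f t) (K g) = ip2 (mom f) g"
  using K_sym[OF pf_L2[OF f], of g] Proj_ip_W[OF K_L2[OF pf_L2[OF f]] g] g
  by (simp add: mom_def W_def)

lemma weighted_le:
  assumes f: "f \<in> L2"
  shows "ip2 (\<lambda>t. p t * f t) (\<lambda>t. p t * f t) \<le> \<beta> * ip2 (\<lambda>t. p t * f t) f"
    and "\<alpha> * ip2 f f \<le> ip2 (\<lambda>t. p t * f t) f"
    and "ip2 (\<lambda>t. p t * f t) f \<le> \<beta> * ip2 f f"
proof -
  note I = L2_mult_integrable[OF pf_L2[OF f] f] L2_mult_integrable[OF pf_L2[OF f] pf_L2[OF f]]
    L2_mult_integrable[OF f f]
  have "ip2 (\<lambda>t. p t * f t) (\<lambda>t. p t * f t) \<le> (LINT t|beam_measure. \<beta> * (p t * f t * f t))"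
    unfolding ip2_def
  proof (rule integral_mono_AE)
    show "AE x in beam_measure. p x * f x * (p x * f x) \<le> \<beta> * (p x * f x * f x)"
      using p_bounds
    proof eventually_elim
      fix x assume "\<alpha> \<le> p x \<and> p x \<le> \<beta>"
      then have "p x * (p x * (f x)\<^sup>2) \<le> \<beta> * (p x * (f x)\<^sup>2)"
        using \<alpha>_pos by (intro mult_right_mono) auto
      then show "p x * f x * (p x * f x) \<le> \<beta> * (p x * f x * f x)"
        by (simp add: power2_eq_square mult_ac)
    qed
  qed (use I in auto)
  then show "ip2 (\<lambda>t. p t * f t) (\<lambda>t. p t * f t) \<le> \<beta> * ip2 (\<lambda>t. p t * f t) f"
    by (simp add: ip2_def)
  have "(LINT t|beam_measure. \<alpha> * (f t * f t)) \<le> ip2 (\<lambda>t. p t * f t) f"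
    unfolding ip2_def
  proof (rule integral_mono_AE)
    show "AE x in beam_measure. \<alpha> * (f x * f x) \<le> p x * f x * f x"
      using p_bounds by eventually_elim (simp add: mult.assoc mult_right_mono)
  qed (use I in auto)
  then show "\<alpha> * ip2 f f \<le> ip2 (\<lambda>t. p t * f t) f" by (simp add: ip2_def)
  have "ip2 (\<lambda>t. p t * f t) f \<le> (LINT t|beam_measure. \<beta> * (f t * f t))"
    unfolding ip2_def
  proof (rule integral_mono_AE)
    show "AE x in beam_measure. p x * f x * f x \<le> \<beta> * (f x * f x)"
      using p_bounds by eventually_elim (simp add: mult.assoc mult_right_mono)
  qed (use I in auto)
  then show "ip2 (\<lambda>t. p t * f t) f \<le> \<beta> * ip2 f f" by (simp add: ip2_def)
qed

lemma weighted_nonneg: "f \<in> L2 \<Longrightarrow> 0 \<le> ip2 (\<lambda>t. p t * f t) f"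
  using weighted_le(2)[of f] ip2_nonneg[of f] \<alpha>_pos by (smt (verit) mult_nonneg_nonneg)

lemma weighted_definite:
  assumes "continuous_on {-pi..pi} f" "ip2 (\<lambda>t. p t * f t) f = 0" "x \<in> {-pi..pi}"
  shows "f x = 0"
proof -
  note L = L2_continuous[OF assms(1)]
  have "\<alpha> * ip2 f f \<le> 0" using weighted_le(2)[OF L] assms(2) by simp
  then have "ip2 f f = 0" using \<alpha>_pos ip2_nonneg[of f] by (simp add: mult_le_0_iff)
  then have "AE x in beam_measure. f x = 0"
    using L2_null[OF L] by (simp add: ip2_self)
  then show ?thesis using continuous_null[OF assms(1) _ assms(3)] by blast
qed

lemma mom_bound: "f \<in> L2 \<Longrightarrow> ip2 (mom f) (mom f) \<le> 16 * pi ^ 4 * \<beta> * ip2 (\<lambda>t. p t * f t) f"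
proof -
  assume f: "f \<in> L2"
  have "ip2 (mom f) (mom f) \<le> ip2 (K (\<lambda>t. p t * f t)) (K (\<lambda>t. p t * f t))"
    unfolding mom_def by (rule Proj_contraction[OF K_L2[OF pf_L2[OF f]]])
  also have "\<dots> \<le> 16 * pi ^ 4 * ip2 (\<lambda>t. p t * f t) (\<lambda>t. p t * f t)"
    by (rule K_norm[OF pf_L2[OF f]])
  also have "\<dots> \<le> 16 * pi ^ 4 * (\<beta> * ip2 (\<lambda>t. p t * f t) f)"
    by (intro mult_left_mono weighted_le f) simp
  finally show ?thesis by (simp add: mult.assoc)
qed

lemma T_apply: "x \<in> {-pi..pi} \<Longrightarrow> apply_bcontfun (T f) x = K (mom (apply_bcontfun f)) x"
  unfolding T_def by (intro ext_apply K_continuous mom_L2 bcontfun_L2)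

lemma ipp_T: "ipp (T f) g = ip2 (mom (apply_bcontfun f)) (mom (apply_bcontfun g))"
proof -
  have "ipp (T f) g = ip2 (K (mom (apply_bcontfun f))) (\<lambda>t. p t * apply_bcontfun g t)"
    unfolding ipp_def ip2_weight_swap by (rule ip2_cong) (auto simp: T_apply)
  also have "\<dots> = ip2 (mom (apply_bcontfun g)) (mom (apply_bcontfun f))"
    using mom_dual[OF bcontfun_L2[of g] mom_W[OF bcontfun_L2[of f]]] by (simp add: ip2_sym)
  finally show ?thesis by (simp add: ip2_sym)
qed

text \<open>
  The Cauchy-Schwarz inequality in the energy \<open>\<integral>(u'')\<^sup>2 = ip2 g g\<close>. With \<open>f = u\<close> it
  turns an upper bound for the quadratic form of \<open>T\<close> into one for the Rayleigh quotient.
\<close>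

lemma energy_bound:
  assumes f: "f \<in> L2" and g: "g \<in> W a" and u: "\<And>x. x \<in> beam \<Longrightarrow> u x = - K g x"
  shows "(ip2 (\<lambda>t. p t * f t) u)\<^sup>2 \<le> ip2 g g * ip2 (mom f) (mom f)"
proof -
  have gL: "g \<in> L2" using g by (simp add: W_def)
  have "ip2 (\<lambda>t. p t * f t) u = ip2 (\<lambda>t. p t * f t) (\<lambda>t. - K g t)"
    by (rule ip2_cong) (use u in auto)
  also have "\<dots> = - ip2 (mom f) g"
    using mom_dual[OF f g] ip2_uminus[of "K g"] ip2_sym by metis
  finally show ?thesis
    using ip2_cauchy_schwarz[OF mom_L2[OF f] gL] by (simp add: mult.commute)
qed

lemma ipp_sup_bound:
  assumes "\<And>x. x \<in> beam \<Longrightarrow> \<bar>apply_bcontfun f x\<bar> \<le> d"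
  shows "ipp f f \<le> \<beta> * (2 * pi * d\<^sup>2)"
proof -
  have "ip2 (apply_bcontfun f) (apply_bcontfun f) \<le> (LINT x|beam_measure. d\<^sup>2)"
    unfolding ip2_self
  proof (rule integral_mono)
    fix x assume "x \<in> space beam_measure"
    then have "\<bar>apply_bcontfun f x\<bar> \<le> \<bar>d\<bar>" using assms[of x] by simp
    then show "(apply_bcontfun f x)\<^sup>2 \<le> d\<^sup>2" by (simp add: abs_le_square_iff)
  qed (use L2D(2)[OF bcontfun_L2] in auto)
  then have "ip2 (apply_bcontfun f) (apply_bcontfun f) \<le> 2 * pi * d\<^sup>2" by simp
  then show ?thesis
    using weighted_le(3)[OF bcontfun_L2, of f] \<beta>_pos unfolding ipp_def
    by (smt (verit) mult_left_mono)
qed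

lemma T_compact_sequence:
  assumes f: "\<And>n. ipp (f n) (f n) \<le> 1"
  shows "\<exists>r w. strict_mono (r :: nat \<Rightarrow> nat) \<and> (\<lambda>n. ipp (T (f (r n)) - w) (T (f (r n)) - w)) \<longlonglongrightarrow> 0"
proof -
  define B where "B = 16 * pi ^ 4 * \<beta>"
  define F where "F n = K (mom (apply_bcontfun (f n)))" for n
  have B0: "B > 0" using \<beta>_pos by (simp add: B_def)
  have mL: "mom (apply_bcontfun (f n)) \<in> L2" for n by (intro mom_L2 bcontfun_L2)
  have mB: "ip2 (mom (apply_bcontfun (f n))) (mom (apply_bcontfun (f n))) \<le> B" for n
    using mom_bound[OF bcontfun_L2, of "f n"] mult_left_mono[OF f[of n], of B] B0
    unfolding ipp_def B_def[symmetric] by linarith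
  have lip: "\<bar>F n y - F n x\<bar> \<le> sqrt (8 * pi * B) * \<bar>y - x\<bar>" if "x \<in> {-pi..pi}" "y \<in> {-pi..pi}" for n x y
  proof -
    have "\<bar>F n y - F n x\<bar> \<le> sqrt (8 * pi * ip2 (mom (apply_bcontfun (f n))) (mom (apply_bcontfun (f n)))) * \<bar>y - x\<bar>"
      unfolding F_def by (rule K_lipschitz[OF mL that])
    also have "\<dots> \<le> sqrt (8 * pi * B) * \<bar>y - x\<bar>"
      by (intro mult_right_mono real_sqrt_le_mono mult_left_mono mB) auto
    finally show ?thesis .
  qed
  obtain g k where g: "continuous_on {-pi..pi} g" and k: "strict_mono (k :: nat \<Rightarrow> nat)"
      and lim: "\<And>e. 0 < e \<Longrightarrow> \<exists>N. \<forall>n\<ge>N. \<forall>x\<in>{-pi..pi}. \<bar>F (k n) x - g x\<bar> < e"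
    by (rule lipschitz_sequence_compact[of F, OF lip]) (simp_all add: F_def K_ends mL)
  define w where "w = ext g"
  have w: "apply_bcontfun w x = g x" if "x \<in> {-pi..pi}" for x
    unfolding w_def by (rule ext_apply[OF g that])
  have "(\<lambda>n. ipp (T (f (k n)) - w) (T (f (k n)) - w)) \<longlonglongrightarrow> 0"
  proof (rule LIMSEQ_I)
    fix e :: real assume e: "0 < e"
    define d where "d = sqrt (e / (4 * pi * \<beta>))"
    have d: "d > 0" "\<beta> * (2 * pi * d\<^sup>2) = e / 2" using e \<beta>_pos by (auto simp: d_def)
    obtain N where N: "\<And>n x. n \<ge> N \<Longrightarrow> x \<in> {-pi..pi} \<Longrightarrow> \<bar>F (k n) x - g x\<bar> < d"
      using lim[OF d(1)] by blast
    have "norm (ipp (T (f (k n)) - w) (T (f (k n)) - w) - 0) < e" if "n \<ge> N" for n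
    proof -
      have "ipp (T (f (k n)) - w) (T (f (k n)) - w) \<le> \<beta> * (2 * pi * d\<^sup>2)"
      proof (rule ipp_sup_bound)
        fix x :: real assume "x \<in> beam"
        then have "x \<in> {-pi..pi}" by auto
        then show "\<bar>apply_bcontfun (T (f (k n)) - w) x\<bar> \<le> d"
          using N[OF that, of x] w[of x] T_apply[of x "f (k n)"]
          by (simp add: F_def minus_bcontfun.rep_eq)
      qed
      moreover have "0 \<le> ipp (T (f (k n)) - w) (T (f (k n)) - w)"
        unfolding ipp_def by (rule weighted_nonneg[OF bcontfun_L2])
      ultimately show ?thesis using d e by simp
    qed
    then show "\<exists>no. \<forall>n\<ge>no. norm (ipp (T (f (k n)) - w) (T (f (k n)) - w) - 0) < e" by blast
  qed
  with k show ?thesis by blast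
qed

text \<open>
  Multiples of the polynomial \<open>(x\<^sup>2 - \<pi>\<^sup>2)(x\<^sup>2 - a\<^sup>2\<pi>\<^sup>2)\<close> vanish at the ends and at the piers.
  Their nonzero combinations are polynomials with finitely many roots, so the weighted norm is
  positive, and by \<open>energy_bound\<close> so is the quadratic form of \<open>T\<close>.
\<close>

lemma T_positive_family:
  "\<exists>v. \<forall>(n::nat) c. (\<exists>i\<le>n. c i \<noteq> 0) \<longrightarrow>
     0 < ipp (T (\<Sum>i\<le>n. c i *\<^sub>R v i)) (\<Sum>i\<le>n. c i *\<^sub>R v i)"
proof (intro exI allI impI)
  define Q :: "real poly" where "Q = [:- pi\<^sup>2, 0, 1:] * [:- (a * pi)\<^sup>2, 0, 1:]"
  have Q0: "Q \<noteq> 0" by (simp add: Q_def)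
  have Qz: "poly Q pi = 0" "poly Q (- pi) = 0" "poly Q (a * pi) = 0" "poly Q (- a * pi) = 0"
    by (auto simp: Q_def power2_eq_square)
  define v where "v i = ext (poly (Q * monom 1 i))" for i :: nat
  fix n :: nat and c :: "nat \<Rightarrow> real" assume "\<exists>i\<le>n. c i \<noteq> 0"
  then obtain k where k: "k \<le> n" "c k \<noteq> 0" by blast
  define R where "R = (\<Sum>i\<le>n. monom (c i) i)"
  define P where "P = Q * R"
  have "coeff R k = c k" using k by (simp add: R_def coeff_sum)
  then have "R \<noteq> 0" using k by auto
  then have P0: "P \<noteq> 0" using Q0 by (simp add: P_def)
  have Pz: "poly P pi = 0" "poly P (- pi) = 0" "poly P (a * pi) = 0" "poly P (- a * pi) = 0"
    using Qz by (auto simp: P_def)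
  define u where "u = (\<Sum>i\<le>n. c i *\<^sub>R v i)"
  have cp: "continuous_on A (poly q)" for A and q :: "real poly"
    by (intro continuous_intros)
  have u: "apply_bcontfun u x = poly P x" if "x \<in> {-pi..pi}" for x
  proof -
    have "apply_bcontfun u x = (\<Sum>i\<le>n. c i * poly (Q * monom 1 i) x)"
      unfolding u_def v_def apply_bcontfun_sum
      using that by (simp add: scaleR_bcontfun.rep_eq ext_apply[OF cp])
    also have "\<dots> = poly P x"
      by (simp add: P_def R_def poly_sum poly_monom sum_distrib_left mult_ac)
    finally show ?thesis .
  qed
  define g where "g = poly (pderiv (pderiv P))"
  have Kg: "K g x = - poly P x" if "x \<in> {-pi..pi}" for x
    unfolding g_def
    by (rule K_second_derivative[OF poly_DERIV poly_DERIV]) (use that Pz cp in auto)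
  show "0 < ipp (T u) u"
  proof -
    have gL: "g \<in> L2" unfolding g_def by (rule L2_continuous[OF cp])
    have api: "a * pi \<in> {-pi..pi}" "- a * pi \<in> {-pi..pi}"
      using less_imp_le[OF pier_range(2)] less_imp_le[OF pier_range(3)]
        less_imp_le[OF pier_range(4)] less_imp_le[OF pier_range(5)] unfolding atLeastAtMost_iff by blast+
    have gW: "g \<in> W a"
      using gL Kg[OF api(1)] Kg[OF api(2)] Pz(3,4) by (simp add: W_def ip2_sym[of g] K_def)
    have uL: "apply_bcontfun u \<in> L2" by (rule bcontfun_L2)
    have "finite {x. poly P x = 0}" by (rule poly_roots_finite[OF P0])
    moreover have "infinite {-pi..pi}" by simp
    ultimately obtain x where x: "x \<in> {-pi..pi}" "poly P x \<noteq> 0"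
      using finite_subset[of "{-pi..pi}" "{x. poly P x = 0}"] by blast
    have "ipp u u \<noteq> 0"
      using weighted_definite[of "apply_bcontfun u" x] x u by (auto simp: ipp_def)
    moreover have "(ipp u u)\<^sup>2 \<le> ip2 g g * ipp (T u) u"
      using energy_bound[OF uL gW, of "apply_bcontfun u"] u Kg unfolding ipp_T by (simp add: ipp_def)
    moreover have "0 \<le> ipp (T u) u" by (simp add: ipp_T ip2_nonneg)
    ultimately show ?thesis
      by (cases "ipp (T u) u = 0") auto
  qed
qed

sublocale compact_positive ipp T
proof
  fix x y z :: "real \<Rightarrow>\<^sub>C real" and c :: real
  show "ipp x y = ipp y x"
    unfolding ipp_def using ip2_weight_swap[of "apply_bcontfun x" "apply_bcontfun y"] ip2_sym by metis
  show "ipp (x + y) z = ipp x z + ipp y z"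
    unfolding ipp_def plus_bcontfun.rep_eq distrib_left
    by (intro ip2_add pf_L2 bcontfun_L2)
  show "ipp (c *\<^sub>R x) y = c * ipp x y"
    unfolding ipp_def scaleR_bcontfun.rep_eq
    by (simp add: mult.left_commute[of _ c] ip2_cmult)
  show "0 \<le> ipp x x"
    unfolding ipp_def by (rule weighted_nonneg[OF bcontfun_L2])
  show "ipp (T x) y = ipp x (T y)"
  proof -
    have "ipp x (T y) = ipp (T y) x"
      unfolding ipp_def using ip2_weight_swap ip2_sym by metis
    then show ?thesis
      using ipp_T[of x y] ipp_T[of y x] ip2_sym by metis
  qed
  show "0 \<le> ipp (T x) x" by (simp add: ipp_T ip2_nonneg)
  show "\<exists>C. \<forall>x. ipp (T x) x \<le> C * ipp x x"
    using mom_bound[OF bcontfun_L2] unfolding ipp_T unfolding ipp_def by blast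
qed (use T_compact_sequence T_positive_family in auto)

end

section \<open>Simplicity of the spectrum\<close>

lemma primitive_mono:
  assumes "f \<in> L2" "g \<in> L2" "AE t in beam_measure. t < x \<longrightarrow> f t \<le> g t"
  shows "primitive f x \<le> primitive g x"
  unfolding primitive_def
  by (rule integral_mono_AE) (use assms in \<open>auto intro!: L2_integrable L2_cut\<close>)

lemma primitive_nonneg:
  assumes "f \<in> L2" "AE t in beam_measure. t < x \<longrightarrow> 0 \<le> f t"
  shows "0 \<le> primitive f x"
  using primitive_mono[OF L2_const[of 0] assms(1), of x] assms(2) by (simp add: primitive_def)

lemma primitive_const: "x \<in> {-pi..pi} \<Longrightarrow> primitive (\<lambda>_. c) x = c * (x + pi)"
  using primitive_cmult[of c "\<lambda>_. 1" x] by (simp add: primitive_one)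

lemma primitive_twice_le:
  assumes h: "h \<in> L2" "\<And>t. 0 \<le> h t" and x: "x \<in> {-pi..pi}"
  shows "primitive (primitive h) x \<le> 2 * pi * primitive h x"
proof -
  have nn: "0 \<le> primitive h x" by (rule primitive_nonneg) (use h in auto)
  have "primitive (primitive h) x \<le> primitive (\<lambda>_. primitive h x) x"
  proof (rule primitive_mono[OF primitive_L2[OF h(1)] L2_const], rule AE_I2, rule impI)
    fix t assume "t < x"
    have "0 \<le> (LINT s|beam_measure. (if t \<le> s \<and> s < x then h s else 0))"
      by (rule integral_nonneg_AE) (use h in auto)
    then show "primitive h t \<le> primitive h x"
      using primitive_increment[OF h(1), of t x] \<open>t < x\<close> by simp
  qed
  also have "\<dots> = primitive h x * (x + pi)" by (rule primitive_const[OF x])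
  also have "\<dots> \<le> primitive h x * (2 * pi)" using nn x by (intro mult_left_mono) auto
  finally show ?thesis by (simp add: mult.commute)
qed

text \<open>
  At a maximum point \<open>z\<close> of \<open>h(x) exp(-2Cx)\<close>, with value \<open>M\<close>, the hypothesis gives
  \<open>M \<le> M/2\<close>.
\<close>

lemma gronwall:
  assumes h: "continuous_on {-pi..pi} h" and nn: "\<And>x. 0 \<le> h x" and C: "0 < C" and t: "t \<in> {-pi..pi}"
    and le: "\<And>x. x \<in> {-pi..t} \<Longrightarrow> h x \<le> C * primitive h x" and x: "x \<in> {-pi..t}"
  shows "h x = 0"
proof -
  have "continuous_on {-pi..t} (\<lambda>x. h x * exp (- 2 * C * x))"
    by (intro continuous_intros continuous_on_subset[OF h]) (use t in auto)
  then obtain z where z: "z \<in> {-pi..t}"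
      and max: "\<And>y. y \<in> {-pi..t} \<Longrightarrow> h y * exp (- 2 * C * y) \<le> h z * exp (- 2 * C * z)"
    using continuous_attains_sup[of "{-pi..t}" "\<lambda>x. h x * exp (- 2 * C * x)"] t by auto
  define M where "M = h z * exp (- 2 * C * z)"
  have M0: "0 \<le> M" using nn by (simp add: M_def)
  have hM: "h y \<le> M * exp (2 * C * y)" if "y \<in> {-pi..t}" for y
    using max[OF that] by (simp add: M_def exp_minus field_simps)
  have eL: "(\<lambda>y. M * exp (2 * C * y)) \<in> L2"
    by (rule L2_continuous) (intro continuous_intros)
  have "primitive h z \<le> primitive (\<lambda>y. M * exp (2 * C * y)) z"
    by (rule primitive_mono[OF L2_continuous[OF h] eL]) (use hM z in auto)
  also have "\<dots> = M * exp (2 * C * z) / (2 * C) - M * exp (2 * C * (-pi)) / (2 * C)"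
  proof (rule primitive_FTC[of "\<lambda>y. M * exp (2 * C * y) / (2 * C)"])
    show "((\<lambda>y. M * exp (2 * C * y) / (2 * C)) has_real_derivative M * exp (2 * C * x)) (at x within {-pi..pi})" for x
      using C by (auto intro!: derivative_eq_intros)
    show "continuous_on {-pi..pi} (\<lambda>y. M * exp (2 * C * y))" by (intro continuous_intros)
  qed (use z t in auto)
  also have "\<dots> \<le> M * exp (2 * C * z) / (2 * C)" using M0 C by simp
  finally have "C * primitive h z \<le> M * exp (2 * C * z) / 2"
    using C by (simp add: field_simps)
  then have "h z \<le> M * exp (2 * C * z) / 2" using le[OF z] by linarith
  then have "M * exp (2 * C * z) \<le> M * exp (2 * C * z) / 2"
    by (simp add: M_def mult.assoc flip: exp_add)
  then have "M * exp (2 * C * z) \<le> 0" by simp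
  then have "M \<le> 0" by (simp add: mult_le_0_iff)
  then have "h x \<le> 0" using hM[OF x] M0 by simp
  then show ?thesis using nn[of x] by simp
qed

text \<open>
  The chain rule for \<open>F\<^sup>2/2\<close> when \<open>F\<close> is a primitive of a square-integrable function, by
  integration by parts with \<open>f\<close> cut off at \<open>x\<close>.
\<close>

lemma primitive_square:
  assumes f: "f \<in> L2" and x: "x \<in> {-pi..pi}"
  shows "primitive (\<lambda>t. f t * primitive f t) x = (primitive f x)\<^sup>2 / 2"
proof -
  define g where "g t = (if t < x then f t else 0)" for t
  have gL: "g \<in> L2" unfolding g_def by (rule L2_cut[OF f])
  have pg: "primitive g t = primitive f t" if "t < x" for t
    unfolding primitive_def g_def using that by (intro Bochner_Integration.integral_cong) auto
  have "primitive (\<lambda>t. f t * primitive f t) x = (LINT t|beam_measure. g t * primitive g t)"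
    unfolding primitive_def[of "\<lambda>t. f t * primitive f t"]
  proof (rule Bochner_Integration.integral_cong)
    fix t
    show "(if t < x then f t * primitive f t else 0) = g t * primitive g t"
    proof (cases "t < x")
      case True
      then have "g t = f t" by (simp add: g_def)
      then show ?thesis using True pg by simp
    next
      case False
      then have "g t = 0" by (simp add: g_def)
      then show ?thesis using False by simp
    qed
  qed simp
  moreover have "(LINT t|beam_measure. primitive g t * g t) = (LINT t|beam_measure. g t * primitive g t)"
    by (simp add: mult.commute)
  moreover have "(LINT t|beam_measure. g t) = primitive f x"
    by (simp add: g_def primitive_def)
  ultimately show ?thesis
    using primitive_by_parts[OF gL gL] by (simp add: power2_eq_square)
qed

definition ramp :: "real \<Rightarrow> real \<Rightarrow> real" where
  "ramp s x = max 0 (x - s)"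

lemma ramp_L2: "ramp s \<in> L2"
  unfolding ramp_def[abs_def] by (rule L2_continuous) (intro continuous_intros)

lemma ramp_primitive:
  assumes "s \<in> {-pi..pi}" "x \<in> {-pi..pi}"
  shows "primitive (\<lambda>t. if t < s then 0 else 1) x = ramp s x"
proof -
  have L: "(\<lambda>t. if t < s then 1 else (0::real)) \<in> L2" by (rule L2_cut) simp
  have "primitive (\<lambda>t. if t < s then 1 else 0) x = primitive (\<lambda>_. 1) (min x s)"
    unfolding primitive_def by (rule Bochner_Integration.integral_cong) auto
  also have "\<dots> = min x s + pi" using assms by (intro primitive_one) (auto simp: min_def)
  finally have 1: "primitive (\<lambda>t. if t < s then 1 else 0) x = min x s + pi" .
  have "primitive (\<lambda>t. if t < s then 0 else 1) x = primitive (\<lambda>t. 1 - (if t < s then 1 else 0)) x"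
    by (rule primitive_cong) auto
  also have "\<dots> = ramp s x"
    using primitive_diff[OF L2_const L, of 1 x] 1 primitive_one[OF assms(2)] by (simp add: ramp_def)
  finally show ?thesis .
qed

text \<open>
  The value is \<open>(t - s)\<^sup>3/6\<close>; a lower bound by Cauchy-Schwarz is enough.
\<close>

lemma ramp_twice_pos:
  assumes s: "s \<in> {-pi..pi}" and t: "t \<in> {-pi..pi}" and "s < t"
  shows "0 < primitive (primitive (ramp s)) t"
proof -
  define c where "c = (\<lambda>t. if t < s then 0 else (1::real))"
  have cL: "c \<in> L2"
    unfolding c_def using L2_diff[OF L2_const[of 1] L2_cut[OF L2_const[of 1], of s]]
    by (simp add: if_distrib cong: if_cong)
  have pc: "primitive c x = ramp s x" if "x \<in> {-pi..pi}" for x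
    unfolding c_def by (rule ramp_primitive[OF s that])
  have one: "primitive (ramp s) x = (ramp s x)\<^sup>2 / 2" if "x \<in> {-pi..pi}" for x
  proof -
    have "primitive (ramp s) x = primitive (\<lambda>t. c t * primitive c t) x"
    proof (rule primitive_cong)
      fix u assume "u \<in> beam"
      then show "ramp s u = c u * primitive c u"
        using pc[of u] by (cases "u < s") (simp_all add: ramp_def, simp_all add: c_def)
    qed
    then show ?thesis using primitive_square[OF cL that] pc[OF that] by simp
  qed
  define r where "r u = (if u < t then ramp s u else 0)" for u
  have rL: "r \<in> L2" unfolding r_def by (rule L2_cut[OF ramp_L2])
  have "primitive (primitive (ramp s)) t = primitive (\<lambda>u. (1/2) * (ramp s u)\<^sup>2) t"
    by (rule primitive_cong) (auto simp: one)
  also have "\<dots> = (1/2) * primitive (\<lambda>u. (ramp s u)\<^sup>2) t" by (rule primitive_cmult)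
  also have "primitive (\<lambda>u. (ramp s u)\<^sup>2) t = (LINT u|beam_measure. (r u)\<^sup>2)"
    unfolding primitive_def by (rule Bochner_Integration.integral_cong) (auto simp: r_def)
  finally have eq: "primitive (primitive (ramp s)) t = (1/2) * (LINT u|beam_measure. (r u)\<^sup>2)" .
  have "(LINT u|beam_measure. r u) = (ramp s t)\<^sup>2 / 2"
    using one[OF t] by (simp add: r_def primitive_def)
  moreover have "0 < (ramp s t)\<^sup>2 / 2" using \<open>s < t\<close> by (simp add: ramp_def)
  ultimately have "0 < (LINT u|beam_measure. r u)" by linarith
  then have "0 < (LINT u|beam_measure. r u)\<^sup>2" by simp
  also have "\<dots> \<le> 2 * pi * (LINT u|beam_measure. (r u)\<^sup>2)" by (rule integral_bound_L2[OF rL])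
  finally show ?thesis unfolding eq by (simp add: zero_less_mult_iff)
qed

text \<open>
  The weight function is the derivative of \<open>hat x t\<close> with respect to \<open>x\<close> at \<open>x = -\<pi>\<close>.
\<close>

lemma slope_ip2:
  assumes h: "h \<in> L2"
  shows "slope h = ip2 h (\<lambda>t. (pi - t) / (2 * pi))"
proof -
  have x: "(\<lambda>t. t + pi) \<in> L2" by (rule L2_continuous) (intro continuous_intros)
  have "(LINT t|beam_measure. primitive h t * 1) + (LINT t|beam_measure. h t * primitive (\<lambda>_. 1) t)
      = (LINT t|beam_measure. h t) * (LINT t|beam_measure. 1)"
    by (rule primitive_by_parts[OF h L2_const])
  moreover have "(LINT t|beam_measure. h t * primitive (\<lambda>_. 1) t) = (LINT t|beam_measure. h t * (t + pi))"
    by (rule Bochner_Integration.integral_cong) (auto simp: primitive_one)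
  ultimately have "2 * pi * slope h = (LINT t|beam_measure. h t) * (2 * pi) - (LINT t|beam_measure. h t * (t + pi))"
    by (simp add: slope_def)
  also have "\<dots> = (LINT t|beam_measure. h t * (2 * pi) - h t * (t + pi))"
    using L2_integrable[OF h] L2_mult_integrable[OF h x] by simp
  also have "\<dots> = (LINT t|beam_measure. (2 * pi) * (h t * ((pi - t) / (2 * pi))))"
    by (rule Bochner_Integration.integral_cong) (auto simp: field_simps)
  also have "\<dots> = 2 * pi * ip2 h (\<lambda>t. (pi - t) / (2 * pi))"
    unfolding ip2_def by (rule integral_mult_right_zero)
  finally show ?thesis by simp
qed

context weighted_beam
begin

text \<open>
  Here \<open>n\<close> is a multiple of \<open>f''\<close>, and \<open>f\<close> vanishes with its first derivative at
  \<open>-\<pi>\<close>. The negative part \<open>h\<close> of \<open>f\<close> is bounded by a multiple of its fourfold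
  primitive, hence of its primitive, and vanishes by \<open>gronwall\<close>.
\<close>

lemma clamped_nonneg:
  assumes f: "continuous_on {-pi..pi} f" and n: "n \<in> L2" and m: "0 < m" and t: "t \<in> {-pi..pi}"
    and mf: "\<And>x. x \<in> {-pi..t} \<Longrightarrow> m * f x = primitive (primitive n) x"
    and ge: "\<And>x. x \<in> {-pi..t} \<Longrightarrow> primitive (primitive (\<lambda>y. p y * f y)) x \<le> n x"
    and x: "x \<in> {-pi..t}"
  shows "0 \<le> f x"
proof -
  define h where "h y = max 0 (- f y)" for y
  have h: "continuous_on {-pi..pi} h" unfolding h_def by (intro continuous_intros f)
  have hnn: "0 \<le> h y" for y by (simp add: h_def)
  note hL = L2_continuous[OF h] and pL = pf_L2[OF L2_continuous[OF f]]
  note P1 = primitive_L2[OF hL] and Q1 = primitive_L2[OF pL]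
  define c where "c = \<beta> * (2 * pi) ^ 3"
  have c0: "c > 0" using \<beta>_pos by (simp add: c_def)
  have A1: "primitive (\<lambda>y. (-\<beta>) * h y) y \<le> primitive (\<lambda>y. p y * f y) y" for y
  proof (rule primitive_mono[OF L2_cmult[OF hL] pL])
    show "AE s in beam_measure. s < y \<longrightarrow> - \<beta> * h s \<le> p s * f s"
      using p_bounds
    proof eventually_elim
      fix s assume ps: "\<alpha> \<le> p s \<and> p s \<le> \<beta>"
      have "p s * (- f s) \<le> p s * h s" using ps \<alpha>_pos by (intro mult_left_mono) (auto simp: h_def)
      also have "\<dots> \<le> \<beta> * h s" using ps hnn by (intro mult_right_mono) auto
      finally show "s < y \<longrightarrow> - \<beta> * h s \<le> p s * f s" by simp
    qed
  qed
  have B1: "- \<beta> * primitive h y \<le> primitive (\<lambda>y. p y * f y) y" for y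
    using A1[of y] unfolding primitive_cmult .
  have B2: "- \<beta> * primitive (primitive h) y \<le> primitive (primitive (\<lambda>y. p y * f y)) y" for y
    using primitive_mono[OF L2_cmult[OF P1, of "-\<beta>"] Q1, of y] B1 primitive_cmult[of "-\<beta>" "primitive h" y]
    by simp
  have B3: "- \<beta> * primitive (primitive (primitive h)) y \<le> primitive n y" if "y \<in> {-pi..t}" for y
  proof -
    have "primitive (\<lambda>s. - \<beta> * primitive (primitive h) s) y \<le> primitive n y"
    proof (rule primitive_mono[OF L2_cmult[OF primitive_L2[OF P1]] n], rule AE_I2, rule impI)
      fix s assume "s \<in> space beam_measure" "s < y"
      then show "- \<beta> * primitive (primitive h) s \<le> n s"
        using B2[of s] ge[of s] that by simp
    qed
    then show ?thesis using primitive_cmult[of "-\<beta>" "primitive (primitive h)" y] by simp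
  qed
  have B4: "- \<beta> * primitive (primitive (primitive (primitive h))) y \<le> m * f y" if y: "y \<in> {-pi..t}" for y
  proof -
    have "primitive (\<lambda>s. - \<beta> * primitive (primitive (primitive h)) s) y \<le> primitive (primitive n) y"
    proof (rule primitive_mono[OF L2_cmult[OF primitive_L2[OF primitive_L2[OF P1]]] primitive_L2[OF n]],
        rule AE_I2, rule impI)
      fix s assume "s \<in> space beam_measure" "s < y"
      then show "- \<beta> * primitive (primitive (primitive h)) s \<le> primitive n s"
        using B3[of s] that by simp
    qed
    then show ?thesis
      using primitive_cmult[of "-\<beta>" "primitive (primitive (primitive h))" y] mf[OF y] by simp
  qed
  have nnP: "0 \<le> primitive g y" if "g \<in> L2" "\<And>s. 0 \<le> g s" for g y
    by (rule primitive_nonneg) (use that in auto)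
  have P4: "primitive (primitive (primitive (primitive h))) y \<le> (2 * pi) ^ 3 * primitive h y"
    if "y \<in> {-pi..pi}" for y
  proof -
    have n1: "0 \<le> primitive h s" for s by (rule nnP[OF hL hnn])
    have n2: "0 \<le> primitive (primitive h) s" for s by (rule nnP[OF P1 n1])
    have "primitive (primitive (primitive (primitive h))) y \<le> 2 * pi * primitive (primitive (primitive h)) y"
      by (rule primitive_twice_le[OF primitive_L2[OF P1] n2 that])
    also have "\<dots> \<le> 2 * pi * (2 * pi * primitive (primitive h) y)"
      by (intro mult_left_mono primitive_twice_le[OF P1 n1 that]) auto
    also have "\<dots> \<le> 2 * pi * (2 * pi * (2 * pi * primitive h y))"
      by (intro mult_left_mono primitive_twice_le[OF hL hnn that]) auto
    finally show ?thesis by (simp add: power3_eq_cube)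
  qed
  have "h x = 0"
  proof (rule gronwall[OF h hnn _ t _ x])
    show "0 < c / m" using c0 m by simp
    fix y assume y: "y \<in> {-pi..t}"
    have "- (m * f y) \<le> \<beta> * ((2 * pi) ^ 3 * primitive h y)"
    proof -
      have "\<beta> * primitive (primitive (primitive (primitive h))) y \<le> \<beta> * ((2 * pi) ^ 3 * primitive h y)"
        by (intro mult_left_mono P4) (use y t \<beta>_pos in auto)
      then show ?thesis using B4[OF y] by linarith
    qed
    then have "- (m * f y) \<le> c * primitive h y" by (simp add: c_def mult.assoc)
    moreover have "0 \<le> c * primitive h y" using c0 nnP[OF hL hnn] by simp
    ultimately have "m * h y \<le> c * primitive h y" using m by (simp add: h_def max_def)
    then show "h y \<le> c / m * primitive h y" using m by (simp add: field_simps)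
  qed
  then show ?thesis by (simp add: h_def max_def split: if_splits)
qed

text \<open>
  Up to the factor \<open>m\<close> the number \<open>b\<close> is the jump of the third derivative of \<open>f\<close> at
  \<open>s\<close>. If it were positive, it would force \<open>f\<close> to be positive at \<open>t\<close>.
\<close>

lemma clamped_span_le:
  assumes f: "continuous_on {-pi..pi} f" and n: "n \<in> L2" and m: "0 < m"
    and s: "s \<in> {-pi..pi}" and t: "t \<in> {-pi..pi}" and "s < t"
    and mf: "\<And>x. x \<in> {-pi..t} \<Longrightarrow> m * f x = primitive (primitive n) x"
    and nx: "\<And>x. x \<in> {-pi..t} \<Longrightarrow> n x = b * ramp s x + primitive (primitive (\<lambda>y. p y * f y)) x"
    and ft: "f t = 0" and b: "0 \<le> b"
  shows "b = 0" "x \<in> {-pi..t} \<Longrightarrow> 0 \<le> f x"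
proof -
  have r0: "0 \<le> ramp s y" for y by (simp add: ramp_def)
  have fnn: "0 \<le> f x" if "x \<in> {-pi..t}" for x
    by (rule clamped_nonneg[OF f n m t mf _ that]) (use nx b r0 in auto)
  then show "x \<in> {-pi..t} \<Longrightarrow> 0 \<le> f x" .
  note pL = pf_L2[OF L2_continuous[OF f]]
  have p1: "0 \<le> primitive (\<lambda>y. p y * f y) y" if "y \<in> {-pi..t}" for y
  proof (rule primitive_nonneg[OF pL])
    show "AE s in beam_measure. s < y \<longrightarrow> 0 \<le> p s * f s"
      using p_bounds AE_space
      by eventually_elim (use fnn that \<alpha>_pos in \<open>auto intro!: mult_nonneg_nonneg\<close>)
  qed
  have p2: "0 \<le> primitive (primitive (\<lambda>y. p y * f y)) y" if "y \<in> {-pi..t}" for y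
    by (rule primitive_nonneg[OF primitive_L2[OF pL]], rule AE_I2) (use p1 that in auto)
  have n1: "b * primitive (ramp s) y \<le> primitive n y" if y: "y \<in> {-pi..t}" for y
  proof -
    have "primitive (\<lambda>u. b * ramp s u) y \<le> primitive n y"
      by (rule primitive_mono[OF L2_cmult[OF ramp_L2] n], rule AE_I2) (use nx p2 y in auto)
    then show ?thesis using primitive_cmult[of b "ramp s" y] by simp
  qed
  have "primitive (\<lambda>u. b * primitive (ramp s) u) t \<le> primitive (primitive n) t"
    by (rule primitive_mono[OF L2_cmult[OF primitive_L2[OF ramp_L2]] primitive_L2[OF n]], rule AE_I2)
       (use n1 in auto)
  then have "b * primitive (primitive (ramp s)) t \<le> 0"
    using primitive_cmult[of b "primitive (ramp s)" t] mf[of t] ft t by simp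
  then show "b = 0"
    using ramp_twice_pos[OF s t \<open>s < t\<close>] b by (simp add: mult_le_0_iff)
qed

lemma clamped_span:
  assumes f: "continuous_on {-pi..pi} f" and n: "n \<in> L2" and m: "0 < m"
    and s: "s \<in> {-pi..pi}" and t: "t \<in> {-pi..pi}" and "s < t"
    and mf: "\<And>x. x \<in> {-pi..t} \<Longrightarrow> m * f x = primitive (primitive n) x"
    and nx: "\<And>x. x \<in> {-pi..t} \<Longrightarrow> n x = b * ramp s x + primitive (primitive (\<lambda>y. p y * f y)) x"
    and ft: "f t = 0"
  shows "b = 0" "x \<in> {-pi..t} \<Longrightarrow> f x = 0"
proof -
  have neg: "primitive (\<lambda>y. - g y) y = - primitive g y" for g y
    using primitive_cmult[of "-1" g y] by simp
  have f': "continuous_on {-pi..pi} (\<lambda>x. - f x)" by (intro continuous_intros f)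
  have n': "(\<lambda>x. - n x) \<in> L2" by (rule L2_uminus[OF n])
  have mf': "m * (- f x) = primitive (primitive (\<lambda>x. - n x)) x" if "x \<in> {-pi..t}" for x
    using mf[OF that] by (simp add: neg[abs_def] neg)
  have nx': "- n x = (- b) * ramp s x + primitive (primitive (\<lambda>y. p y * (- f y))) x" if "x \<in> {-pi..t}" for x
    using nx[OF that] by (simp add: neg[abs_def] neg)
  have pos: "0 \<le> b \<Longrightarrow> b = 0"
    by (rule clamped_span_le(1)[OF f n m s t \<open>s < t\<close> mf nx ft])
  have pos': "0 \<le> b \<Longrightarrow> x \<in> {-pi..t} \<Longrightarrow> 0 \<le> f x" for x
    by (rule clamped_span_le(2)[OF f n m s t \<open>s < t\<close> mf nx ft])
  have ft': "- f t = 0" using ft by simp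
  have neg: "0 \<le> - b \<Longrightarrow> - b = 0"
    by (rule clamped_span_le(1)[OF f' n' m s t \<open>s < t\<close> mf' nx' ft'])
  have neg': "0 \<le> - b \<Longrightarrow> x \<in> {-pi..t} \<Longrightarrow> 0 \<le> - f x" for x
    by (rule clamped_span_le(2)[OF f' n' m s t \<open>s < t\<close> mf' nx' ft'])
  show b0: "b = 0"
    using pos neg by linarith
  show "x \<in> {-pi..t} \<Longrightarrow> f x = 0"
    using pos'[of x] neg'[of x] b0 by force
qed

lemma hat_ramp: "hat y x = (1 - (y + pi) / (2 * pi)) * (x + pi) - ramp y x"
  by (simp add: hat_def ramp_def min_def max_def field_simps)

text \<open>
  Integrating the equation twice, the moment \<open>mom f\<close> consists, up to signs, of a linear
  function, one ramp for the reaction of each pier, and the double primitive of the load. The lemma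
  \<open>clamped_span\<close> removes the linear function on the first span, and the ramps on the second
  and third.
\<close>

lemma clamped_eigenfunction_zero:
  assumes f: "continuous_on {-pi..pi} f" and m: "0 < m"
    and eq: "\<And>x. x \<in> {-pi..pi} \<Longrightarrow> m * f x = K (mom f) x" and sl: "slope (mom f) = 0"
    and x: "x \<in> {-pi..pi}"
  shows "f x = 0"
proof -
  note fL = L2_continuous[OF f]
  note pL = pf_L2[OF fL]
  note mL = mom_L2[OF fL]
  define n where "n x = - mom f x" for x
  have nL: "n \<in> L2" unfolding n_def by (rule L2_uminus[OF mL])
  have neg: "primitive (\<lambda>y. - g y) = (\<lambda>y. - primitive g y)" for g
    using primitive_cmult[of "-1" g] by auto
  have mf: "m * f x = primitive (primitive n) x" if "x \<in> {-pi..pi}" for x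
  proof -
    have "K' (mom f) = primitive n"
      unfolding K'_def[abs_def] n_def[abs_def] neg using sl by simp
    then show ?thesis using eq[OF that] K_primitive[OF mL that] by simp
  qed
  obtain b c where bc: "\<And>x. mom f x = K (\<lambda>t. p t * f t) x + b * hat (a * pi) x + c * hat (- a * pi) x"
    unfolding mom_def using Proj_expansion[of a "K (\<lambda>t. p t * f t)"] by blast
  have Kp: "K (\<lambda>t. p t * f t) x = slope (\<lambda>t. p t * f t) * (x + pi) - primitive (primitive (\<lambda>t. p t * f t)) x"
    if "x \<in> {-pi..pi}" for x
    unfolding K_primitive[OF pL that] K'_def[abs_def]
    using primitive_diff[OF L2_const primitive_L2[OF pL]] primitive_const[OF that] by simp
  define B where "B = - slope (\<lambda>t. p t * f t) - b * (1 - (a * pi + pi) / (2 * pi)) - c * (1 - (- a * pi + pi) / (2 * pi))"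
  have nx: "n x = B * (x + pi) + b * ramp (a * pi) x + c * ramp (- a * pi) x
      + primitive (primitive (\<lambda>t. p t * f t)) x" if "x \<in> {-pi..pi}" for x
    unfolding n_def bc Kp[OF that] hat_ramp B_def by (simp add: algebra_simps)
  have mW: "ip2 (hat (a * pi)) (mom f) = 0" "ip2 (hat (- a * pi)) (mom f) = 0"
    using mom_W[OF fL] by (auto simp: W_def ip2_sym)
  have pier: "f (a * pi) = 0" "f (- a * pi) = 0"
    using eq[of "a * pi"] eq[of "- a * pi"] mW m pier_range by (auto simp: K_def)
  have fpi: "f pi = 0" using eq[of pi] K_ends[OF mL] m by simp
  note R = pier_range
  have I: "-pi \<in> {-pi..pi}" "- a * pi \<in> {-pi..pi}" "a * pi \<in> {-pi..pi}" "pi \<in> {-pi..pi}"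
    using R by (auto simp: less_imp_le)
  have order: "- a * pi < a * pi" using R(1) by simp
  have B0: "B = 0"
  proof (rule clamped_span(1)[OF f nL m I(1,2) R(4)])
    fix x assume x: "x \<in> {-pi..- a * pi}"
    then have "x \<in> {-pi..pi}" using R by auto
    then show "m * f x = primitive (primitive n) x" by (rule mf)
    show "n x = B * ramp (-pi) x + primitive (primitive (\<lambda>t. p t * f t)) x"
      using nx[OF \<open>x \<in> {-pi..pi}\<close>] x R order by (simp add: ramp_def max_def)
  qed (rule pier)
  have c0: "c = 0"
  proof (rule clamped_span(1)[OF f nL m I(2,3) order])
    fix x assume x: "x \<in> {-pi..a * pi}"
    then have "-pi \<le> x" "x \<le> a * pi" by auto
    then have "x \<in> {-pi..pi}" using R(2) unfolding atLeastAtMost_iff by linarith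
    then show "m * f x = primitive (primitive n) x" by (rule mf)
    show "n x = c * ramp (- a * pi) x + primitive (primitive (\<lambda>t. p t * f t)) x"
      using nx[OF \<open>x \<in> {-pi..pi}\<close>] x B0 by (simp add: ramp_def[of "a * pi"] max_def)
  qed (rule pier)
  show ?thesis
  proof (rule clamped_span(2)[OF f nL m I(3,4) R(2)])
    fix x :: real assume x: "x \<in> {-pi..pi}"
    then show "m * f x = primitive (primitive n) x" by (rule mf)
    show "n x = b * ramp (a * pi) x + primitive (primitive (\<lambda>t. p t * f t)) x"
      using nx[OF x] B0 c0 by simp
  qed (use fpi x in auto)
qed

lemma eigenpair_pointwise:
  assumes "eigenpair e m" "x \<in> {-pi..pi}"
  shows "m * apply_bcontfun e x = K (mom (apply_bcontfun e)) x"
proof -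
  define d where "d = T e - m *\<^sub>R e"
  have "ipp d y = 0" for y
    using assms(1) by (simp add: d_def ip_diff ip_scale eigenpair_def)
  then have "apply_bcontfun d x = 0"
    using weighted_definite[of "apply_bcontfun d" x] assms(2) by (simp add: ipp_def)
  then show ?thesis
    by (simp add: d_def minus_bcontfun.rep_eq scaleR_bcontfun.rep_eq T_apply[OF assms(2)])
qed

text \<open>
  The slope of the deflection at the left end is a linear functional of the load, represented by a
  square-integrable influence function. Linearity is what the proof of simplicity needs.
\<close>

lemma slope_mom:
  "\<exists>\<kappa>\<in>L2. \<forall>f\<in>L2. slope (mom f) = ip2 (\<lambda>t. p t * f t) \<kappa>"
proof -
  define z where "z t = (pi - t) / (2 * pi)" for t
  have z: "z \<in> L2" unfolding z_def by (rule L2_continuous) (intro continuous_intros, simp)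
  have "slope (mom f) = ip2 (\<lambda>t. p t * f t) (K (Proj a z))" if f: "f \<in> L2" for f
  proof -
    have "slope (mom f) = ip2 z (mom f)"
      using slope_ip2[OF mom_L2[OF f]] by (simp add: z_def[abs_def] ip2_sym)
    also have "\<dots> = ip2 (mom f) (Proj a z)"
      using Proj_ip_W[OF z mom_W[OF f]] by (simp add: ip2_sym)
    also have "\<dots> = ip2 (\<lambda>t. p t * f t) (K (Proj a z))"
      using mom_dual[OF f Proj_W[OF z]] by simp
    finally show ?thesis .
  qed
  then show ?thesis using K_L2[OF Proj_L2[OF z]] by blast
qed

text \<open>
  The combination of \<open>u\<close> and \<open>v\<close> with zero slope at the left end is an eigenfunction and
  vanishes, which contradicts the orthogonality of \<open>u\<close> and \<open>v\<close>.
\<close>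

lemma simple_eigenvalue:
  assumes u: "eigenpair u m" and v: "eigenpair v m" and "0 < m"
    and uv: "ipp u v = 0" and "ipp u u \<noteq> 0" and "ipp v v \<noteq> 0"
  shows False
proof -
  obtain k where k: "k \<in> L2" and sl: "\<And>f. f \<in> L2 \<Longrightarrow> slope (mom f) = ip2 (\<lambda>t. p t * f t) k"
    using slope_mom by blast
  define A where "A f = slope (mom (apply_bcontfun f))" for f
  have A: "A (x *\<^sub>R f + y *\<^sub>R g) = x * A f + y * A g" for x y f g
  proof -
    have "A (x *\<^sub>R f + y *\<^sub>R g) = ip2 (\<lambda>t. x * (p t * apply_bcontfun f t) + y * (p t * apply_bcontfun g t)) k"
      unfolding A_def sl[OF bcontfun_L2]
      by (rule ip2_cong) (auto simp: plus_bcontfun.rep_eq scaleR_bcontfun.rep_eq algebra_simps)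
    also have "\<dots> = x * A f + y * A g"
      by (simp add: ip2_add L2_cmult pf_L2 bcontfun_L2 k ip2_cmult A_def sl)
    finally show ?thesis .
  qed
  have zero: "ipp w w = 0" if "eigenpair w m" "A w = 0" for w
  proof -
    have "apply_bcontfun w x = 0" if "x \<in> {-pi..pi}" for x
      by (rule clamped_eigenfunction_zero[OF _ \<open>0 < m\<close> eigenpair_pointwise[OF \<open>eigenpair w m\<close>] _ that])
         (use \<open>A w = 0\<close> in \<open>auto simp: A_def\<close>)
    then have "ipp w w = ip2 (\<lambda>t. p t * 0) (\<lambda>t. 0)"
      unfolding ipp_def by (intro ip2_cong) auto
    then show ?thesis by (simp add: ip2_def)
  qed
  define w where "w = A v *\<^sub>R u + (- A u) *\<^sub>R v"
  have "eigenpair w m"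
    using u v unfolding eigenpair_def w_def
    by (simp add: T_add_ip T_scale_ip ip_add ip_scale algebra_simps del: scaleR_minus_left)
  moreover have "A w = 0" unfolding w_def A by simp
  ultimately have w0: "ipp w y = 0" for y using zero ip_null by blast
  have "ipp w u = A v * ipp u u"
    using uv ip_sym[of v u] by (simp add: w_def ip_add ip_scale del: scaleR_minus_left)
  then have "A v = 0" using w0[of u] assms by simp
  then show False using zero[OF v] assms by simp
qed

text \<open>
  The conclusion of \<open>spectral_sequence\<close> with strictly decreasing eigenvalues, as a predicate so
  that the sequences for two different weights can be compared.
\<close>

definition spectral :: "(nat \<Rightarrow> real \<Rightarrow>\<^sub>C real) \<Rightarrow> (nat \<Rightarrow> real) \<Rightarrow> bool" where
  "spectral e m \<longleftrightarrow> (\<forall>i j. ipp (e i) (e j) = (if i = j then 1 else 0)) \<and>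
     (\<forall>i. eigenpair (e i) (m i)) \<and> (\<forall>i. 0 < m i) \<and> (\<forall>i. m (Suc i) < m i) \<and> m \<longlonglongrightarrow> 0 \<and>
     (\<forall>n x. (\<forall>i<n. ipp x (e i) = 0) \<longrightarrow> ipp (T x) x \<le> m n * ipp x x)"

lemma spectral_exists: "\<exists>e m. spectral e m"
proof -
  obtain e m where *: "\<forall>i j. ipp (e i) (e j) = (if i = j then 1 else 0)"
     "\<forall>i. eigenpair (e i) (m i)" "\<forall>i. 0 < m i" "decseq m" "m \<longlonglongrightarrow> 0"
     "\<forall>n x. (\<forall>i<n. ipp x (e i) = 0) \<longrightarrow> ipp (T x) x \<le> m n * ipp x x"
    using spectral_sequence by blast
  have "m (Suc i) < m i" for i
  proof (rule ccontr)
    assume "\<not> m (Suc i) < m i"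
    then have "m (Suc i) = m i" using decseq_SucD[OF *(4), of i] by simp
    then show False
      using simple_eigenvalue[of "e i" "m i" "e (Suc i)"] *(1-3) by (metis n_not_Suc_n zero_neq_one)
  qed
  then show ?thesis using * unfolding spectral_def by blast
qed

text \<open>
  An eigenvector for a value that is missing from the sequence would be orthogonal to all
  \<open>e i\<close>, so its eigenvalue would be at most every \<open>m n\<close>, and these tend to 0.
\<close>

lemma spectral_complete:
  assumes sp: "spectral e m" and x: "eigenpair x l" and "0 < l" and nz: "ipp x x \<noteq> 0"
  shows "\<exists>n. l = m n"
proof (rule ccontr)
  assume no: "\<nexists>n. l = m n"
  have "ipp x (e i) = 0" for i
  proof -
    have "l * ipp x (e i) = ipp (T x) (e i)" using x by (simp add: eigenpair_def)
    also have "\<dots> = ipp (T (e i)) x" by (metis T_sym ip_sym)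
    also have "\<dots> = m i * ipp x (e i)" using sp by (simp add: spectral_def eigenpair_def ip_sym)
    finally show ?thesis using no by auto
  qed
  then have "ipp (T x) x \<le> m n * ipp x x" for n using sp by (simp add: spectral_def)
  then have "l * ipp x x \<le> m n * ipp x x" for n using x by (simp add: eigenpair_def)
  then have "l \<le> m n" for n using nz ip_nonneg[of x] by simp
  moreover have "m \<longlonglongrightarrow> 0" using sp by (simp add: spectral_def)
  ultimately have "l \<le> 0" using LIMSEQ_le_const by blast
  then show False using \<open>0 < l\<close> by simp
qed

end

section \<open>The weak eigenvalue problem as an operator equation\<close>

text \<open>
  Applying \<open>weak_deriv_imp_primitive\<close> twice writes \<open>v\<close> as a double primitive of its second
  derivative up to an affine function, which the boundary values determine. The equality, at first
  almost everywhere, holds everywhere by continuity.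
\<close>

lemma V_imp_K:
  assumes a: "0 < a" "a < 1" and v: "v \<in> V a"
  shows "weak_deriv (weak_deriv v) \<in> W a"
    and "x \<in> beam \<Longrightarrow> v x = - K (weak_deriv (weak_deriv v)) x"
proof -
  define g where "g = weak_deriv v"
  define h where "h = weak_deriv g"
  have H2: "v \<in> H2" and H10: "v \<in> H10" and cont: "continuous_on beam v"
    and piers: "v (a * pi) = 0" "v (- a * pi) = 0"
    using v by (auto simp: V_def)
  obtain g' h' where gh: "has_weak_deriv v g'" "has_weak_deriv g' h'"
    using H2 unfolding H2_def by blast
  have wg: "has_weak_deriv v g" unfolding g_def by (rule weak_deriv_AE[OF gh(1)])
  have gL: "g \<in> L2" using wg by (simp add: has_weak_deriv_def)
  have "has_weak_deriv g h'"
    by (rule has_weak_deriv_cong_AE[OF gh(2) L2D(1)[OF gL]])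
       (use weak_deriv_AE(2)[OF gh(1)] in \<open>simp add: g_def\<close>)
  then have wh: "has_weak_deriv g h" unfolding h_def by (rule weak_deriv_AE)
  have hL: "h \<in> L2" using wh by (simp add: has_weak_deriv_def)
  obtain c where c: "AE x in beam_measure. g x = c + primitive h x"
    using weak_deriv_imp_primitive[OF wh] by blast
  obtain d where d: "AE x in beam_measure. v x = d + primitive g x"
    using weak_deriv_imp_primitive[OF wg] by blast
  note bd = H10_boundary[OF H10 gL d]
  note PL = primitive_L2[OF hL]
  note [measurable] = L2D(1)[OF gL] L2D(1)[OF PL]
  have "0 = (LINT x|beam_measure. g x)" using bd(2) by simp
  also have "\<dots> = (LINT x|beam_measure. c + primitive h x)"
    by (rule integral_cong_AE) (use c in auto)
  also have "\<dots> = 2 * pi * (c + slope h)"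
    using L2_integrable[OF PL] by (simp add: slope_def algebra_simps)
  finally have csl: "c = - slope h" by simp
  have pg: "primitive g x = - K h x" if "x \<in> {-pi..pi}" for x
  proof -
    have "primitive g x = primitive (\<lambda>x. (-1) * K' h x) x"
      by (rule primitive_cong_AE)
         (use c L2D(1)[OF L2_cmult[OF K'_L2[OF hL]]] in \<open>auto simp: csl K'_def\<close>)
    also have "\<dots> = - K h x"
      using primitive_cmult[of "-1" "K' h" x] K_primitive[OF hL that] by simp
    finally show ?thesis .
  qed
  have vK: "v x = - K h x" if "x \<in> beam" for x
  proof -
    have cd: "continuous_on beam (\<lambda>x. v x + K h x)"
      by (intro continuous_intros cont continuous_on_subset[OF K_continuous[OF hL]]) auto
    have "AE x in beam_measure. v x + K h x = 0"
      using d AE_space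
    proof eventually_elim
      fix x assume "v x = d + primitive g x" "x \<in> space beam_measure"
      then show "v x + K h x = 0" using bd(1) pg[of x] by simp
    qed
    then have "v x + K h x = 0" by (rule continuous_null_open[OF cd _ that])
    then show ?thesis by simp
  qed
  have "a * pi \<in> beam" "- a * pi \<in> beam"
    using pier_bounds[OF a] unfolding greaterThanLessThan_iff by blast+
  then have "K h (a * pi) = 0" "K h (- a * pi) = 0"
    using vK piers by force+
  then have "h \<in> W a" using hL by (simp add: W_def K_def ip2_sym)
  then show "weak_deriv (weak_deriv v) \<in> W a" by (simp add: g_def h_def)
  show "x \<in> beam \<Longrightarrow> v x = - K (weak_deriv (weak_deriv v)) x"
    using vK[of x] by (simp add: g_def h_def)
qed

lemma K_imp_V:
  assumes h: "h \<in> W a" and u: "\<And>x. x \<in> {-pi<..<pi} \<Longrightarrow> u x = - K h x" and a: "0 < a" "a < 1"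
  shows "u \<in> V a" and "AE x in beam_measure. weak_deriv (weak_deriv u) x = h x"
proof -
  have hL: "h \<in> L2" using h by (simp add: W_def)
  define g where "g x = - K' h x" for x
  have g: "continuous_on {-pi..pi} g" unfolding g_def by (intro continuous_intros K'_continuous hL)
  note gL = L2_continuous[OF g]
  have mean: "(LINT x|beam_measure. g x) = 0" unfolding g_def using K'_mean[OF hL] by simp
  have eq: "u x = primitive g x" if "x \<in> beam" for x
    using u[OF that] K_primitive[OF hL, of x] primitive_cmult[of "-1" "K' h" x] that
    by (simp add: g_def[abs_def])
  have um: "u \<in> borel_measurable beam_measure"
    using measurable_cong[THEN iffD2, OF _ L2D(1)[OF primitive_L2[OF gL]]] eq by simp
  have AEu: "AE x in beam_measure. u x = primitive g x" by (rule AE_I2) (use eq in auto)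
  have wg: "has_weak_deriv u g"
    by (rule has_weak_deriv_primitive[OF gL um, of 0]) (use AEu in auto)
  have wh: "has_weak_deriv g h"
    by (rule has_weak_deriv_primitive[OF hL L2D(1)[OF gL], of "- slope h"])
       (auto simp: g_def K'_def)
  have "u \<in> H2" using wg wh unfolding H2_def by blast
  moreover have "u \<in> H10" by (rule primitive_H10[OF g mean um AEu])
  moreover have "continuous_on beam u"
  proof (rule continuous_on_cong[THEN iffD2, OF refl eq])
    show "continuous_on beam (primitive g)"
      by (rule continuous_on_subset[OF primitive_continuous[OF gL]]) auto
  qed
  moreover have "u (a * pi) = 0" "u (- a * pi) = 0"
  proof -
    have "a * pi \<in> beam" "- a * pi \<in> beam"
      using pier_bounds[OF a] unfolding greaterThanLessThan_iff by blast+
    then show "u (a * pi) = 0" "u (- a * pi) = 0"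
      using u h by (auto simp: W_def K_def ip2_sym)
  qed
  ultimately show "u \<in> V a" by (simp add: V_def)
  have wgL: "weak_deriv u \<in> L2" using weak_deriv_AE(1)[OF wg] by (simp add: has_weak_deriv_def)
  have "has_weak_deriv (weak_deriv u) h"
    by (rule has_weak_deriv_cong_AE[OF wh L2D(1)[OF wgL] weak_deriv_AE(2)[OF wg]])
  then show "AE x in beam_measure. weak_deriv (weak_deriv u) x = h x"
    by (rule weak_deriv_AE(2))
qed

context weighted_beam
begin

lemma is_eigenvalue_ip2:
  "is_eigenvalue a p l \<longleftrightarrow>
     (\<exists>e\<in>V a. (\<exists>x\<in>beam. e x \<noteq> 0) \<and>
        (\<forall>v\<in>V a. ip2 (weak_deriv (weak_deriv e)) (weak_deriv (weak_deriv v)) = l * ip2 (\<lambda>t. p t * e t) v))"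
  unfolding is_eigenvalue_def ip2_def by (rule refl)

text \<open>
  Testing the weak equation with \<open>v = -K g\<close> for \<open>g\<close> in \<open>W a\<close> identifies the second
  derivative \<open>h\<close> of an eigenfunction with \<open>-l\<close> times its moment.
\<close>

lemma eigenvalue_imp_eigenpair:
  assumes "is_eigenvalue a p l"
  shows "0 < l \<and> (\<exists>f. eigenpair f (1 / l) \<and> ipp f f \<noteq> 0)"
proof -
  obtain e x0 where e: "e \<in> V a" and x0: "x0 \<in> beam" "e x0 \<noteq> 0"
    and eq: "\<And>v. v \<in> V a \<Longrightarrow> ip2 (weak_deriv (weak_deriv e)) (weak_deriv (weak_deriv v))
           = l * ip2 (\<lambda>t. p t * e t) v"
    using assms unfolding is_eigenvalue_ip2 by blast
  define h where "h = weak_deriv (weak_deriv e)"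
  have hW: "h \<in> W a" unfolding h_def by (rule V_imp_K[OF a_range e])
  then have hL: "h \<in> L2" by (simp add: W_def)
  have eK: "e x = - K h x" if "x \<in> beam" for x
    unfolding h_def by (rule V_imp_K(2)[OF a_range e that])
  define f where "f = ext (\<lambda>x. - K h x)"
  have cK: "continuous_on {-pi..pi} (\<lambda>x. - K h x)" by (intro continuous_intros K_continuous hL)
  have f: "apply_bcontfun f x = - K h x" if "x \<in> {-pi..pi}" for x
    unfolding f_def by (rule ext_apply[OF cK that])
  note fL = bcontfun_L2[of f]
  have key: "ip2 h g = - l * ip2 (mom (apply_bcontfun f)) g" if g: "g \<in> W a" for g
  proof -
    define v where "v x = - K g x" for x
    have v: "v \<in> V a" "AE x in beam_measure. weak_deriv (weak_deriv v) x = g x"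
      by (rule K_imp_V[OF g _ a_range]; simp add: v_def)+
    have gL: "g \<in> L2" using g by (simp add: W_def)
    have vL: "weak_deriv (weak_deriv v) \<in> L2" using V_imp_K(1)[OF a_range v(1)] by (simp add: W_def)
    have "ip2 h g = ip2 g h" by (rule ip2_sym)
    also have "\<dots> = ip2 (weak_deriv (weak_deriv v)) h"
      by (rule ip2_cong_AE[OF gL L2D(1)[OF vL] hL]) (use v(2) in auto)
    also have "\<dots> = l * ip2 (\<lambda>t. p t * e t) v" using eq[OF v(1)] by (simp add: h_def ip2_sym)
    also have "ip2 (\<lambda>t. p t * e t) v = ip2 (\<lambda>t. - K g t) (\<lambda>t. p t * apply_bcontfun f t)"
      by (subst ip2_sym, rule ip2_cong) (auto simp: v_def eK f)
    also have "\<dots> = - ip2 (mom (apply_bcontfun f)) g"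
      using mom_dual[OF fL g] by (simp add: ip2_uminus ip2_sym)
    finally show ?thesis by simp
  qed
  have nz: "ipp f f \<noteq> 0"
  proof
    assume "ipp f f = 0"
    then have "apply_bcontfun f x0 = 0"
      using weighted_definite[of "apply_bcontfun f" x0] x0 by (auto simp: ipp_def)
    then show False using f[of x0] eK[OF x0(1)] x0 by simp
  qed
  have pos: "ipp f f > 0" using nz ip_nonneg[of f] by simp
  have fh: "ip2 (mom (apply_bcontfun f)) h = - ipp f f"
  proof -
    have "ip2 (mom (apply_bcontfun f)) h = ip2 (\<lambda>t. p t * apply_bcontfun f t) (K h)"
      using mom_dual[OF fL hW] by simp
    also have "\<dots> = ip2 (\<lambda>t. - apply_bcontfun f t) (\<lambda>t. p t * apply_bcontfun f t)"
      by (subst ip2_sym, rule ip2_cong) (auto simp: f)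
    finally show ?thesis by (simp add: ip2_uminus ipp_def ip2_weight_swap)
  qed
  have hh: "ip2 h h = l * ipp f f" using key[OF hW] fh by simp
  have l0: "l \<noteq> 0"
  proof
    assume "l = 0"
    then have "ip2 h h = 0" using hh by simp
    then have "AE x in beam_measure. h x = 0" using L2_null[OF hL] by (simp add: ip2_self)
    then have "K h x0 = 0"
      unfolding K_def ip2_sym[of "hat x0"] using ip2_cong_AE[of "\<lambda>_. 0" h "hat x0"] hL L2D(1)[OF hL] hat_L2
      by (auto simp: ip2_def)
    then show False using eK[OF x0(1)] x0 by simp
  qed
  have lpos: "0 < l" using hh ip2_nonneg[of h] pos l0 by (simp add: zero_le_mult_iff)
  have "ipp (T f) y = 1 / l * ipp f y" for y
  proof -
    have "ip2 h (mom (apply_bcontfun y)) = - l * ip2 (mom (apply_bcontfun f)) (mom (apply_bcontfun y))"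
      by (rule key[OF mom_W[OF bcontfun_L2]])
    moreover have "ip2 h (mom (apply_bcontfun y)) = - ipp f y"
    proof -
      have "ip2 h (mom (apply_bcontfun y)) = ip2 (\<lambda>t. p t * apply_bcontfun y t) (K h)"
        using mom_dual[OF bcontfun_L2 hW, of y] by (simp add: ip2_sym)
      also have "\<dots> = ip2 (\<lambda>t. - apply_bcontfun f t) (\<lambda>t. p t * apply_bcontfun y t)"
        by (subst ip2_sym, rule ip2_cong) (auto simp: f)
      finally show ?thesis by (simp add: ip2_uminus ipp_def ip2_weight_swap)
    qed
    ultimately show ?thesis using l0 by (simp add: ipp_T)
  qed
  then have "eigenpair f (1 / l)" by (simp add: eigenpair_def)
  then show ?thesis using lpos nz by blast
qed

lemma eigenpair_imp_eigenvalue: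
  assumes f: "eigenpair f m" and "0 < m" and nz: "ipp f f \<noteq> 0"
  shows "is_eigenvalue a p (1 / m)"
proof -
  note fL = bcontfun_L2[of f]
  define h where "h x = (- 1 / m) * mom (apply_bcontfun f) x" for x
  note mW = mom_W[OF fL]
  note mL = mom_L2[OF fL]
  have hL: "h \<in> L2" unfolding h_def by (rule L2_cmult[OF mL])
  have hW: "h \<in> W a"
    using hL mW ip2_cmult[of "- 1 / m" "mom (apply_bcontfun f)"] by (simp add: W_def h_def[abs_def])
  have fK: "apply_bcontfun f x = - K h x" if "x \<in> {-pi..pi}" for x
  proof -
    have "K h x = (- 1 / m) * K (mom (apply_bcontfun f)) x"
      unfolding K_def h_def[abs_def] ip2_sym[of "hat x"] by (rule ip2_cmult)
    then have "m * apply_bcontfun f x = m * (- K h x)"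
      using eigenpair_pointwise[OF f that] \<open>0 < m\<close> by simp
    then show ?thesis using \<open>0 < m\<close> mult_left_cancel[of m] by blast
  qed
  have fV: "apply_bcontfun f \<in> V a" and AEh: "AE x in beam_measure. weak_deriv (weak_deriv (apply_bcontfun f)) x = h x"
    by (rule K_imp_V[OF hW _ a_range]; simp add: fK)+
  have wL: "weak_deriv (weak_deriv (apply_bcontfun f)) \<in> L2"
    using V_imp_K(1)[OF a_range fV] by (simp add: W_def)
  have "\<exists>x\<in>beam. apply_bcontfun f x \<noteq> 0"
  proof (rule ccontr)
    assume "\<not> ?thesis"
    then have "ipp f f = ip2 (\<lambda>t. 0) (\<lambda>t. 0)" unfolding ipp_def by (intro ip2_cong) auto
    then show False using nz by (simp add: ip2_def)
  qed
  moreover have "ip2 (weak_deriv (weak_deriv (apply_bcontfun f))) (weak_deriv (weak_deriv v))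
           = 1 / m * ip2 (\<lambda>t. p t * apply_bcontfun f t) v" if v: "v \<in> V a" for v
  proof -
    define g where "g = weak_deriv (weak_deriv v)"
    have gW: "g \<in> W a" and vK: "\<And>x. x \<in> beam \<Longrightarrow> v x = - K g x"
      unfolding g_def using V_imp_K[OF a_range v] by auto
    then have gL: "g \<in> L2" by (simp add: W_def)
    have "ip2 (weak_deriv (weak_deriv (apply_bcontfun f))) g = ip2 h g"
      by (rule ip2_cong_AE[OF wL L2D(1)[OF hL] gL AEh])
    also have "\<dots> = (- 1 / m) * ip2 (mom (apply_bcontfun f)) g"
      unfolding h_def[abs_def] by (rule ip2_cmult)
    also have "\<dots> = (- 1 / m) * ip2 (\<lambda>t. p t * apply_bcontfun f t) (K g)"
      by (simp add: mom_dual[OF fL gW])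
    also have "ip2 (\<lambda>t. p t * apply_bcontfun f t) (K g) = ip2 (\<lambda>t. - v t) (\<lambda>t. p t * apply_bcontfun f t)"
      by (subst ip2_sym, rule ip2_cong) (auto simp: vK)
    also have "\<dots> = - ip2 (\<lambda>t. p t * apply_bcontfun f t) v"
      by (simp add: ip2_uminus ip2_sym)
    finally show ?thesis by (simp add: g_def)
  qed
  ultimately show ?thesis
    using fV unfolding is_eigenvalue_ip2 by blast
qed

lemma eigenvalues_spectral:
  assumes sp: "spectral e m"
  shows "is_eigenvalue a p l \<longleftrightarrow> (\<exists>n. l = 1 / m n)"
proof
  assume "is_eigenvalue a p l"
  then obtain f where "0 < l" "eigenpair f (1 / l)" "ipp f f \<noteq> 0"
    using eigenvalue_imp_eigenpair by blast
  then obtain n where "1 / l = m n" using spectral_complete[OF sp] by fastforce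
  then have "l = 1 / m n" using \<open>0 < l\<close> by (metis divide_divide_eq_right div_by_1 mult_1)
  then show "\<exists>n. l = 1 / m n" ..
next
  assume "\<exists>n. l = 1 / m n"
  then obtain n where "l = 1 / m n" ..
  then show "is_eigenvalue a p l"
    using eigenpair_imp_eigenvalue[of "e n" "m n"] sp by (simp add: spectral_def)
qed

text \<open>
  Exactly \<open>i + 1\<close> members of the strictly increasing sequence \<open>1 / m\<close> are at most
  \<open>1 / m i\<close>, so the counting condition picks the right member and no other.
\<close>

lemma nth_eigenvalue_spectral:
  assumes sp: "spectral e m"
  shows "nth_eigenvalue a p (Suc n) = 1 / m n"
proof -
  have pos: "0 < m i" and dec: "m (Suc i) < m i" for i using sp by (auto simp: spectral_def)
  have mono: "strict_mono (\<lambda>i. 1 / m i)"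
    using pos dec by (auto simp: strict_mono_Suc_iff intro!: divide_strict_left_mono)
  have count: "card {l. is_eigenvalue a p l \<and> l \<le> 1 / m i} = Suc i" for i
  proof -
    have "{l. is_eigenvalue a p l \<and> l \<le> 1 / m i} = (\<lambda>i. 1 / m i) ` {..i}"
      using strict_mono_less_eq[OF mono] by (auto simp: eigenvalues_spectral[OF sp])
    moreover have "inj_on (\<lambda>i. 1 / m i) {..i}"
      using strict_mono_imp_inj_on[OF mono] by (rule inj_on_subset) (rule subset_UNIV)
    ultimately show ?thesis by (simp add: card_image)
  qed
  show ?thesis
    unfolding nth_eigenvalue_def
  proof (rule the_equality)
    show "is_eigenvalue a p (1 / m n) \<and> card {l. is_eigenvalue a p l \<and> l \<le> 1 / m n} = Suc n"
      using count eigenvalues_spectral[OF sp] by blast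
    fix l assume l: "is_eigenvalue a p l \<and> card {l'. is_eigenvalue a p l' \<and> l' \<le> l} = Suc n"
    then obtain i where "l = 1 / m i" using eigenvalues_spectral[OF sp] by blast
    then show "l = 1 / m n" using l count[of i] by simp
  qed
qed

end

section \<open>Dependence of the eigenvalues on the weight\<close>

lemma ip2_sum:
  "h \<in> L2 \<Longrightarrow> (\<And>i. i \<in> A \<Longrightarrow> f i \<in> L2) \<Longrightarrow>
     ip2 (\<lambda>t. \<Sum>i\<in>A. k i * f i t) h = (\<Sum>i\<in>A. k i * ip2 (f i) h)"
proof (induction A rule: infinite_finite_induct)
  case (insert i A)
  then show ?case
    by (simp add: ip2_add L2_cmult L2_sum ip2_cmult)
qed (auto simp: ip2_def)

text \<open>
  On the interval \<open>u\<^sup>2\<close> is the primitive of \<open>s = 2uu'\<close>. The difference of the two forms is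
  \<open>\<integral>(p - q)u\<^sup>2 = -\<integral>s(P - Q)\<close> with the primitives \<open>P\<close> and \<open>Q\<close> of the weights, and
  \<open>K_bound\<close> and \<open>K'_bound\<close> give \<open>\<bar>s\<bar> \<le> 16\<pi>\<^sup>2 ip2 g g\<close>.
\<close>

lemma weight_perturbation:
  assumes p: "p \<in> L2" and q: "q \<in> L2" and g: "g \<in> L2"
    and mean: "(LINT x|beam_measure. p x) = (LINT x|beam_measure. q x)"
    and d: "\<And>x. x \<in> {-pi..pi} \<Longrightarrow> \<bar>primitive p x - primitive q x\<bar> \<le> d"
    and int: "integrable beam_measure (\<lambda>x. p x * u x * u x)" "integrable beam_measure (\<lambda>x. q x * u x * u x)"
    and u: "\<And>x. x \<in> beam \<Longrightarrow> u x = - K g x"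
  shows "\<bar>ip2 (\<lambda>t. p t * u t) u - ip2 (\<lambda>t. q t * u t) u\<bar> \<le> 32 * pi ^ 3 * d * ip2 g g"
proof -
  define E where "E = ip2 g g"
  have E0: "0 \<le> E" unfolding E_def by (rule ip2_nonneg)
  have d0: "0 \<le> d" using d[of pi] by simp
  define w where "w = K' g"
  have wc: "continuous_on {-pi..pi} w" unfolding w_def by (rule K'_continuous[OF g])
  have wL: "w \<in> L2" by (rule L2_continuous[OF wc])
  define s where "s x = 2 * (w x * primitive w x)" for x
  have sc: "continuous_on {-pi..pi} s"
    unfolding s_def by (intro continuous_intros wc primitive_continuous[OF wL])
  have sL: "s \<in> L2" by (rule L2_continuous[OF sc])
  have us: "u x * u x = primitive s x" if "x \<in> beam" for x
  proof -
    have "primitive s x = 2 * primitive (\<lambda>x. w x * primitive w x) x"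
      unfolding s_def[abs_def] by (rule primitive_cmult)
    also have "\<dots> = (primitive w x)\<^sup>2" using primitive_square[OF wL, of x] that by simp
    also have "\<dots> = (K g x)\<^sup>2" using K_primitive[OF g, of x] that by (simp add: w_def)
    finally show ?thesis using u[OF that] by (simp add: power2_eq_square)
  qed
  define r where "r x = p x - q x" for x
  have rL: "r \<in> L2" unfolding r_def by (rule L2_diff[OF p q])
  have r0: "(LINT x|beam_measure. r x) = 0"
    unfolding r_def using L2_integrable[OF p] L2_integrable[OF q] mean by simp
  have "ip2 (\<lambda>t. p t * u t) u - ip2 (\<lambda>t. q t * u t) u = (LINT x|beam_measure. p x * u x * u x - q x * u x * u x)"
    unfolding ip2_def using int by simp
  also have "\<dots> = (LINT x|beam_measure. primitive s x * r x)"
  proof (rule Bochner_Integration.integral_cong[OF refl])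
    fix x assume "x \<in> space beam_measure"
    then have "u x * u x = primitive s x" by (intro us) simp
    then show "p x * u x * u x - q x * u x * u x = primitive s x * r x"
      by (simp add: r_def mult.assoc algebra_simps)
  qed
  also have "\<dots> = - (LINT x|beam_measure. s x * primitive r x)"
    using primitive_by_parts[OF sL rL] r0 by simp
  finally have eq: "\<bar>ip2 (\<lambda>t. p t * u t) u - ip2 (\<lambda>t. q t * u t) u\<bar> = \<bar>LINT x|beam_measure. s x * primitive r x\<bar>"
    by simp
  have sb: "\<bar>s x\<bar> \<le> 16 * pi\<^sup>2 * E" if x: "x \<in> {-pi..pi}" for x
  proof -
    have "(w x)\<^sup>2 \<le> 8 * pi * E" unfolding w_def E_def by (rule K'_bound[OF g])
    moreover have "(primitive w x)\<^sup>2 \<le> 8 * pi ^ 3 * E"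
      using K_bound[OF g x] K_primitive[OF g x] by (simp add: w_def E_def)
    ultimately have "(w x)\<^sup>2 * (primitive w x)\<^sup>2 \<le> (8 * pi * E) * (8 * pi ^ 3 * E)"
      using E0 by (intro mult_mono) auto
    then have "4 * ((w x)\<^sup>2 * (primitive w x)\<^sup>2) \<le> 4 * ((8 * pi * E) * (8 * pi ^ 3 * E))"
      by (rule mult_left_mono) simp
    moreover have "(s x)\<^sup>2 = 4 * ((w x)\<^sup>2 * (primitive w x)\<^sup>2)"
      by (simp add: s_def power_mult_distrib)
    ultimately have "(s x)\<^sup>2 \<le> 4 * ((8 * pi * E) * (8 * pi ^ 3 * E))" by simp
    also have "\<dots> = (16 * pi\<^sup>2 * E)\<^sup>2"
      by (simp add: power2_eq_square power3_eq_cube)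
    finally have "\<bar>s x\<bar> \<le> \<bar>16 * pi\<^sup>2 * E\<bar>" by (simp only: abs_le_square_iff)
    then show ?thesis using E0 by simp
  qed
  have "\<bar>LINT x|beam_measure. s x * primitive r x\<bar> \<le> (LINT x|beam_measure. \<bar>s x * primitive r x\<bar>)"
    by (rule integral_abs_bound)
  also have "\<dots> \<le> (LINT x|beam_measure. 16 * pi\<^sup>2 * E * d)"
  proof (rule integral_mono)
    fix x assume "x \<in> space beam_measure"
    then have x: "x \<in> {-pi..pi}" by auto
    have "\<bar>primitive r x\<bar> \<le> d"
      unfolding r_def[abs_def] primitive_diff[OF p q] by (rule d[OF x])
    then show "\<bar>s x * primitive r x\<bar> \<le> 16 * pi\<^sup>2 * E * d"
      unfolding abs_mult using sb[OF x] E0 by (intro mult_mono) auto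
  qed (use L2_mult_integrable[OF sL primitive_L2[OF rL]] in auto)
  also have "\<dots> = 32 * pi ^ 3 * d * E" by (simp add: power2_eq_square power3_eq_cube)
  finally show ?thesis unfolding eq E_def .
qed

text \<open>
  Half of the minimax principle for each weight. Among the combinations of the first \<open>n+1\<close>
  eigenfunctions for \<open>p\<close> there is one, \<open>x\<close>, that is orthogonal to the first \<open>n\<close>
  eigenfunctions for \<open>q\<close>. With energy \<open>E\<close>, the form of \<open>p\<close> is at least \<open>m n * E\<close> at
  \<open>x\<close> and the form of \<open>q\<close> at most \<open>m' n * E\<close>.
\<close>

lemma spectral_comparison:
  assumes P: "weighted_beam a \<alpha> \<beta> p" and Q: "weighted_beam a \<alpha> \<beta> q"
    and sp: "weighted_beam.spectral a p e m" and sq: "weighted_beam.spectral a q e' m'"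
    and mean: "(LINT x|beam_measure. p x) = (LINT x|beam_measure. q x)"
    and d: "\<And>x. x \<in> {-pi..pi} \<Longrightarrow> \<bar>primitive p x - primitive q x\<bar> \<le> d"
  shows "m n \<le> m' n + 32 * pi ^ 3 * d"
proof -
  interpret P: weighted_beam a \<alpha> \<beta> p by (rule P)
  interpret Q: weighted_beam a \<alpha> \<beta> q by (rule Q)
  have orth: "\<And>i j. P.ipp (e i) (e j) = (if i = j then 1 else 0)" and eig: "\<And>i. P.eigenpair (e i) (m i)"
    and mpos: "\<And>i. 0 < m i" and mdec: "\<And>i. m (Suc i) < m i"
    using sp by (auto simp: P.spectral_def)
  have mpos': "0 < m' n" and max': "\<And>x. (\<And>i. i < n \<Longrightarrow> Q.ipp x (e' i) = 0) \<Longrightarrow> Q.ipp (Q.T x) x \<le> m' n * Q.ipp x x"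
    using sq by (auto simp: Q.spectral_def)
  have manti: "m n \<le> m i" if "i \<le> n" for i
    using decseqD[of m i n] that mdec by (auto intro: decseq_SucI less_imp_le)
  obtain c where c0: "\<exists>i\<in>{..n}. c i \<noteq> 0"
      and c: "\<forall>j\<in>{..<n}. (\<Sum>i\<in>{..n}. c i * Q.ipp (e i) (e' j)) = 0"
    using homogeneous_system[of "{..<n}" "{..n}" "\<lambda>j i. Q.ipp (e i) (e' j)"] by auto
  define x where "x = (\<Sum>i\<le>n. c i *\<^sub>R e i)"
  have Px: "P.ipp (e i) x = c i" if "i \<le> n" for i
  proof -
    have "P.ipp (e i) x = (\<Sum>j\<le>n. c j * P.ipp (e j) (e i))"
      unfolding x_def P.ip_sym[of "e i"] P.ip_sum P.ip_scale by (rule refl)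
    also have "\<dots> = c i" using that by (simp add: orth if_distrib cong: if_cong)
    finally show ?thesis .
  qed
  have Pxx: "P.ipp x x = (\<Sum>i\<le>n. c i * c i)"
  proof -
    have "P.ipp x x = (\<Sum>i\<le>n. c i * P.ipp (e i) x)"
      by (subst (1) x_def) (simp add: P.ip_sum P.ip_scale)
    then show ?thesis using Px by simp
  qed
  define M where "M i = P.mom (apply_bcontfun (e i))" for i
  have M_W: "M i \<in> W a" for i unfolding M_def by (rule P.mom_W[OF bcontfun_L2])
  have M_L2: "M i \<in> L2" for i using M_W by (simp add: W_def)
  define g where "g t = (\<Sum>i\<le>n. (- c i / m i) * M i t)" for t
  have gL: "g \<in> L2" unfolding g_def by (intro L2_sum L2_cmult M_L2)
  have gip: "ip2 g h = (\<Sum>i\<le>n. (- c i / m i) * ip2 (M i) h)" if "h \<in> L2" for h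
    unfolding g_def[abs_def] by (rule ip2_sum[OF that M_L2])
  have gW: "g \<in> W a"
    using gL M_W by (simp add: W_def gip hat_L2)
  have xK: "apply_bcontfun x t = - K g t" if "t \<in> {-pi..pi}" for t
  proof -
    have "K g t = (\<Sum>i\<le>n. (- c i / m i) * K (M i) t)"
      unfolding K_def ip2_sym[of "hat t"] by (rule gip[OF hat_L2])
    also have "\<dots> = (\<Sum>i\<le>n. - (c i * apply_bcontfun (e i) t))"
    proof (rule sum.cong[OF refl])
      fix i
      show "(- c i / m i) * K (M i) t = - (c i * apply_bcontfun (e i) t)"
        unfolding M_def P.eigenpair_pointwise[OF eig that, symmetric] using mpos[of i] by simp
    qed
    finally show ?thesis
      by (simp add: x_def apply_bcontfun_sum scaleR_bcontfun.rep_eq sum_negf)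
  qed
  have xL: "apply_bcontfun x \<in> L2" by (rule bcontfun_L2)
  define E where "E = ip2 g g"
  have E: "E = (\<Sum>i\<le>n. c i * c i / m i)"
  proof -
    have "ip2 (M i) g = - c i" if "i \<le> n" for i
    proof -
      have "ip2 (M i) g = ip2 (\<lambda>t. p t * apply_bcontfun (e i) t) (K g)"
        unfolding M_def using P.mom_dual[OF bcontfun_L2 gW, of "e i"] by simp
      also have "\<dots> = ip2 (\<lambda>t. - apply_bcontfun x t) (\<lambda>t. p t * apply_bcontfun (e i) t)"
        by (subst ip2_sym, rule ip2_cong) (auto simp: xK)
      also have "\<dots> = - P.ipp (e i) x"
        unfolding ip2_uminus P.ipp_def by (simp add: ip2_sym)
      finally show ?thesis using Px[OF that] by simp
    qed
    then show ?thesis unfolding E_def gip[OF gL] by (intro sum.cong) auto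
  qed
  obtain k where k: "k \<le> n" "c k \<noteq> 0" using c0 by auto
  have Epos: "0 < E"
    unfolding E
  proof (rule sum_pos2[of _ k])
    show "0 < c k * c k / m k" using k mpos[of k] by (intro divide_pos_pos) (auto simp: zero_less_mult_iff linorder_neq_iff)
    show "0 \<le> c i * c i / m i" for i using mpos[of i] by simp
  qed (use k in auto)
  have low: "m n * E \<le> P.ipp x x"
    unfolding E Pxx sum_distrib_left
  proof (rule sum_mono)
    fix i assume "i \<in> {..n}"
    then have "m n / m i \<le> 1" using manti mpos[of i] by simp
    then have "(c i * c i) * (m n / m i) \<le> (c i * c i) * 1" by (rule mult_left_mono) simp
    then show "m n * (c i * c i / m i) \<le> c i * c i" by (simp add: mult.commute)
  qed
  have upp: "Q.ipp x x \<le> m' n * E"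
  proof (cases "Q.ipp x x = 0")
    case True
    then show ?thesis using Epos mpos' by simp
  next
    case False
    then have pos: "0 < Q.ipp x x" using Q.ip_nonneg[of x] by simp
    have "Q.ipp x (e' j) = 0" if "j < n" for j
      using c that by (simp add: x_def Q.ip_sum Q.ip_scale)
    then have "Q.ipp (Q.T x) x \<le> m' n * Q.ipp x x" by (rule max')
    then have "E * Q.ipp (Q.T x) x \<le> E * (m' n * Q.ipp x x)"
      using Epos by (intro mult_left_mono) auto
    moreover have "(Q.ipp x x)\<^sup>2 \<le> E * Q.ipp (Q.T x) x"
      using Q.energy_bound[OF xL gW, of "apply_bcontfun x"] xK
      unfolding Q.ipp_T by (simp add: Q.ipp_def E_def)
    ultimately have "Q.ipp x x * Q.ipp x x \<le> (m' n * E) * Q.ipp x x"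
      by (simp add: power2_eq_square mult_ac)
    then show ?thesis using pos by simp
  qed
  have "\<bar>P.ipp x x - Q.ipp x x\<bar> \<le> 32 * pi ^ 3 * d * E"
    unfolding P.ipp_def Q.ipp_def E_def
    by (rule weight_perturbation[OF P.p_L2 Q.p_L2 gL mean d])
       (use xK L2_mult_integrable[OF P.pf_L2[OF xL] xL] L2_mult_integrable[OF Q.pf_L2[OF xL] xL] in auto)
  then have "m n * E \<le> m' n * E + 32 * pi ^ 3 * d * E" using low upp by linarith
  then have "m n * E \<le> (m' n + 32 * pi ^ 3 * d) * E" by (simp add: distrib_right)
  then show ?thesis using Epos by simp
qed

lemma weights_beam:
  assumes "0 < \<alpha>" "0 < a" "a < 1" "p \<in> weights \<alpha> \<beta>"
  shows "weighted_beam a \<alpha> \<beta> p"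
  using assms by unfold_locales (auto simp: weights_def)

lemma eigenvalue_lipschitz:
  assumes \<alpha>: "0 < \<alpha>" and a: "0 < a" "a < 1" and p: "p \<in> weights \<alpha> \<beta>" and q: "q \<in> weights \<alpha> \<beta>"
    and d: "\<And>x. x \<in> {-pi..pi} \<Longrightarrow> \<bar>primitive p x - primitive q x\<bar> \<le> d"
  shows "0 < nth_eigenvalue a p (Suc n)"
    and "\<bar>1 / nth_eigenvalue a p (Suc n) - 1 / nth_eigenvalue a q (Suc n)\<bar> \<le> 32 * pi ^ 3 * d"
proof -
  note P = weights_beam[OF \<alpha> a p] and Q = weights_beam[OF \<alpha> a q]
  obtain e m where sp: "weighted_beam.spectral a p e m"
    using weighted_beam.spectral_exists[OF P] by blast
  obtain e' m' where sq: "weighted_beam.spectral a q e' m'"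
    using weighted_beam.spectral_exists[OF Q] by blast
  have mean: "(LINT x|beam_measure. p x) = (LINT x|beam_measure. q x)"
    using p q by (simp add: weights_def)
  have d': "\<bar>primitive q x - primitive p x\<bar> \<le> d" if "x \<in> {-pi..pi}" for x
    using d[OF that] by (simp add: abs_minus_commute)
  have "0 < m n" using sp by (simp add: weighted_beam.spectral_def[OF P])
  then show "0 < nth_eigenvalue a p (Suc n)"
    by (simp add: weighted_beam.nth_eigenvalue_spectral[OF P sp])
  show "\<bar>1 / nth_eigenvalue a p (Suc n) - 1 / nth_eigenvalue a q (Suc n)\<bar> \<le> 32 * pi ^ 3 * d"
    using spectral_comparison[OF P Q sp sq mean d, of n] spectral_comparison[OF Q P sq sp mean[symmetric] d', of n]
    by (simp add: weighted_beam.nth_eigenvalue_spectral[OF P sp] weighted_beam.nth_eigenvalue_spectral[OF Q sq] abs_le_iff)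
qed

section \<open>Compactness of the weights and existence of a maximizer\<close>

lemma weights_L2: "0 < \<alpha> \<Longrightarrow> p \<in> weights \<alpha> \<beta> \<Longrightarrow> p \<in> L2"
proof (rule L2_bounded[where C=\<beta>])
  assume \<alpha>: "0 < \<alpha>" and p: "p \<in> weights \<alpha> \<beta>"
  show "p \<in> borel_measurable beam_measure" using p by (simp add: weights_def)
  have "AE x in beam_measure. \<alpha> \<le> p x \<and> p x \<le> \<beta>" using p by (simp add: weights_def)
  then show "AE x in beam_measure. \<bar>p x\<bar> \<le> \<beta>" by eventually_elim (use \<alpha> in auto)
qed

lemma weights_midpoint:
  assumes \<alpha>: "0 < \<alpha>" and p: "p \<in> weights \<alpha> \<beta>" and q: "q \<in> weights \<alpha> \<beta>"
  shows "(\<lambda>x. (1/2) * (p x + q x)) \<in> weights \<alpha> \<beta>"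
proof -
  note [measurable] = L2D(1)[OF weights_L2[OF \<alpha> p]] L2D(1)[OF weights_L2[OF \<alpha> q]]
  have "(LINT x|beam_measure. (1/2) * (p x + q x)) = 2 * pi"
    using p q L2_integrable[OF weights_L2[OF \<alpha> p]] L2_integrable[OF weights_L2[OF \<alpha> q]]
    by (simp add: weights_def)
  moreover have "AE x in beam_measure. \<alpha> \<le> p x \<and> p x \<le> \<beta>" "AE x in beam_measure. \<alpha> \<le> q x \<and> q x \<le> \<beta>"
    "AE x in beam_measure. p x = p (- x)" "AE x in beam_measure. q x = q (- x)"
    using p q by (auto simp: weights_def)
  then have "AE x in beam_measure. \<alpha> \<le> (1/2) * (p x + q x) \<and> (1/2) * (p x + q x) \<le> \<beta>"
    "AE x in beam_measure. (1/2) * (p x + q x) = (1/2) * (p (-x) + q (-x))"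
    by (eventually_elim, simp)+
  ultimately show ?thesis by (simp add: weights_def)
qed

text \<open>
  The steps have summable \<open>L\<^sup>1\<close> norms, so by monotone convergence they are absolutely summable
  at almost every point.
\<close>

lemma L2_cauchy_AE_convergent:
  assumes q: "\<And>k. q k \<in> L2"
    and small: "\<And>k. (LINT x|beam_measure. (q (Suc k) x - q k x)\<^sup>2) \<le> (1/4) ^ k"
  shows "AE x in beam_measure. convergent (\<lambda>k. q k x)"
proof -
  define D where "D k x = \<bar>q (Suc k) x - q k x\<bar>" for k x
  have dL: "(\<lambda>x. q (Suc k) x - q k x) \<in> L2" for k by (intro L2_diff q)
  have DL: "D k \<in> L2" for k
    using L2D[OF dL[of k]] by (auto simp: D_def[abs_def] L2_def)
  note [measurable] = L2D(1)[OF DL]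
  have Dint: "(LINT x|beam_measure. D k x) \<le> sqrt (2 * pi) * (1/2) ^ k" for k
  proof -
    have "(LINT x|beam_measure. D k x)\<^sup>2 \<le> 2 * pi * (LINT x|beam_measure. (D k x)\<^sup>2)"
      by (rule integral_bound_L2[OF DL])
    also have "(LINT x|beam_measure. (D k x)\<^sup>2) \<le> (1/4) ^ k"
      using small[of k] by (simp add: D_def)
    finally have "(LINT x|beam_measure. D k x)\<^sup>2 \<le> 2 * pi * (1/4) ^ k" by simp
    also have "\<dots> = (sqrt (2 * pi) * (1/2) ^ k)\<^sup>2"
    proof -
      have "((1/2) ^ k)\<^sup>2 = (1/4 :: real) ^ k"
        by (simp add: power2_eq_square flip: power_mult_distrib)
      then show ?thesis by (simp add: power_mult_distrib)
    qed
    finally show ?thesis by (rule power2_le_imp_le) simp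
  qed
  have summ: "summable (\<lambda>k. LINT x|beam_measure. D k x)"
  proof (rule summable_comparison_test')
    show "summable (\<lambda>k. sqrt (2 * pi) * (1/2) ^ k :: real)"
      by (intro summable_mult summable_geometric) simp
    show "norm (LINT x|beam_measure. D k x) \<le> sqrt (2 * pi) * (1/2) ^ k" if "k \<ge> 0" for k
      using Dint[of k] integral_nonneg_AE[of "D k" beam_measure] by (simp add: D_def)
  qed
  have "(\<integral>\<^sup>+x. (\<Sum>k. ennreal (D k x)) \<partial>beam_measure) = (\<Sum>k. \<integral>\<^sup>+x. ennreal (D k x) \<partial>beam_measure)"
    by (rule nn_integral_suminf) measurable
  also have "\<dots> = (\<Sum>k. ennreal (LINT x|beam_measure. D k x))"
    by (intro suminf_cong nn_integral_eq_integral L2_integrable DL) (simp add: D_def)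
  also have "\<dots> \<noteq> \<infinity>"
    unfolding infinity_ennreal_def
    by (rule ennreal_suminf_neq_top[OF summ]) (rule integral_nonneg_AE, simp add: D_def)
  finally have fin: "(\<integral>\<^sup>+x. (\<Sum>k. ennreal (D k x)) \<partial>beam_measure) \<noteq> \<infinity>" .
  have "AE x in beam_measure. (\<Sum>k. ennreal (D k x)) \<noteq> \<infinity>"
    by (rule nn_integral_PInf_AE[OF _ fin]) measurable
  then show ?thesis
  proof eventually_elim
    fix x assume "(\<Sum>k. ennreal (D k x)) \<noteq> \<infinity>"
    then have "summable (\<lambda>k. D k x)"
      by (intro summable_suminf_not_top) (auto simp: D_def)
    then have "summable (\<lambda>k. q (Suc k) x - q k x)"
      by (rule summable_norm_cancel[where f="\<lambda>k. q (Suc k) x - q k x", unfolded real_norm_def, folded D_def])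
    then have "convergent (\<lambda>n. \<Sum>k<n. q (Suc k) x - q k x)" by (simp add: summable_iff_convergent)
    moreover have "(\<Sum>k<n. q (Suc k) x - q k x) = q n x - q 0 x" for n
      by (rule sum_lessThan_telescope)
    ultimately have "convergent (\<lambda>n. q n x - q 0 x)" by simp
    then show "convergent (\<lambda>n. q n x)"
      using convergent_add[OF _ convergent_const, of "\<lambda>n. q n x - q 0 x" "q 0 x"] by simp
  qed
qed

text \<open>
  The sets \<open>C n\<close> are convex and decreasing. If \<open>q n\<close> nearly minimizes the norm on \<open>C n\<close>,
  then for \<open>k \<le> n\<close> the midpoint of \<open>q k\<close> and \<open>q n\<close> lies in \<open>C k\<close>, and the
  parallelogram identity bounds the distance of \<open>q k\<close> and \<open>q n\<close> by the increment of the
  minimal norms, which converge, and the tolerances. The pointwise bounds and the symmetry pass to the almost everywhere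
  limit.
\<close>

lemma weights_closed:
  assumes \<alpha>: "0 < \<alpha>" and approx: "\<And>n. \<exists>q\<in>weights \<alpha> \<beta>. \<forall>x\<in>{-pi..pi}. \<bar>primitive q x - P x\<bar> \<le> 1 / real (Suc n)"
  shows "\<exists>q\<in>weights \<alpha> \<beta>. \<forall>x\<in>{-pi..pi}. primitive q x = P x"
proof -
  define C where "C n = {q \<in> weights \<alpha> \<beta>. \<forall>x\<in>{-pi..pi}. \<bar>primitive q x - P x\<bar> \<le> 1 / real (Suc n)}" for n
  note wL = weights_L2[OF \<alpha>]
  have CL: "q \<in> L2" if "q \<in> C n" for q n using that wL by (auto simp: C_def)
  have Cne: "C n \<noteq> {}" for n using approx[of n] by (auto simp: C_def)
  have Cdec: "C n \<subseteq> C k" if "k \<le> n" for k n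
  proof
    fix q assume q: "q \<in> C n"
    have "1 / real (Suc n) \<le> 1 / real (Suc k)" using that by (intro divide_left_mono) auto
    then show "q \<in> C k" using q unfolding C_def by (auto intro: order_trans)
  qed
  have mid: "(\<lambda>x. (1/2) * (p x + q x)) \<in> C n" if pq: "p \<in> C n" "q \<in> C n" for p q n
  proof -
    have prim: "primitive (\<lambda>x. (1/2) * (p x + q x)) x = (1/2) * (primitive p x + primitive q x)" for x
      using primitive_cmult[of "1/2" "\<lambda>x. p x + q x" x] primitive_add[OF CL[OF pq(1)] CL[OF pq(2)]] by simp
    have avg: "\<bar>(1/2) * (u + v) - w\<bar> \<le> t" if "\<bar>u - w\<bar> \<le> t" "\<bar>v - w\<bar> \<le> t" for u v w t :: real
      using that unfolding abs_le_iff by (auto simp: field_simps)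
    have "\<bar>primitive (\<lambda>x. (1/2) * (p x + q x)) x - P x\<bar> \<le> 1 / real (Suc n)" if "x \<in> {-pi..pi}" for x
      unfolding prim by (rule avg) (use pq that in \<open>auto simp: C_def\<close>)
    then show ?thesis
      using pq weights_midpoint[OF \<alpha>, of p \<beta> q] unfolding C_def by blast
  qed
  have bnd: "ip2 q q \<le> 2 * pi * \<beta>\<^sup>2" if "q \<in> weights \<alpha> \<beta>" for q
  proof -
    have "ip2 q q \<le> (LINT x|beam_measure. \<beta>\<^sup>2)"
      unfolding ip2_self
    proof (rule integral_mono_AE)
      show "AE x in beam_measure. (q x)\<^sup>2 \<le> \<beta>\<^sup>2"
      proof -
        have "AE x in beam_measure. \<alpha> \<le> q x \<and> q x \<le> \<beta>" using that by (simp add: weights_def)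
        then show ?thesis by eventually_elim (use \<alpha> in \<open>auto intro!: power_mono\<close>)
      qed
    qed (use L2D(2)[OF wL[OF that]] in auto)
    then show ?thesis by simp
  qed
  define d where "d n = Inf ((\<lambda>q. ip2 q q) ` C n)" for n
  have bb: "bdd_below ((\<lambda>q. ip2 q q) ` C n)" for n
    using ip2_nonneg by (auto intro!: bdd_belowI[of _ 0])
  have dle: "d n \<le> ip2 q q" if "q \<in> C n" for q n
    unfolding d_def using that by (intro cInf_lower[OF _ bb]) auto
  have dinc: "incseq d"
  proof (rule incseq_SucI)
    fix n
    show "d n \<le> d (Suc n)"
      unfolding d_def by (rule cInf_superset_mono) (use Cne Cdec[of n "Suc n"] bb in auto)
  qed
  have "\<exists>q\<in>C n. ip2 q q < d n + 1 / real (Suc n)" for n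
    using cInf_lessD[of "(\<lambda>q. ip2 q q) ` C n" "d n + 1 / real (Suc n)"] Cne[of n] by (auto simp: d_def)
  then obtain q where q: "\<And>n. q n \<in> C n" and qd: "\<And>n. ip2 (q n) (q n) < d n + 1 / real (Suc n)"
    by metis
  have dub: "d n \<le> 2 * pi * \<beta>\<^sup>2" for n
    using dle[OF q[of n]] bnd[of "q n"] q[of n] by (simp add: C_def)
  obtain D where D: "d \<longlonglongrightarrow> D" "\<And>n. d n \<le> D"
    using incseq_convergent[OF dinc, of "2 * pi * \<beta>\<^sup>2"] dub by blast
  define \<epsilon> where "\<epsilon> n = 2 * (D - d n) + 4 * (1 / real (Suc n))" for n
  have diff: "(LINT x|beam_measure. (q n x - q k x)\<^sup>2) \<le> \<epsilon> k" if "k \<le> n" for k n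
  proof -
    define h where "h x = (1/2) * (q n x + q k x)" for x
    have "h \<in> C k" unfolding h_def using mid[OF _ q] Cdec[OF that] q by blast
    then have "d k \<le> ip2 h h" by (rule dle)
    moreover have "(LINT x|beam_measure. (q n x - q k x)\<^sup>2) = 2 * ip2 (q n) (q n) + 2 * ip2 (q k) (q k) - 4 * ip2 h h"
    proof -
      note L = L2D(2)[OF CL[OF q]] L2D(2)[OF CL[OF \<open>h \<in> C k\<close>]]
      have "(LINT x|beam_measure. (q n x - q k x)\<^sup>2)
          = (LINT x|beam_measure. 2 * (q n x)\<^sup>2 + 2 * (q k x)\<^sup>2 - 4 * (h x)\<^sup>2)"
        by (rule Bochner_Integration.integral_cong) (auto simp: h_def power2_eq_square algebra_simps)
      then show ?thesis unfolding ip2_self using L by simp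
    qed
    moreover have "1 / real (Suc n) \<le> 1 / real (Suc k)" using that by (intro divide_left_mono) auto
    moreover have "I \<le> 2 * (D - dk) + 4 * tk"
      if "dk \<le> i" "I = 2 * x + 2 * y - 4 * i" "tn \<le> tk" "x < dn + tn" "y < dk + tk" "dn \<le> D"
      for I dk dn i tk tn x y :: real
      using that by argo
    ultimately show ?thesis
      unfolding \<epsilon>_def using qd[of n] qd[of k] D(2)[of n] by blast
  qed
  have "(\<lambda>n. 2 * (D - d n) + 4 * (1 / real (Suc n))) \<longlonglongrightarrow> 2 * (D - D) + 4 * 0"
    by (intro tendsto_intros D(1) LIMSEQ_Suc[OF lim_1_over_n])
  then have \<epsilon>0: "\<epsilon> \<longlonglongrightarrow> 0" by (simp add: \<epsilon>_def[abs_def])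
  have ex: "\<exists>n>N. \<epsilon> n \<le> (1/4) ^ k" for N k
  proof -
    have "\<forall>\<^sub>F n in sequentially. \<epsilon> n < (1/4) ^ k" by (rule order_tendstoD(2)[OF \<epsilon>0]) simp
    then obtain M where "\<And>n. n \<ge> M \<Longrightarrow> \<epsilon> n < (1/4) ^ k" by (auto simp: eventually_sequentially)
    then show ?thesis by (intro exI[of _ "max M (Suc N)"]) (auto simp: less_imp_le)
  qed
  have "\<exists>s. \<forall>k. \<epsilon> (s k) \<le> (1/4) ^ k \<and> s k < s (Suc k)"
    by (rule dependent_nat_choice) (use ex in blast)+
  then obtain s where s: "\<And>k. \<epsilon> (s k) \<le> (1/4) ^ k" "\<And>k. s k < s (Suc k)" by blast
  have smono: "strict_mono s" using s(2) by (simp add: strict_mono_Suc_iff)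
  define r where "r k = q (s k)" for k
  have rw: "r k \<in> weights \<alpha> \<beta>" for k using q[of "s k"] by (simp add: r_def C_def)
  have rL: "r k \<in> L2" for k by (rule wL[OF rw])
  have conv: "AE x in beam_measure. convergent (\<lambda>k. r k x)"
  proof (rule L2_cauchy_AE_convergent[OF rL])
    fix k
    show "(LINT x|beam_measure. (r (Suc k) x - r k x)\<^sup>2) \<le> (1/4) ^ k"
      using diff[of "s k" "s (Suc k)"] s[of k] by (simp add: r_def)
  qed
  note [measurable] = L2D(1)[OF rL]
  define p where "p x = lim (\<lambda>k. r k x)" for x
  have pm: "p \<in> borel_measurable beam_measure"
    unfolding p_def[abs_def] by (rule borel_measurable_lim_metric) measurable
  have lim: "AE x in beam_measure. (\<lambda>k. r k x) \<longlonglongrightarrow> p x"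
    using conv by eventually_elim (simp add: p_def convergent_LIMSEQ_iff)
  have rb: "AE x in beam_measure. \<forall>k. \<alpha> \<le> r k x \<and> r k x \<le> \<beta>"
    unfolding AE_all_countable using rw by (auto simp: weights_def)
  have pb: "AE x in beam_measure. \<alpha> \<le> p x \<and> p x \<le> \<beta>"
    using lim rb by eventually_elim (blast intro: LIMSEQ_le_const LIMSEQ_le_const2)
  have "AE x in beam_measure. \<forall>k. r k x = r k (- x)"
    unfolding AE_all_countable using rw by (auto simp: weights_def)
  \<comment> \<open>Where the sequences at \<open>x\<close> and \<open>-x\<close> agree, so do their limits, whether or not they
    converge.\<close>
  then have peven: "AE x in beam_measure. p x = p (- x)"
    by eventually_elim (simp add: p_def)
  have prim: "primitive p x = P x" if x: "x \<in> {-pi..pi}" for x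
  proof -
    have "(\<lambda>k. primitive (r k) x) \<longlonglongrightarrow> primitive p x"
      unfolding primitive_def
    proof (rule integral_dominated_convergence[where w="\<lambda>_. \<beta>"])
      show "AE t in beam_measure. (\<lambda>k. if t < x then r k t else 0) \<longlonglongrightarrow> (if t < x then p t else 0)"
        using lim by eventually_elim auto
      show "AE t in beam_measure. norm (if t < x then r k t else 0) \<le> \<beta>" for k
        using rb by eventually_elim (use \<alpha> in \<open>auto intro: order_trans[of 0 \<alpha>]\<close>, smt (verit))
    qed (use pm in measurable)
    moreover have "(\<lambda>k. primitive (r k) x) \<longlonglongrightarrow> P x"
    proof (rule Lim_null_comparison[THEN LIM_zero_cancel])
      show "\<forall>\<^sub>F k in sequentially. norm (primitive (r k) x - P x) \<le> 1 / real (Suc (s k))"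
        using q x by (intro always_eventually) (auto simp: r_def C_def)
      show "(\<lambda>k. 1 / real (Suc (s k))) \<longlonglongrightarrow> 0"
        using LIMSEQ_subseq_LIMSEQ[OF LIMSEQ_Suc[OF lim_1_over_n] smono] by (simp add: o_def)
    qed
    ultimately show ?thesis by (rule LIMSEQ_unique)
  qed
  have "P pi = 2 * pi"
  proof -
    have "\<bar>2 * pi - P pi\<bar> \<le> 1 / real (Suc n)" for n
    proof -
      have "\<bar>primitive (q n) pi - P pi\<bar> \<le> 1 / real (Suc n)" "(LINT x|beam_measure. q n x) = 2 * pi"
        using q[of n] unfolding C_def weights_def by auto
      then show ?thesis by (simp add: primitive_right)
    qed
    then have "\<bar>2 * pi - P pi\<bar> \<le> 0"
      using LIMSEQ_le_const[OF LIMSEQ_Suc[OF lim_1_over_n], of "\<bar>2 * pi - P pi\<bar>"] by auto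
    then show ?thesis by simp
  qed
  then have "(LINT x|beam_measure. p x) = 2 * pi" using prim[of pi] by (simp add: primitive_right)
  then have "p \<in> weights \<alpha> \<beta>" using pm pb peven by (simp add: weights_def)
  then show ?thesis using prim by blast
qed

lemma weights_compact:
  assumes \<alpha>: "0 < \<alpha>" and p: "\<And>n. p n \<in> weights \<alpha> \<beta>"
  shows "\<exists>q\<in>weights \<alpha> \<beta>. \<exists>r. strict_mono (r :: nat \<Rightarrow> nat) \<and>
    (\<forall>e>0. \<exists>N. \<forall>n\<ge>N. \<forall>x\<in>{-pi..pi}. \<bar>primitive (p (r n)) x - primitive q x\<bar> \<le> e)"
proof -
  have pL: "p n \<in> L2" for n by (rule weights_L2[OF \<alpha> p])
  have pb: "AE x in beam_measure. \<alpha> \<le> p n x \<and> p n x \<le> \<beta>" for n using p[of n] by (simp add: weights_def)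
  define B where "B = \<bar>\<beta>\<bar> + 1"
  have B: "B > 0" "\<beta> \<le> B" "- B \<le> \<alpha>" using \<alpha> by (auto simp: B_def)
  have lip: "\<bar>primitive (p n) y - primitive (p n) x\<bar> \<le> B * \<bar>y - x\<bar>" if "x \<in> {-pi..pi}" "y \<in> {-pi..pi}" for n x y
  proof -
    have AE: "AE x in beam_measure. - B \<le> p n x \<and> p n x \<le> B"
      using pb[of n] by eventually_elim (use B in auto)
    have *: "\<bar>primitive (p n) y - primitive (p n) x\<bar> \<le> B * (y - x)"
      if "x \<in> {-pi..pi}" "y \<in> {-pi..pi}" "x \<le> y" for x y
      using primitive_lipschitz[OF pL AE, of x y] that by (auto simp: abs_le_iff)
    show ?thesis using *[of x y] *[of y x] that by (cases "x \<le> y") auto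
  qed
  obtain P r where "continuous_on {-pi..pi} P" and r: "strict_mono (r :: nat \<Rightarrow> nat)"
      and lim: "\<And>e. 0 < e \<Longrightarrow> \<exists>N. \<forall>n\<ge>N. \<forall>x\<in>{-pi..pi}. \<bar>primitive (p (r n)) x - P x\<bar> < e"
    by (rule lipschitz_sequence_compact[of "\<lambda>n. primitive (p n)", OF lip]) simp_all
  have "\<exists>q\<in>weights \<alpha> \<beta>. \<forall>x\<in>{-pi..pi}. primitive q x = P x"
  proof (rule weights_closed[OF \<alpha>])
    fix n
    obtain N where "\<forall>k\<ge>N. \<forall>x\<in>{-pi..pi}. \<bar>primitive (p (r k)) x - P x\<bar> < 1 / real (Suc n)"
      using lim[of "1 / real (Suc n)"] by auto
    then show "\<exists>q\<in>weights \<alpha> \<beta>. \<forall>x\<in>{-pi..pi}. \<bar>primitive q x - P x\<bar> \<le> 1 / real (Suc n)"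
      using p[of "r N"] by (intro bexI[of _ "p (r N)"] ballI less_imp_le) auto
  qed
  then obtain q where q: "q \<in> weights \<alpha> \<beta>" "\<And>x. x \<in> {-pi..pi} \<Longrightarrow> primitive q x = P x" by blast
  have "\<exists>N. \<forall>n\<ge>N. \<forall>x\<in>{-pi..pi}. \<bar>primitive (p (r n)) x - primitive q x\<bar> \<le> e" if e: "e > 0" for e
  proof -
    obtain N where "\<forall>n\<ge>N. \<forall>x\<in>{-pi..pi}. \<bar>primitive (p (r n)) x - P x\<bar> < e"
      using lim[OF e] by blast
    then show ?thesis using q(2) by (intro exI[of _ N]) (auto simp: less_imp_le)
  qed
  then show ?thesis using q(1) r by blast
qed

text \<open>
  Stated through the convergence of values alone. A sequence with values beyond every bound has no
  subsequence of convergent values, so \<open>F\<close> is bounded above.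
\<close>

lemma sequentially_compact_attains_sup:
  fixes F :: "'a \<Rightarrow> real"
  assumes "S \<noteq> {}"
    and cpt: "\<And>p. (\<And>n. p n \<in> S) \<Longrightarrow> \<exists>q\<in>S. \<exists>r. strict_mono (r :: nat \<Rightarrow> nat) \<and> (\<lambda>n. F (p (r n))) \<longlonglongrightarrow> F q"
  shows "\<exists>q\<in>S. \<forall>p\<in>S. F p \<le> F q"
proof -
  have bdd: "bdd_above (F ` S)"
  proof (rule ccontr)
    assume "\<not> bdd_above (F ` S)"
    then have "\<exists>p\<in>S. real n < F p" for n
      unfolding bdd_above_def by (auto simp: not_le)
    then obtain p where p: "\<And>n. p n \<in> S" "\<And>n. real n < F (p n)" by metis
    obtain q r where r: "strict_mono (r :: nat \<Rightarrow> nat)" and lim: "(\<lambda>n. F (p (r n))) \<longlonglongrightarrow> F q"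
      using cpt[of p, OF p(1)] by blast
    have "real n \<le> F (p (r n))" for n
      using p(2)[of "r n"] seq_suble[OF r, of n] by linarith
    then have "filterlim (\<lambda>n. F (p (r n))) at_top sequentially"
      by (intro filterlim_at_top_mono[OF filterlim_real_sequentially] always_eventually) auto
    then show False using lim not_tendsto_and_filterlim_at_infinity[of sequentially]
      by (metis filterlim_at_top_imp_at_infinity sequentially_bot)
  qed
  have "\<exists>p\<in>S. Sup (F ` S) - 1 / real (Suc n) < F p" for n
    using less_cSup_iff[of "F ` S" "Sup (F ` S) - 1 / real (Suc n)"] bdd assms(1) by auto
  then obtain p where p: "\<And>n. p n \<in> S" "\<And>n. Sup (F ` S) - 1 / real (Suc n) < F (p n)" by metis
  obtain q r where q: "q \<in> S" and r: "strict_mono (r :: nat \<Rightarrow> nat)" and lim: "(\<lambda>n. F (p (r n))) \<longlonglongrightarrow> F q"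
    using cpt[of p, OF p(1)] by blast
  have "(\<lambda>n. Sup (F ` S) - 1 / real (Suc n)) \<longlonglongrightarrow> Sup (F ` S) - 0"
    by (intro tendsto_intros LIMSEQ_Suc[OF lim_1_over_n])
  from LIMSEQ_subseq_LIMSEQ[OF this r]
  have "Sup (F ` S) - 0 \<le> F q"
    by (rule LIMSEQ_le[OF _ lim]) (use p(2) in \<open>auto intro: less_imp_le\<close>)
  then have "F s \<le> F q" if "s \<in> S" for s
    using cSup_upper[OF imageI[OF that] bdd] by simp
  then show ?thesis using q by blast
qed

theorem proposition3p3:
  fixes \<alpha> \<beta> a :: real and j k :: nat
  assumes "0 < \<alpha>" and "\<alpha> < 1" and "1 < \<beta>"
    and "0 < a" and "a < 1"
    and "1 \<le> k" and "k < j"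
  shows "\<exists>p_hat \<in> weights \<alpha> \<beta>. \<forall>p \<in> weights \<alpha> \<beta>.
           nth_eigenvalue a p j / nth_eigenvalue a p k
             \<le> nth_eigenvalue a p_hat j / nth_eigenvalue a p_hat k"
proof (rule sequentially_compact_attains_sup)
  have "(\<lambda>_. 1) \<in> weights \<alpha> \<beta>"
    using assms by (simp add: weights_def)
  then show "weights \<alpha> \<beta> \<noteq> {}" by blast
next
  fix p :: "nat \<Rightarrow> real \<Rightarrow> real" assume p: "\<And>n. p n \<in> weights \<alpha> \<beta>"
  obtain q r where q: "q \<in> weights \<alpha> \<beta>" and r: "strict_mono (r :: nat \<Rightarrow> nat)"
    and lim: "\<And>e. e > 0 \<Longrightarrow> \<exists>N. \<forall>n\<ge>N. \<forall>x\<in>{-pi..pi}. \<bar>primitive (p (r n)) x - primitive q x\<bar> \<le> e"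
    using weights_compact[of \<alpha> p \<beta>, OF assms(1) p] by metis
  have conv: "(\<lambda>n. nth_eigenvalue a (p (r n)) (Suc i)) \<longlonglongrightarrow> nth_eigenvalue a q (Suc i)"
    and pos: "0 < nth_eigenvalue a q (Suc i)" for i
  proof -
    show pos: "0 < nth_eigenvalue a q (Suc i)"
      by (rule eigenvalue_lipschitz(1)[OF assms(1,4,5) q q, of 0]) simp
    have "(\<lambda>n. 1 / nth_eigenvalue a (p (r n)) (Suc i)) \<longlonglongrightarrow> 1 / nth_eigenvalue a q (Suc i)"
    proof (rule LIMSEQ_I)
      fix e :: real assume "0 < e"
      define d where "d = e / (64 * pi ^ 3)"
      have d: "d > 0" "32 * pi ^ 3 * d < e" using \<open>0 < e\<close> by (auto simp: d_def)
      obtain N where N: "\<And>n x. n \<ge> N \<Longrightarrow> x \<in> {-pi..pi} \<Longrightarrow> \<bar>primitive (p (r n)) x - primitive q x\<bar> \<le> d"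
        using lim[OF d(1)] by blast
      have "norm (1 / nth_eigenvalue a (p (r n)) (Suc i) - 1 / nth_eigenvalue a q (Suc i)) < e" if "n \<ge> N" for n
        using eigenvalue_lipschitz(2)[OF assms(1,4,5) p q, of "r n" d i] N[OF that] d by simp
      then show "\<exists>no. \<forall>n\<ge>no. norm (1 / nth_eigenvalue a (p (r n)) (Suc i) - 1 / nth_eigenvalue a q (Suc i)) < e"
        by blast
    qed
    from tendsto_inverse[OF this] show "(\<lambda>n. nth_eigenvalue a (p (r n)) (Suc i)) \<longlonglongrightarrow> nth_eigenvalue a q (Suc i)"
      using pos by (simp add: inverse_eq_divide)
  qed
  obtain i i' where "j = Suc i" "k = Suc i'"
    using assms(6,7) by (metis Suc_le_D One_nat_def less_imp_Suc_add)
  then have "(\<lambda>n. nth_eigenvalue a (p (r n)) j / nth_eigenvalue a (p (r n)) k)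
      \<longlonglongrightarrow> nth_eigenvalue a q j / nth_eigenvalue a q k"
    using conv[of i] conv[of i'] pos[of i'] by (simp add: tendsto_divide)
  then show "\<exists>q\<in>weights \<alpha> \<beta>. \<exists>r. strict_mono (r :: nat \<Rightarrow> nat) \<and>
      (\<lambda>n. nth_eigenvalue a (p (r n)) j / nth_eigenvalue a (p (r n)) k)
        \<longlonglongrightarrow> nth_eigenvalue a q j / nth_eigenvalue a q k"
    using q r by blast
qed

end
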